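(* For all $g\ge 0$ and $n\ge 0$, $$(2g+1)\,\alpha_g(n,2)=\alpha^{(3)}_{g-1}(n,2)+\sum_{\substack{g_1+g_2=g\\ g_1,g_2\ge 0}}\ \sum_{\substack{i+j=n\\ i,j\ge 0}}\alpha^{(1)}_{g_1}(i,1)\,\alpha^{(1)}_{g_2}(j,1),$$ where $\alpha_g(n,f)$ is the number of precubic maps of genus $g$ with $n$ edges and $f$ faces, and $\alpha^{(k)}_g(n,f)$ is the number of such maps together with an (unordered) set of $k$ distinct marked leaves, with $\alpha^{(3)}_{-1}(n,2)=0$.
   Context: A map is a connected multigraph (loops and multiple edges allowed) embedded in a compact connected oriented surface so that the complement is a disjoint union of open disks (the faces), considered up to (orientation-preserving) homeomorphism; its genus is that of the surface. A rooted map is a map with a distinguished corner (angular sector between two consecutive half-edges around a vertex). A precubic map is a rooted map all of whose vertices have degree $1$ or $3$, rooted at a vertex of degree $1$. A leaf is a vertex of degree $1$ that is not the root vertex. *)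

theory Defs
  imports "HOL-Combinatorics.Combinatorics"
begin

(* Maps on oriented surfaces are encoded by rotation systems.  The darts are the half-edges:
   opp exchanges the two halves of each edge, and rot sends a half-edge to the next one in
   counterclockwise order around its vertex.  The corners correspond to the darts (the corner
   following a half-edge), so the root corner is given by a dart.  Gluing a disk along each
   cycle of rot o opp gives the surface, and two maps are homeomorphic by an
   orientation-preserving homeomorphism iff their rotation systems are conjugate.
   The only map without a half-edge is the one-vertex map on the sphere; its vertex has
   degree 0, so nothing is lost by requiring a root dart. *)

record 'd rooted_map =
  darts :: "'d set"
  rot :: "'d \<Rightarrow> 'd"
  opp :: "'d \<Rightarrow> 'd"
  root :: 'd

definition vertices :: "'d rooted_map \<Rightarrow> 'd set set" where
  "vertices m = orbit (rot m) ` darts m"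

definition edges :: "'d rooted_map \<Rightarrow> 'd set set" where
  "edges m = orbit (opp m) ` darts m"

definition faces :: "'d rooted_map \<Rightarrow> 'd set set" where
  "faces m = orbit (rot m \<circ> opp m) ` darts m"

definition is_rooted_map :: "'d rooted_map \<Rightarrow> bool" where
  "is_rooted_map m \<longleftrightarrow>
     finite (darts m) \<and>
     rot m permutes darts m \<and>
     opp m permutes darts m \<and>
     (\<forall>d\<in>darts m. opp m d \<noteq> d \<and> opp m (opp m d) = d) \<and>
     root m \<in> darts m \<and>
     (\<forall>x\<in>darts m. \<forall>y\<in>darts m.
        (x, y) \<in> ({(d, rot m d) | d. d \<in> darts m} \<union> {(d, opp m d) | d. d \<in> darts m})\<^sup>*)"

(* Euler's formula; the faces are disks, so this is the genus of the surface. *)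
definition has_genus :: "'d rooted_map \<Rightarrow> nat \<Rightarrow> bool" where
  "has_genus m g \<longleftrightarrow>
     int (card (vertices m)) - int (card (edges m)) + int (card (faces m)) = 2 - 2 * int g"

(* A vertex is the set of its half-edges, so its degree is its cardinality
   (a loop contributes 2). *)
definition is_precubic :: "'d rooted_map \<Rightarrow> bool" where
  "is_precubic m \<longleftrightarrow>
     is_rooted_map m \<and>
     (\<forall>v\<in>vertices m. card v = 1 \<or> card v = 3) \<and>
     card (orbit (rot m) (root m)) = 1"

definition leaves :: "'d rooted_map \<Rightarrow> 'd set set" where
  "leaves m = {v \<in> vertices m. card v = 1 \<and> root m \<notin> v}"

definition is_map_iso :: "('d \<Rightarrow> 'e) \<Rightarrow> 'd rooted_map \<Rightarrow> 'e rooted_map \<Rightarrow> bool" where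
  "is_map_iso h m m' \<longleftrightarrow>
     bij_betw h (darts m) (darts m') \<and>
     (\<forall>d\<in>darts m. h (rot m d) = rot m' (h d) \<and> h (opp m d) = opp m' (h d)) \<and>
     h (root m) = root m'"

(* Every map with n edges is isomorphic to one whose darts are {..<2 * n}, so counting maps
   up to isomorphism amounts to counting isomorphism classes on this fixed set of darts. *)
definition precubic_maps :: "nat \<Rightarrow> nat \<Rightarrow> nat \<Rightarrow> nat rooted_map set" where
  "precubic_maps g n f =
     {m. is_precubic m \<and> darts m = {..<2 * n} \<and>
         has_genus m g \<and> card (edges m) = n \<and> card (faces m) = f}"

definition map_iso_rel :: "(nat rooted_map \<times> nat rooted_map) set" where
  "map_iso_rel = {(m, m'). \<exists>h. is_map_iso h m m'}"

definition num_precubic :: "nat \<Rightarrow> nat \<Rightarrow> nat \<Rightarrow> nat" where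
  "num_precubic g n f =
     card (precubic_maps g n f // Restr map_iso_rel (precubic_maps g n f))"

definition marked_precubic_maps ::
  "nat \<Rightarrow> nat \<Rightarrow> nat \<Rightarrow> nat \<Rightarrow> (nat rooted_map \<times> nat set set) set" where
  "marked_precubic_maps k g n f =
     {(m, L). m \<in> precubic_maps g n f \<and> L \<subseteq> leaves m \<and> card L = k}"

definition marked_map_iso_rel ::
  "((nat rooted_map \<times> nat set set) \<times> (nat rooted_map \<times> nat set set)) set" where
  "marked_map_iso_rel =
     {((m, L), (m', L')). \<exists>h. is_map_iso h m m' \<and> (\<lambda>v. h ` v) ` L = L'}"

definition num_marked_precubic :: "nat \<Rightarrow> nat \<Rightarrow> nat \<Rightarrow> nat \<Rightarrow> nat" where
  "num_marked_precubic k g n f =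
     card (marked_precubic_maps k g n f //
           Restr marked_map_iso_rel (marked_precubic_maps k g n f))"

end

(* Rooted maps whose rotation has order three are read as words: the darts of a rooted face in
   the order of the face.  If the darts f, s, t of a vertex appear in the order opposite to the
   rotation, the vertex can be cut into three leaves without changing the number of faces or
   edges, and any three leaves can be glued back.  Counting such vertices through the descents
   of the word gives a recurrence for maps with one face, and one for pairs of rooted faces,
   connected or not, in which the three leaves may be distributed over both faces.

   Let F n x y count connected two-face maps with a root leaf in each face and x, y leaves in the
   faces, and B i x count one-face maps with a marked leaf besides the root and x further leaves.
   Taking second differences of the recurrence along x + y = const makes the mixed terms
   telescope and yields n (F n (x+1) y - F n x (y+1)) = sum over i + j = n of
   (j - i) B i x B j y.  Together with the effect of adding a leaf this gives a refinement of the
   theorem by the numbers of leaves in the two faces, as long as both faces contain a leaf.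
   If the second face contains none, the defect of the refined formula gets multiplied by 2n/L
   when a leaf is added, but the quantities it is made of grow by a factor of at most (2n-1)/L;
   hence the defect vanishes.  Summing over the distributions of the leaves proves the theorem. *)

theory Submission
  imports Defs
begin

section \<open>Rotation systems and faces as words\<close>

text \<open>Along a word a vertex of degree three gives one weak descent of the rotation if its
  darts follow the word cyclically and two if they are reversed, while the total is the number of
  edges plus the number of roots. So the number of reversed vertices depends only on edges and
  leaves; by Euler's formula it is 2g for one face, 2g + 2 for a connected pair of rooted faces and
  2(g1 + g2) for two separate maps. Faces are rooted at leaves because the closing step of a face
  then arrives at a fixed point of the rotation. The obstacle is a vertex with darts in both faces:
  cutting it carries a block with any number of leaves from one face to the other, so all
  distributions of a given number of leaves are coupled. The refined formula weights a pair of
  one-face maps with i and n - i edges by 2i/n; only after summing over all distributions does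
  exchanging the two maps turn this weight into 1. Counts are divided by the factorial of the number
  of darts, which turns labelled disjoint unions into convolutions.\<close>

definition cubic_pair :: "nat set \<Rightarrow> (nat \<Rightarrow> nat) \<Rightarrow> (nat \<Rightarrow> nat) \<Rightarrow> bool" where
  "cubic_pair D rt op \<longleftrightarrow> rt permutes D \<and> op permutes D \<and>
     (\<forall>d\<in>D. op d \<noteq> d \<and> op (op d) = d) \<and> (\<forall>d\<in>D. rt (rt (rt d)) = d)"

abbreviation path :: "('a \<Rightarrow> 'a) \<Rightarrow> 'a list \<Rightarrow> bool" where
  "path p \<equiv> successively (\<lambda>a b. p a = b)"

definition face_list :: "('a \<Rightarrow> 'a) \<Rightarrow> 'a \<Rightarrow> 'a list \<Rightarrow> bool" where
  "face_list p r us \<longleftrightarrow> distinct (r # us) \<and> path p (r # us @ [r])"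

text \<open>Composed with a rotation that fixes the three darts, this cycle creates a vertex whose
  rotation runs against the order f, s, t. The cycle with the last two arguments exchanged is its
  inverse.\<close>

definition cyc3 :: "'a \<Rightarrow> 'a \<Rightarrow> 'a \<Rightarrow> 'a \<Rightarrow> 'a" where
  "cyc3 f s t d = (if d = f then t else if d = t then s else if d = s then f else d)"

definition num_fix :: "('a \<Rightarrow> 'a) \<Rightarrow> 'a list \<Rightarrow> nat" where
  "num_fix p xs = length (filter (\<lambda>d. p d = d) xs)"

lemma num_fix_simps [simp]:
  "num_fix p [] = 0"
  "num_fix p (x # xs) = (if p x = x then Suc (num_fix p xs) else num_fix p xs)"
  "num_fix p (xs @ ys) = num_fix p xs + num_fix p ys"
  by (auto simp: num_fix_def)

lemma num_fix_cong: "(\<And>d. d \<in> set xs \<Longrightarrow> p d = d \<longleftrightarrow> q d = d) \<Longrightarrow> num_fix p xs = num_fix q xs"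
  unfolding num_fix_def by (intro arg_cong[of _ _ length] filter_cong refl)

lemma path_split: "path p (xs @ a # ys) \<longleftrightarrow> path p (xs @ [a]) \<and> path p (a # ys)"
  by (auto simp: successively_append_iff successively_Cons)

lemma path_two: "path p (a # xs @ b # ys) \<longleftrightarrow> path p (a # xs @ [b]) \<and> path p (b # ys)"
  using path_split[of p "a # xs" b ys] by simp

lemma cyc3_inv:
  assumes "f \<noteq> s" "s \<noteq> t" "f \<noteq> t"
  shows "cyc3 f t s (cyc3 f s t d) = d" "cyc3 f s t (cyc3 f t s d) = d"
  using assms by (auto simp: cyc3_def)

lemma cyc3_permutes:
  assumes "f \<in> D" "s \<in> D" "t \<in> D" "f \<noteq> s" "s \<noteq> t" "f \<noteq> t"
  shows "cyc3 f s t permutes D"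
proof -
  have "cyc3 f s t = transpose f s \<circ> transpose f t"
    using assms by (auto simp: cyc3_def fun_eq_iff transpose_def)
  moreover have "transpose f s \<circ> transpose f t permutes D"
    using assms by (intro permutes_compose permutes_swap_id)
  ultimately show ?thesis by simp
qed

text \<open>Inside a stretch that avoids the three darts both permutations take the same steps; only
  the arrival at the last dart is redirected.\<close>

lemma path_cyc3:
  assumes dist: "f \<noteq> s" "s \<noteq> t" "f \<noteq> t" and int: "set xs \<inter> {f, s, t} = {}"
    and q: "\<And>d. q d = cyc3 f s t (p d)"
  shows "path q (x # xs @ [cyc3 f s t a]) \<longleftrightarrow> path p (x # xs @ [a])"
  using int
proof (induction xs arbitrary: x)
  case Nil
  show ?case using q dist by (auto simp: cyc3_def)
next
  case (Cons y ys)
  have "q x = y \<longleftrightarrow> p x = y" using q Cons.prems dist by (auto simp: cyc3_def)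
  then show ?case using Cons.IH[of y] Cons.prems by (simp add: successively_Cons)
qed

text \<open>Gluing the leaves \<open>f\<close>, \<open>s\<close>, \<open>t\<close>, which is inverse to cutting a vertex of degree three.\<close>

lemma cubic_pair_glue:
  assumes "cubic_pair D rt op" "f \<in> D" "s \<in> D" "t \<in> D" "f \<noteq> s" "s \<noteq> t" "f \<noteq> t"
    and "rt f = f" "rt s = s" "rt t = t"
  shows "cubic_pair D (cyc3 f s t \<circ> rt) op"
proof -
  have inj: "inj rt" using assms(1) by (auto simp: cubic_pair_def intro: permutes_inj)
  have "(cyc3 f s t \<circ> rt) permutes D"
    using assms cyc3_permutes[of f D s t] by (auto simp: cubic_pair_def intro: permutes_compose)
  moreover have "(cyc3 f s t \<circ> rt) ((cyc3 f s t \<circ> rt) ((cyc3 f s t \<circ> rt) d)) = d" if "d \<in> D" for d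
  proof (cases "d \<in> {f, s, t}")
    case True
    moreover have "(cyc3 f s t \<circ> rt) f = t" "(cyc3 f s t \<circ> rt) s = f" "(cyc3 f s t \<circ> rt) t = s"
      using assms(5-10) by (simp_all add: cyc3_def)
    ultimately show ?thesis by (smt (verit) insertE singletonD)
  next
    case False
    moreover have "rt ` {f, s, t} = {f, s, t}" using assms(8-10) by auto
    ultimately have "rt d \<notin> {f,s,t}" "rt (rt d) \<notin> {f,s,t}"
      using inj_image_mem_iff[OF inj, of _ "{f, s, t}"] by metis+
    then have "cyc3 f s t (rt d) = rt d" "cyc3 f s t (rt (rt d)) = rt (rt d)"
      by (simp_all add: cyc3_def)
    moreover have "rt (rt (rt d)) = d" using assms(1) that by (auto simp: cubic_pair_def)
    moreover have "cyc3 f s t d = d" using False by (simp add: cyc3_def)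
    ultimately show ?thesis by simp
  qed
  ultimately show ?thesis using assms(1) by (auto simp: cubic_pair_def)
qed

lemma cubic_pair_cut:
  assumes "cubic_pair D rt op" "f \<in> D" "s \<in> D" "t \<in> D" "f \<noteq> s" "s \<noteq> t" "f \<noteq> t"
    and "rt f = t" "rt t = s" "rt s = f"
  shows "cubic_pair D (cyc3 f t s \<circ> rt) op"
proof -
  have inj: "inj rt" using assms(1) by (auto simp: cubic_pair_def intro: permutes_inj)
  have "(cyc3 f t s \<circ> rt) permutes D"
    using assms cyc3_permutes[of f D t s] by (auto simp: cubic_pair_def intro: permutes_compose)
  moreover have "(cyc3 f t s \<circ> rt) ((cyc3 f t s \<circ> rt) ((cyc3 f t s \<circ> rt) d)) = d" if "d \<in> D" for d
  proof (cases "d \<in> {f, s, t}")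
    case True
    moreover have "(cyc3 f t s \<circ> rt) f = f" "(cyc3 f t s \<circ> rt) s = s" "(cyc3 f t s \<circ> rt) t = t"
      using assms(5-10) by (simp_all add: cyc3_def)
    ultimately show ?thesis by force
  next
    case False
    moreover have "rt ` {f, s, t} = {f, s, t}" using assms(8-10) by auto
    ultimately have "rt d \<notin> {f,s,t}" "rt (rt d) \<notin> {f,s,t}"
      using inj_image_mem_iff[OF inj, of _ "{f, s, t}"] by metis+
    then have "cyc3 f t s (rt d) = rt d" "cyc3 f t s (rt (rt d)) = rt (rt d)"
      by (simp_all add: cyc3_def)
    moreover have "rt (rt (rt d)) = d" using assms(1) that by (auto simp: cubic_pair_def)
    moreover have "cyc3 f t s d = d" using False by (simp add: cyc3_def)
    ultimately show ?thesis by simp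
  qed
  ultimately show ?thesis using assms(1) by (auto simp: cubic_pair_def)
qed

lemma glue_cut:
  assumes "f \<noteq> s" "s \<noteq> t" "f \<noteq> t"
  shows "cyc3 f t s \<circ> (cyc3 f s t \<circ> rt) = rt" "cyc3 f s t \<circ> (cyc3 f t s \<circ> rt) = rt"
  by (rule ext, simp add: cyc3_inv[OF assms])+

lemma glue_iff:
  fixes rt :: "nat \<Rightarrow> nat"
  assumes "f \<in> D" "s \<in> D" "t \<in> D" "f \<noteq> s" "s \<noteq> t" "f \<noteq> t"
  defines "rt' \<equiv> cyc3 f s t \<circ> rt"
  shows "cubic_pair D rt' op \<and> rt' f = t \<and> rt' t = s \<and> rt' s = f
     \<longleftrightarrow> cubic_pair D rt op \<and> rt f = f \<and> rt s = s \<and> rt t = t" (is "?l \<longleftrightarrow> ?r")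
proof
  assume l: ?l
  have eq: "cyc3 f t s \<circ> rt' = rt"
    unfolding rt'_def by (rule glue_cut(1)[OF assms(4-6)])
  have "cubic_pair D (cyc3 f t s \<circ> rt') op"
    using l by (intro cubic_pair_cut assms) blast+
  moreover have "(cyc3 f t s \<circ> rt') f = f" "(cyc3 f t s \<circ> rt') s = s" "(cyc3 f t s \<circ> rt') t = t"
    using l assms(4-6) by (simp_all add: cyc3_def)
  ultimately show ?r unfolding eq by blast
next
  assume r: ?r
  have "cubic_pair D rt' op"
    unfolding rt'_def using r by (intro cubic_pair_glue assms) blast+
  moreover have "rt' f = t" "rt' t = s" "rt' s = f"
    using r assms(4-6) by (simp_all add: rt'_def cyc3_def)
  ultimately show ?l by blast
qed

lemma num_fix_glue:
  assumes "f \<noteq> s" "s \<noteq> t" "f \<noteq> t" "rt f = f" "rt s = s" "rt t = t" "inj rt"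
    and "set xs \<inter> {f, s, t} = {}"
  shows "num_fix (cyc3 f s t \<circ> rt) xs = num_fix rt xs"
proof (rule num_fix_cong)
  fix d assume "d \<in> set xs"
  then have d: "d \<notin> {f, s, t}" using assms(8) by auto
  moreover have "rt ` {f, s, t} = {f, s, t}" using assms(4-6) by auto
  ultimately have "rt d \<notin> {f, s, t}"
    using inj_image_mem_iff[OF assms(7), of _ "{f, s, t}"] by metis
  then have "cyc3 f s t (rt d) = rt d" by (simp add: cyc3_def)
  then show "(cyc3 f s t \<circ> rt) d = d \<longleftrightarrow> rt d = d" by simp
qed

section \<open>Descents of the rotation along a word\<close>

lemma sum_rot3:
  fixes h :: "'a \<Rightarrow> nat"
  assumes "p permutes D"
  shows "(\<Sum>d\<in>D. h d + h (p d) + h (p (p d))) = 3 * (\<Sum>d\<in>D. h d)"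
proof -
  have *: "(\<Sum>d\<in>D. k (p d)) = (\<Sum>d\<in>D. k d)" for k :: "'a \<Rightarrow> nat"
    using sum.permute[OF assms, of k] by (simp add: comp_def)
  show ?thesis using *[of h] *[of "\<lambda>d. h (p d)"] by (simp add: sum.distrib)
qed

lemma sum_add_one_add_double:
  "(\<Sum>d\<in>D. a d + 1 + 2 * b d) = (\<Sum>d\<in>D. a d) + card D + 2 * (\<Sum>d\<in>D. b d :: nat)"
proof -
  have "(\<Sum>d\<in>D. a d + 1 + 2 * b d) = (\<Sum>d\<in>D. a d) + (\<Sum>d\<in>D. 1) + (\<Sum>d\<in>D. 2 * b d)"
    by (simp only: sum.distrib)
  then show ?thesis by (simp add: sum_distrib_left)
qed

text \<open>Going once around a vertex of degree three, the position drops once or twice, and twice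
  exactly when the vertex is reversed. The left set picks the dart of highest position, so each
  reversed vertex appears once.\<close>

lemma reversed_count:
  assumes cp: "cubic_pair D rt op" and fin: "finite D" and inj: "inj_on pos D"
  shows "3 * card {d \<in> D. pos (rt (rt d)) < pos (rt d) \<and> pos (rt d) < (pos d :: nat)}
           + card D + 2 * card {d \<in> D. rt d = d} = 3 * card {d \<in> D. pos (rt d) \<le> pos d}"
proof -
  let ?g = "\<lambda>d. if pos (rt d) \<le> pos d then 1 else 0 :: nat"
  let ?r = "\<lambda>d. if pos (rt (rt d)) < pos (rt d) \<and> pos (rt d) < pos d then 1 else 0 :: nat"
  let ?f = "\<lambda>d. if rt d = d then 1 else 0 :: nat"
  have perm: "rt permutes D" using cp by (simp add: cubic_pair_def)
  have card_sum: "card {d \<in> D. P d} = (\<Sum>d\<in>D. if P d then 1 else 0)" for P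
    using fin by (simp add: sum.If_cases Int_def)
  \<comment> \<open>Both sides add up over a full turn, hence every vertex of degree three is seen
    three times in the sum over \<open>D\<close>. At a leaf all three terms on the right are 1,
    which the summand \<open>2 * ?f d\<close> compensates.\<close>
  have pt: "?r d + ?r (rt d) + ?r (rt (rt d)) + 1 + 2 * ?f d = ?g d + ?g (rt d) + ?g (rt (rt d))"
    if d: "d \<in> D" for d
  proof -
    have c: "rt (rt (rt d)) = d" using cp d by (simp add: cubic_pair_def)
    have in1: "rt d \<in> D" and in2: "rt (rt d) \<in> D" using perm d by (simp_all add: permutes_in_image)
    show ?thesis
    proof (cases "rt d = d")
      case True
      then show ?thesis by simp
    next
      case False
      then have n: "rt (rt d) \<noteq> d" "rt (rt d) \<noteq> rt d"
        using c permutes_inj[OF perm] by (metis injD)+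
      have "pos d \<noteq> pos (rt d)" "pos d \<noteq> pos (rt (rt d))" "pos (rt d) \<noteq> pos (rt (rt d))"
        using inj d in1 in2 False n by (metis inj_onD)+
      then show ?thesis using False c by auto
    qed
  qed
  have "(\<Sum>d\<in>D. ?r d + ?r (rt d) + ?r (rt (rt d)) + 1 + 2 * ?f d)
      = (\<Sum>d\<in>D. ?g d + ?g (rt d) + ?g (rt (rt d)))"
    by (rule sum.cong[OF refl pt])
  moreover have "(\<Sum>d\<in>D. ?g d + ?g (rt d) + ?g (rt (rt d))) = 3 * (\<Sum>d\<in>D. ?g d)"
    by (rule sum_rot3[OF perm])
  moreover have "(\<Sum>d\<in>D. ?r d + ?r (rt d) + ?r (rt (rt d)) + 1 + 2 * ?f d)
      = 3 * (\<Sum>d\<in>D. ?r d) + card D + 2 * (\<Sum>d\<in>D. ?f d)"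
    unfolding sum_rot3[OF perm, of ?r, symmetric] by (rule sum_add_one_add_double)
  ultimately show ?thesis unfolding card_sum by linarith
qed

lemma lower_half_card:
  assumes "finite D" "\<And>d. d \<in> D \<Longrightarrow> op d \<in> D \<and> op d \<noteq> d \<and> op (op d) = d"
    and "inj_on pos D" "card D = 2 * n"
  shows "card {d \<in> D. pos (op d) < (pos d :: nat)} = n"
proof -
  let ?A = "{d \<in> D. pos (op d) < pos d}" and ?B = "{d \<in> D. pos d < pos (op d)}"
  have "bij_betw op ?A ?B"
    by (rule bij_betw_byWitness[where f' = op]) (use assms(2) in auto)
  then have "card ?A = card ?B" by (rule bij_betw_same_card)
  moreover have "?A \<inter> ?B = {}" by auto
  moreover have "D = ?A \<union> ?B"
  proof -
    have "pos (op d) \<noteq> pos d" if "d \<in> D" for d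
      using assms(2)[OF that] that inj_onD[OF assms(3), of "op d" d] by auto
    then show ?thesis by (auto simp: nat_neq_iff)
  qed
  ultimately have "card D = 2 * card ?A"
    using assms(1) by (metis (no_types, lifting) card_Un_disjoint finite_Un mult_2)
  then show ?thesis using assms(4) by simp
qed

text \<open>In a face word \<open>rt d\<close> stands directly after \<open>op d\<close>, so whether
  the rotation drops at \<open>d\<close> is decided by the edge of \<open>d\<close>, and each edge
  has exactly one dart that comes later than its partner. The set \<open>X\<close> holds the roots,
  which are weak descents of the rotation but not the later halves of their edges.\<close>

lemma descents_card:
  assumes "finite D" "\<And>d. d \<in> D \<Longrightarrow> op d \<in> D \<and> op d \<noteq> d \<and> op (op d) = d"
    and "inj_on pos D" "card D = 2 * n" "X \<subseteq> D"
    and "\<And>d. d \<in> D - X \<Longrightarrow> pos (rt d) \<le> (pos d :: nat) \<longleftrightarrow> pos (op d) < pos d"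
    and "\<And>d. d \<in> X \<Longrightarrow> pos (rt d) \<le> pos d \<and> pos d \<le> pos (op d)"
  shows "card {d \<in> D. pos (rt d) \<le> pos d} = n + card X"
proof -
  have "{d \<in> D. pos (rt d) \<le> pos d} = {d \<in> D. pos (op d) < pos d} \<union> X"
    using assms(5-7) by fastforce
  moreover have "{d \<in> D. pos (op d) < pos d} \<inter> X = {}"
    using assms(7) by fastforce
  moreover have "finite X" using assms(1,5) by (rule rev_finite_subset)
  ultimately show ?thesis
    using lower_half_card[OF assms(1-4)] assms(1) by (simp add: card_Un_disjoint)
qed

section \<open>Positions in a word\<close>

definition idx :: "'a list \<Rightarrow> 'a \<Rightarrow> nat" where
  "idx zs d = length (takeWhile (\<lambda>x. x \<noteq> d) zs)"

lemma idx_append [simp]: "d \<notin> set A \<Longrightarrow> idx (A @ B) d = length A + idx B d"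
  by (simp add: idx_def takeWhile_append)

lemma idx_append1: "d \<in> set A \<Longrightarrow> idx (A @ B) d = idx A d"
  by (auto simp: idx_def takeWhile_append)

lemma idx_Cons [simp]: "idx (d # B) d = 0" "a \<noteq> d \<Longrightarrow> idx (a # B) d = Suc (idx B d)"
  by (simp_all add: idx_def)

lemma idx_less: "d \<in> set zs \<Longrightarrow> idx zs d < length zs"
  by (induction zs) (auto simp: idx_def)

lemma nth_idx: "d \<in> set zs \<Longrightarrow> zs ! idx zs d = d"
  by (induction zs) (auto simp: idx_def)

lemma inj_on_idx: "inj_on (idx zs) (set zs)"
  by (metis inj_onI nth_idx)

lemma path_next:
  assumes "path p (xs @ [a])" "e \<in> set xs" "xs = ys @ [l]" "e \<noteq> l"
  obtains A B where "xs = A @ e # p e # B"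
proof -
  obtain A C where C: "xs = A @ e # C" using assms(2) by (meson split_list)
  have "C \<noteq> []" using C assms(3,4) by auto
  then obtain c B where "C = c # B" by (cases C) auto
  moreover have "p e = c" using assms(1) C \<open>C = c # B\<close> by (simp add: successively_append_iff)
  ultimately show ?thesis using that C by blast
qed

lemma path_last: "path p (xs @ [l] @ [a]) \<Longrightarrow> p l = a"
  by (simp add: successively_append_iff)

lemma face_list_next:
  assumes "face_list p r us" "e \<in> set (r # us)"
  shows "p e = r \<and> e = last (r # us) \<or> (\<exists>A B. r # us = A @ e # p e # B)"
proof -
  obtain b l where bl: "r # us = b @ [l]" by (metis rev_exhaust list.distinct(1))
  have p: "path p ((r # us) @ [r])" using assms(1) by (simp add: face_list_def)
  show ?thesis
  proof (cases "e = l")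
    case True
    have "path p (b @ [l] @ [r])" using p unfolding bl by simp
    from path_last[OF this] show ?thesis using True bl by simp
  next
    case False
    from path_next[OF p assms(2) bl False] show ?thesis by blast
  qed
qed

lemma idx_next:
  assumes "distinct zs" "zs = A @ e # e' # B"
  shows "idx zs e' = Suc (idx zs e)"
  using assms by (auto simp: idx_def takeWhile_append)

section \<open>Cutting vertices of degree three\<close>

text \<open>The root \<open>r\<close> is a leaf and \<open>us\<close> lists the other darts of its face; \<open>q\<close> and \<open>vs\<close> describe the
  second face. The numbers \<open>x\<close> and \<open>y\<close> do not count the roots \<open>r\<close> and \<open>q\<close>. Connectivity is
  automatic for a single face, and not required for two.\<close>

definition uni :: "nat set \<Rightarrow> nat \<Rightarrow> ((nat \<Rightarrow> nat) \<times> (nat \<Rightarrow> nat) \<times> nat \<times> nat list) set" where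
  "uni D x = {(rt, op, r, us). cubic_pair D rt op \<and> face_list (rt \<circ> op) r us \<and> set (r # us) = D \<and>
     rt r = r \<and> num_fix rt us = x}"

definition duo :: "nat set \<Rightarrow> nat \<Rightarrow> nat \<Rightarrow>
    ((nat \<Rightarrow> nat) \<times> (nat \<Rightarrow> nat) \<times> nat \<times> nat list \<times> nat \<times> nat list) set" where
  "duo D x y = {(rt, op, r, us, q, vs). cubic_pair D rt op \<and>
     face_list (rt \<circ> op) r us \<and> face_list (rt \<circ> op) q vs \<and>
     set (r # us) \<inter> set (q # vs) = {} \<and> set (r # us) \<union> set (q # vs) = D \<and>
     rt r = r \<and> rt q = q \<and> num_fix rt us = x \<and> num_fix rt vs = y}"

text \<open>The arguments are listed in the order of the word, against which the rotation
  runs.\<close>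

definition reversed :: "('a \<Rightarrow> 'a) \<Rightarrow> 'a \<Rightarrow> 'a \<Rightarrow> 'a \<Rightarrow> bool" where
  "reversed rt f s t \<longleftrightarrow> rt f = t \<and> rt t = s \<and> rt s = f"

text \<open>A reversed vertex is represented by its last dart in the word.\<close>

definition rev_darts :: "('a \<Rightarrow> 'a) \<Rightarrow> 'a list \<Rightarrow> 'a set" where
  "rev_darts rt zs = {d \<in> set zs. idx zs (rt (rt d)) < idx zs (rt d) \<and> idx zs (rt d) < idx zs d}"

lemma cubic_pairD:
  assumes "cubic_pair D rt op"
  shows "rt permutes D" "op permutes D" "d \<in> D \<Longrightarrow> op d \<in> D" "d \<in> D \<Longrightarrow> op d \<noteq> d"
    "d \<in> D \<Longrightarrow> op (op d) = d" "d \<in> D \<Longrightarrow> rt d \<in> D" "d \<in> D \<Longrightarrow> rt (rt (rt d)) = d" "inj rt" "inj op"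
  using assms unfolding cubic_pair_def by (auto simp: permutes_in_image intro: permutes_inj)

lemma card_fix_set:
  assumes "distinct zs"
  shows "card {d \<in> set zs. rt d = d} = num_fix rt zs"
proof -
  have "{d \<in> set zs. rt d = d} = set (filter (\<lambda>d. rt d = d) zs)" by auto
  then show ?thesis using assms by (simp add: num_fix_def distinct_card del: set_filter)
qed

lemma rev_darts_card:
  assumes cp: "cubic_pair D rt op" and zs: "distinct zs" "set zs = D" and n: "card D = 2 * n"
    and X: "X \<subseteq> D"
    and 1: "\<And>d. d \<in> D - X \<Longrightarrow> idx zs (rt d) \<le> idx zs d \<longleftrightarrow> idx zs (op d) < idx zs d"
    and 2: "\<And>d. d \<in> X \<Longrightarrow> idx zs (rt d) \<le> idx zs d \<and> idx zs d \<le> idx zs (op d)"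
  shows "3 * card (rev_darts rt zs) + 2 * n + 2 * num_fix rt zs = 3 * (n + card X)"
proof -
  have fin: "finite D" using zs(2) by auto
  have inj: "inj_on (idx zs) D" using inj_on_idx[of zs] zs(2) by simp
  have "card {d \<in> D. idx zs (rt d) \<le> idx zs d} = n + card X"
    using cubic_pairD[OF cp] by (intro descents_card[OF fin _ inj n X 1 2]) auto
  then show ?thesis
    using reversed_count[OF cp fin inj] card_fix_set[OF zs(1), of rt] zs(2) n
    by (simp add: rev_darts_def)
qed

lemma next_idx_iff:
  assumes cp: "cubic_pair D rt op" and zs: "distinct zs" "set zs = D" and d: "d \<in> D"
    and nx: "zs = A @ op d # rt d # B"
  shows "idx zs (rt d) \<le> idx zs d \<longleftrightarrow> idx zs (op d) < idx zs d"
  using idx_next[OF zs(1) nx] by auto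

text \<open>For a one-face map of genus g Euler's formula reads n + 1 = 2x + 6g, so this equation
  says that there are exactly 2g reversed vertices.\<close>

lemma uni_rev_darts:
  assumes m: "(rt, op, r, us) \<in> uni D x" and n: "card D = 2 * n"
  shows "3 * card (rev_darts rt (r # us)) + 2 * n + 2 * (x + 1) = 3 * (n + 1)"
proof -
  have cp: "cubic_pair D rt op" and fl: "face_list (rt \<circ> op) r us" and D: "set (r # us) = D"
    and r: "rt r = r" and x: "num_fix rt us = x"
    using m by (auto simp: uni_def)
  have dist: "distinct (r # us)" using fl by (simp add: face_list_def)
  have "3 * card (rev_darts rt (r # us)) + 2 * n + 2 * num_fix rt (r # us) = 3 * (n + card {r})"
  proof (rule rev_darts_card[OF cp dist D n])
    show "{r} \<subseteq> D" using D by auto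
  next
    fix d assume d: "d \<in> D - {r}"
    then have e: "op d \<in> set (r # us)" using D cubic_pairD(3)[OF cp] by auto
    have oo: "op (op d) = d" using d cubic_pairD(5)[OF cp] by auto
    \<comment> \<open>The word wraps around only in the step arriving at \<open>r\<close>. Since
      \<open>rt\<close> fixes \<open>r\<close>, that step starts at \<open>op r\<close>, so it
      concerns no dart \<open>d\<close> other than the root.\<close>
    have "rt d \<noteq> r" using d r cubic_pairD(8)[OF cp] by (metis DiffE injD singletonI)
    then obtain A B where "r # us = A @ op d # rt d # B"
      using face_list_next[OF fl e] oo by auto
    then show "idx (r # us) (rt d) \<le> idx (r # us) d \<longleftrightarrow> idx (r # us) (op d) < idx (r # us) d"
      using next_idx_iff[OF cp dist D] d by blast
  next
    fix d assume "d \<in> {r}"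
    then show "idx (r # us) (rt d) \<le> idx (r # us) d \<and> idx (r # us) d \<le> idx (r # us) (op d)"
      using r by simp
  qed
  then show ?thesis using r x by simp
qed

lemma idx_last:
  assumes "distinct zs" "zs = A @ xs @ B" "x \<in> set xs"
  shows "idx zs x \<le> idx zs (last xs)"
proof -
  obtain C l where l: "xs = C @ [l]" using assms(3) by (metis list.set_cases list.distinct(1) rev_exhaust)
  have "idx zs l = length A + length C" using assms(1,2) l by auto
  moreover have "idx zs x \<le> length A + length C"
  proof -
    have "x \<notin> set A" using assms by auto
    then have "idx zs x = length A + idx (xs @ B) x" unfolding assms(2) by (rule idx_append)
    moreover have "idx (xs @ B) x < length xs" using idx_append1 idx_less assms(3) by metis
    ultimately show ?thesis using l by simp
  qed
  ultimately show ?thesis using l by simp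
qed

text \<open>Both words wrap around, so both roots are exceptional. Euler's formula turns the count
  into 2g + 2 for a connected pair and into 2(g1 + g2) for two separate maps.\<close>

lemma duo_rev_darts:
  assumes m: "(rt, op, r, us, q, vs) \<in> duo D x y" and n: "card D = 2 * n"
  shows "3 * card (rev_darts rt (r # us @ q # vs)) + 2 * n + 2 * (x + y + 2) = 3 * (n + 2)"
proof -
  have cp: "cubic_pair D rt op" and fl: "face_list (rt \<circ> op) r us" "face_list (rt \<circ> op) q vs"
    and D: "set (r # us) \<union> set (q # vs) = D" and disj: "set (r # us) \<inter> set (q # vs) = {}"
    and r: "rt r = r" "rt q = q" and x: "num_fix rt us = x" "num_fix rt vs = y"
    using m by (auto simp: duo_def)
  let ?zs = "r # us @ q # vs"
  have dist: "distinct ?zs" using fl disj by (auto simp: face_list_def)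
  have Dz: "set ?zs = D" using D by auto
  have rq: "r \<noteq> q" using disj by auto
  have inj: "rt a = rt b \<longleftrightarrow> a = b" for a b using cubic_pairD(8)[OF cp] by (metis injD)
  have "3 * card (rev_darts rt ?zs) + 2 * n + 2 * num_fix rt ?zs = 3 * (n + card {r, q})"
  proof (rule rev_darts_card[OF cp dist Dz n])
    show "{r, q} \<subseteq> D" using D by auto
  next
    fix d assume d: "d \<in> D - {r, q}"
    then have e: "op d \<in> set (r # us) \<union> set (q # vs)" using D cubic_pairD(3)[OF cp] by auto
    have oo: "op (op d) = d" using d cubic_pairD(5)[OF cp] by auto
    have "rt d \<noteq> r" "rt d \<noteq> q" using d r inj[of d r] inj[of d q] by auto
    then have "(\<exists>A B. r # us = A @ op d # rt d # B) \<or> (\<exists>A B. q # vs = A @ op d # rt d # B)"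
      using face_list_next[OF fl(1)] face_list_next[OF fl(2)] oo e by (metis Un_iff comp_apply)
    then have "\<exists>A B. ?zs = A @ op d # rt d # B"
    proof (elim disjE exE)
      fix A B assume "r # us = A @ op d # rt d # B"
      then have "?zs = A @ op d # rt d # (B @ q # vs)" by (metis append.assoc append_Cons)
      then show ?thesis by blast
    next
      fix A B assume "q # vs = A @ op d # rt d # B"
      then have "?zs = (r # us @ A) @ op d # rt d # B" by simp
      then show ?thesis by blast
    qed
    then show "idx ?zs (rt d) \<le> idx ?zs d \<longleftrightarrow> idx ?zs (op d) < idx ?zs d"
      using next_idx_iff[OF cp dist Dz] d by blast
  next
    fix d assume d: "d \<in> {r, q}"
    \<comment> \<open>The face arrives at \<open>q\<close> from \<open>op q\<close> because
      \<open>rt\<close> fixes \<open>q\<close>; hence \<open>op q\<close> closes the second word and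
      cannot precede \<open>q\<close> in the concatenation.\<close>
    have "op q = last (q # vs)"
    proof -
      have q: "q \<in> D" using D by auto
      then have oq: "op (op q) = q" using cubic_pairD(5)[OF cp] by auto
      have ins: "op q \<in> set (r # us) \<union> set (q # vs)" using cubic_pairD(3)[OF cp] q D by auto
      have g: "(rt \<circ> op) (op q) = q" using oq r by simp
      have "\<not> (\<exists>A B. r # us = A @ op q # q # B)" using disj by (metis Int_iff empty_iff in_set_conv_decomp
          append_Cons list.set_intros(1) append.assoc append_Nil)
      moreover have "\<not> (\<exists>A B. q # vs = A @ op q # q # B)"
      proof (intro notI, elim exE)
        fix A B assume "q # vs = A @ op q # q # B"
        then show False using dist by (cases A) auto
      qed
      ultimately show ?thesis
        using face_list_next[OF fl(1), of "op q"] face_list_next[OF fl(2), of "op q"] g ins rq by auto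
    qed
    then have "idx ?zs q \<le> idx ?zs (op q)"
      using idx_last[OF dist, of "r # us" "q # vs" "[]" q] by simp
    then show "idx ?zs (rt d) \<le> idx ?zs d \<and> idx ?zs d \<le> idx ?zs (op d)"
      using d r by auto
  qed
  then show ?thesis using r x rq by simp
qed

section \<open>Choices of leaves in a word\<close>

definition splits1 :: "('a \<Rightarrow> bool) \<Rightarrow> 'a list \<Rightarrow> ('a list \<times> 'a \<times> 'a list) set" where
  "splits1 P zs = {(A, a, E). zs = A @ a # E \<and> P a}"

text \<open>The number \<open>k\<close> of marked entries strictly between the two chosen ones will
  be the number of leaves that a cut carries into the other face.\<close>

definition splits2 :: "('a \<Rightarrow> bool) \<Rightarrow> nat \<Rightarrow> 'a list \<Rightarrow> ('a list \<times> 'a \<times> 'a list \<times> 'a \<times> 'a list) set" where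
  "splits2 P k zs = {(A, a, B, b, E). zs = A @ a # B @ b # E \<and> P a \<and> P b \<and> length (filter P B) = k}"

definition splits2' :: "('a \<Rightarrow> bool) \<Rightarrow> 'a list \<Rightarrow> ('a list \<times> 'a \<times> 'a list \<times> 'a \<times> 'a list) set" where
  "splits2' P zs = {(A, a, B, b, E). zs = A @ a # B @ b # E \<and> P a \<and> P b}"

definition splits3 :: "('a \<Rightarrow> bool) \<Rightarrow> 'a list \<Rightarrow>
    ('a list \<times> 'a \<times> 'a list \<times> 'a \<times> 'a list \<times> 'a \<times> 'a list) set" where
  "splits3 P zs = {(A, a, B, b, C, c, E). zs = A @ a # B @ b # C @ c # E \<and> P a \<and> P b \<and> P c}"

lemma splits1_rec:
  "splits1 P [] = {}"
  "splits1 P (z # zs) = (if P z then {([], z, zs)} else {}) \<union> (\<lambda>(A, r). (z # A, r)) ` splits1 P zs"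
  by (auto simp: splits1_def Cons_eq_append_conv image_iff)

lemma splits2_rec:
  "splits2 P k [] = {}"
  "splits2 P k (z # zs) = (if P z then (\<lambda>(B, b, E). ([], z, B, b, E)) `
       {x \<in> splits1 P zs. length (filter P (fst x)) = k} else {})
     \<union> (\<lambda>(A, r). (z # A, r)) ` splits2 P k zs"
  by (auto simp: splits1_def splits2_def Cons_eq_append_conv image_iff)

lemma splits2'_rec:
  "splits2' P [] = {}"
  "splits2' P (z # zs) = (if P z then (\<lambda>r. ([], z, r)) ` splits1 P zs else {})
     \<union> (\<lambda>(A, r). (z # A, r)) ` splits2' P zs"
  by (auto simp: splits1_def splits2'_def Cons_eq_append_conv image_iff)

lemma splits3_rec:
  "splits3 P [] = {}"
  "splits3 P (z # zs) = (if P z then (\<lambda>r. ([], z, r)) ` splits2' P zs else {})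
     \<union> (\<lambda>(A, r). (z # A, r)) ` splits3 P zs"
  by (auto simp: splits2'_def splits3_def Cons_eq_append_conv image_iff)

lemma inj_on_Cons: "inj_on (\<lambda>(A, r). (z # A, r)) S"
  by (auto simp: inj_on_def)

lemma card_Un_Cons:
  assumes "finite S" "finite T" "\<And>x. x \<in> S \<Longrightarrow> fst x = []"
  shows "card (S \<union> (\<lambda>(A, r). (z # A, r)) ` T) = card S + card T"
proof -
  have "S \<inter> (\<lambda>(A, r). (z # A, r)) ` T = {}" using assms(3) by force
  then show ?thesis
    using assms(1,2) by (simp add: card_Un_disjoint card_image[OF inj_on_Cons])
qed

lemma finite_splits:
  "finite (splits1 P zs)" "finite (splits2 P k zs)" "finite (splits2' P zs)" "finite (splits3 P zs)"
proof -
  show 1: "finite (splits1 P zs)" for zs :: "'a list"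
    by (induction zs) (auto simp: splits1_rec)
  show "finite (splits2 P k zs)" by (induction zs) (auto simp: splits2_rec 1)
  show 2: "finite (splits2' P zs)" for zs :: "'a list"
    by (induction zs) (auto simp: splits2'_rec 1)
  show "finite (splits3 P zs)" by (induction zs) (auto simp: splits3_rec 2)
qed

lemma card_splits1: "card (splits1 P zs) = length (filter P zs)"
proof (induction zs)
  case (Cons z zs)
  show ?case unfolding splits1_rec
    by (subst card_Un_Cons) (auto simp: finite_splits Cons split: if_splits)
qed (simp add: splits1_rec)

lemma card_splits1_gap:
  "card {x \<in> splits1 P zs. length (filter P (fst x)) = k} = (if k < length (filter P zs) then 1 else 0)"
proof (induction zs arbitrary: k)
  case (Cons z zs)
  show ?case
  proof (cases "P z")
    case False
    then have "{x \<in> splits1 P (z # zs). length (filter P (fst x)) = k}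
        = (\<lambda>(A, r). (z # A, r)) ` {x \<in> splits1 P zs. length (filter P (fst x)) = k}"
      by (auto simp: splits1_rec)
    then show ?thesis using False Cons.IH[of k]
      by (simp only: card_image[OF inj_on_Cons]) simp
  next
    case P: True
    show ?thesis
    proof (cases k)
      case 0
      then have "{x \<in> splits1 P (z # zs). length (filter P (fst x)) = k} = {([], z, zs)}"
        using P by (auto simp: splits1_rec)
      then show ?thesis using 0 P by simp
    next
      case (Suc j)
      then have "{x \<in> splits1 P (z # zs). length (filter P (fst x)) = k}
          = (\<lambda>(A, r). (z # A, r)) ` {x \<in> splits1 P zs. length (filter P (fst x)) = j}"
        using P by (auto simp: splits1_rec)
      then show ?thesis using P Suc Cons.IH[of j]
        by (simp only: card_image[OF inj_on_Cons]) simp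
    qed
  qed
qed (simp add: splits1_rec)

text \<open>The gap determines the second entry from the first one; it exists unless the first is
  among the last \<open>k + 1\<close> marked entries.\<close>

lemma card_splits2: "card (splits2 P k zs) = length (filter P zs) - 1 - k"
proof (induction zs)
  case (Cons z zs)
  have "card ((\<lambda>(B, b, E). ([] :: 'a list, z, B, b, E)) ` {x \<in> splits1 P zs. length (filter P (fst x)) = k})
      = (if k < length (filter P zs) then 1 else 0)"
    by (subst card_image) (auto simp: inj_on_def card_splits1_gap)
  then show ?case unfolding splits2_rec
    by (subst card_Un_Cons) (auto simp: finite_splits Cons split: if_splits)
qed (simp add: splits2_rec)

lemma card_splits2': "card (splits2' P zs) = length (filter P zs) choose 2"
proof (induction zs)
  case (Cons z zs)
  have "card ((\<lambda>r. ([] :: 'a list, z, r)) ` splits1 P zs) = length (filter P zs)"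
    by (subst card_image) (auto simp: inj_on_def card_splits1)
  then show ?case unfolding splits2'_rec
    by (subst card_Un_Cons) (auto simp: finite_splits Cons numeral_2_eq_2 split: if_splits)
qed (simp add: splits2'_rec)

lemma card_splits3: "card (splits3 P zs) = length (filter P zs) choose 3"
proof (induction zs)
  case (Cons z zs)
  have "card ((\<lambda>r. ([] :: 'a list, z, r)) ` splits2' P zs) = length (filter P zs) choose 2"
    by (subst card_image) (auto simp: inj_on_def card_splits2')
  then show ?case unfolding splits3_rec
    by (subst card_Un_Cons) (auto simp: finite_splits Cons numeral_3_eq_3 numeral_2_eq_2 split: if_splits)
qed (simp add: splits3_rec)

section \<open>Reversed vertices distributed over two words\<close>

definition rsplits3 where
  "rsplits3 rt us = {(P, f, Q, s, R, t, S). us = P @ f # Q @ s # R @ t # S \<and> reversed rt f s t}"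

text \<open>The digits give the numbers of darts of the vertex in the two words. As the first word
  precedes the second, its darts come first in the order f, s, t.\<close>

definition rsplits21 where
  "rsplits21 rt us vs = {((P, f, Q, s, R), (U, t, V)). us = P @ f # Q @ s # R \<and> vs = U @ t # V \<and>
     reversed rt f s t}"

definition rsplits12 where
  "rsplits12 rt us vs = {((P, f, Q), (U, s, R, t, V)). us = P @ f # Q \<and> vs = U @ s # R @ t # V \<and>
     reversed rt f s t}"

lemma idx_lessE:
  assumes "distinct us" "a \<in> set us" "b \<in> set us" "idx us a < idx us b"
  obtains A B C where "us = A @ a # B @ b # C"
proof -
  obtain A E where E: "us = A @ a # E" using assms(2) by (meson split_list)
  have "b \<notin> set A" "b \<noteq> a"
  proof
    assume "b \<in> set A"
    then have "idx us b < length A" unfolding E by (simp add: idx_append1 idx_less)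
    then show False using assms(1,4) E by simp
  qed (use assms(4) in auto)
  then have "b \<in> set E" using assms(3) E by auto
  then obtain B C where "E = B @ b # C" by (meson split_list)
  then show ?thesis using that E by simp
qed

lemma idx_less3E:
  assumes "distinct us" "a \<in> set us" "b \<in> set us" "c \<in> set us" "idx us a < idx us b" "idx us b < idx us c"
  obtains A B C E where "us = A @ a # B @ b # C @ c # E"
proof -
  obtain A B F where F: "us = A @ a # B @ b # F"
    using idx_lessE[OF assms(1,2,3,5)] .
  have "idx (A @ a # B @ b # F) b = Suc (length A + length B)" using assms(1) F by auto
  have "c \<in> set F"
  proof (rule ccontr)
    assume "c \<notin> set F"
    then have "c \<in> set (A @ a # B)" using assms(4,6) F by auto
    then have "idx us c < length (A @ a # B)"
      unfolding F using idx_append1[of c "A @ a # B" "b # F"] idx_less[of c "A @ a # B"] by simp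
    then show False using assms(1,6) F by auto
  qed
  then obtain C E where "F = C @ c # E" by (meson split_list)
  then show ?thesis using that F by simp
qed

lemma split_unique:
  assumes "distinct (A @ a # B)" "A @ a # B = A' @ a # B'"
  shows "A = A' \<and> B = B'"
proof -
  have "a \<notin> set A" "a \<notin> set B" using assms(1) by auto
  then show ?thesis using assms(2) append_Cons_eq_iff[of a A B A' B'] by simp
qed

text \<open>The distribution of reversed vertices over two faces is a matter of positions in the
  concatenated word, so only the words and the rotation are kept.\<close>

locale two_words =
  fixes rt :: "'a \<Rightarrow> 'a" and r q :: 'a and us vs :: "'a list"
  assumes dist: "distinct (r # us @ q # vs)"
    and r: "rt r = r" and q: "rt q = q"
    and closed: "\<And>d. d \<in> set (r # us @ q # vs) \<Longrightarrow> rt d \<in> set (r # us @ q # vs)"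
    and order3: "\<And>d. d \<in> set (r # us @ q # vs) \<Longrightarrow> rt (rt (rt d)) = d"
begin

abbreviation "zs \<equiv> r # us @ q # vs"

lemma idx_us: "a \<in> set us \<Longrightarrow> idx zs a = Suc (idx us a)"
  using dist by (subst idx_Cons) (auto simp: idx_append1)

lemma idx_vs: "a \<in> set vs \<Longrightarrow> idx zs a = length us + 2 + idx vs a"
proof -
  assume a: "a \<in> set vs"
  then have "a \<notin> set us" "r \<noteq> a" "q \<noteq> a" using dist by auto
  then show ?thesis by simp
qed

lemma idx_us_less: "a \<in> set us \<Longrightarrow> idx zs a < length us + 2"
  using idx_us idx_less by fastforce

lemma rev_darts_iff:
  "t \<in> rev_darts rt zs \<longleftrightarrow> (\<exists>f s. reversed rt f s t \<and> f \<in> set us \<union> set vs \<and> s \<in> set us \<union> set vs \<and>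
     t \<in> set us \<union> set vs \<and> idx zs f < idx zs s \<and> idx zs s < idx zs t)" (is "_ \<longleftrightarrow> ?R")
proof
  assume t: "t \<in> rev_darts rt zs"
  let ?s = "rt t" and ?f = "rt (rt t)"
  have tz: "t \<in> set zs" and lt: "idx zs ?f < idx zs ?s" "idx zs ?s < idx zs t"
    using t by (auto simp: rev_darts_def)
  have in_z: "?s \<in> set zs" "?f \<in> set zs" using closed tz by blast+
  have c: "rt ?f = t" using order3 tz by blast
  have "t \<noteq> r" "t \<noteq> q" using lt r q by auto
  moreover have "?s \<noteq> r" "?s \<noteq> q" using lt r q by auto
  moreover have "?f \<noteq> r" "?f \<noteq> q" using lt c r q by auto
  ultimately have "?f \<in> set us \<union> set vs" "?s \<in> set us \<union> set vs" "t \<in> set us \<union> set vs"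
    using tz in_z by auto
  then show ?R using lt c unfolding reversed_def by blast
next
  assume ?R
  then show "t \<in> rev_darts rt zs" by (auto simp: rev_darts_def reversed_def)
qed

text \<open>The last dart determines the other two by rotation, and since the word has no
  repetitions the three darts determine the factorization. The other three counts below rest on the
  same observation.\<close>

lemma rsplits3_us:
  "card (rsplits3 rt us) = card {t \<in> rev_darts rt zs. t \<in> set us}"
proof -
  have "bij_betw (\<lambda>(P, f, Q, s, R, t, S). t) (rsplits3 rt us) {t \<in> rev_darts rt zs. t \<in> set us}"
    unfolding bij_betw_def
  proof
    show "inj_on (\<lambda>(P, f, Q, s, R, t, S). t) (rsplits3 rt us)"
    proof (rule inj_onI)
      fix x y assume x: "x \<in> rsplits3 rt us" and y: "y \<in> rsplits3 rt us"
        and e: "(\<lambda>(P, f, Q, s, R, t, S). t) x = (\<lambda>(P, f, Q, s, R, t, S). t) y"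
      obtain P f Q s R t S where X: "x = (P, f, Q, s, R, t, S)" "us = P @ f # Q @ s # R @ t # S"
        "reversed rt f s t" using x by (auto simp: rsplits3_def)
      obtain P' f' Q' s' R' t' S' where Y: "y = (P', f', Q', s', R', t', S')"
        "us = P' @ f' # Q' @ s' # R' @ t' # S'" "reversed rt f' s' t'"
        using y by (auto simp: rsplits3_def)
      have ts: "t' = t" "s' = s" "f' = f" using e X Y by (auto simp: reversed_def)
      have eq: "P @ f # Q @ s # R @ t # S = P' @ f # Q' @ s # R' @ t # S'"
        using X(2) Y(2) ts by simp
      have "distinct (P @ f # Q @ s # R @ t # S)" using dist X(2) by auto
      from this split_unique[OF this eq]
      have 1: "P = P'" "Q @ s # R @ t # S = Q' @ s # R' @ t # S'" "distinct (Q @ s # R @ t # S)" by auto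
      from this(3) split_unique[OF this(3,2)]
      have 2: "Q = Q'" "R @ t # S = R' @ t # S'" "distinct (R @ t # S)" by auto
      from split_unique[OF 2(3,2)] 1 2 ts
      show "x = y" using X(1) Y(1) by simp
    qed
    show "(\<lambda>(P, f, Q, s, R, t, S). t) ` rsplits3 rt us = {t \<in> rev_darts rt zs. t \<in> set us}"
    proof (intro subset_antisym subsetI)
      fix t assume "t \<in> (\<lambda>(P, f, Q, s, R, t, S). t) ` rsplits3 rt us"
      then obtain P f Q s R S where us: "us = P @ f # Q @ s # R @ t # S" and rv: "reversed rt f s t"
        by (auto simp: rsplits3_def)
      have du: "distinct us" using dist by auto
      have "f \<in> set us" "s \<in> set us" "t \<in> set us" using us by auto
      moreover have "idx us f < idx us s" "idx us s < idx us t" using du unfolding us by auto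
      ultimately show "t \<in> {t \<in> rev_darts rt zs. t \<in> set us}"
        unfolding mem_Collect_eq rev_darts_iff using rv idx_us by (metis Suc_less_eq UnI1)
    next
      fix t assume "t \<in> {t \<in> rev_darts rt zs. t \<in> set us}"
      then obtain f s where rv: "reversed rt f s t" and fs: "f \<in> set us \<union> set vs" "s \<in> set us \<union> set vs"
        and t: "t \<in> set us" and lt: "idx zs f < idx zs s" "idx zs s < idx zs t"
        unfolding mem_Collect_eq rev_darts_iff by blast
      have "idx zs t < length us + 2" using t idx_us_less by blast
      then have fs': "f \<in> set us" "s \<in> set us" using fs lt idx_vs by fastforce+
      then have "idx us f < idx us s" "idx us s < idx us t" using lt t idx_us by auto
      then obtain P Q R S where "us = P @ f # Q @ s # R @ t # S"
        using idx_less3E[OF _ fs' t] dist by (metis distinct.simps(2) distinct_append)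
      then have "(P, f, Q, s, R, t, S) \<in> rsplits3 rt us" using rv by (simp add: rsplits3_def)
      then show "t \<in> (\<lambda>(P, f, Q, s, R, t, S). t) ` rsplits3 rt us" by (rule rev_image_eqI) simp
    qed
  qed
  then show ?thesis by (rule bij_betw_same_card)
qed

lemma rsplits3_vs:
  "card (rsplits3 rt vs) = card {t \<in> rev_darts rt zs. rt (rt t) \<in> set vs}"
proof -
  have "bij_betw (\<lambda>(P, f, Q, s, R, t, S). t) (rsplits3 rt vs) {t \<in> rev_darts rt zs. rt (rt t) \<in> set vs}"
    unfolding bij_betw_def
  proof
    show "inj_on (\<lambda>(P, f, Q, s, R, t, S). t) (rsplits3 rt vs)"
    proof (rule inj_onI)
      fix x y assume x: "x \<in> rsplits3 rt vs" and y: "y \<in> rsplits3 rt vs"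
        and e: "(\<lambda>(P, f, Q, s, R, t, S). t) x = (\<lambda>(P, f, Q, s, R, t, S). t) y"
      obtain P f Q s R t S where X: "x = (P, f, Q, s, R, t, S)" "vs = P @ f # Q @ s # R @ t # S"
        "reversed rt f s t" using x by (auto simp: rsplits3_def)
      obtain P' f' Q' s' R' t' S' where Y: "y = (P', f', Q', s', R', t', S')"
        "vs = P' @ f' # Q' @ s' # R' @ t' # S'" "reversed rt f' s' t'"
        using y by (auto simp: rsplits3_def)
      have ts: "t' = t" "s' = s" "f' = f" using e X Y by (auto simp: reversed_def)
      have eq: "P @ f # Q @ s # R @ t # S = P' @ f # Q' @ s # R' @ t # S'"
        using X(2) Y(2) ts by simp
      have "distinct (P @ f # Q @ s # R @ t # S)" using dist X(2) by auto
      from this split_unique[OF this eq]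
      have 1: "P = P'" "Q @ s # R @ t # S = Q' @ s # R' @ t # S'" "distinct (Q @ s # R @ t # S)" by auto
      from this(3) split_unique[OF this(3,2)]
      have 2: "Q = Q'" "R @ t # S = R' @ t # S'" "distinct (R @ t # S)" by auto
      from split_unique[OF 2(3,2)] 1 2 ts
      show "x = y" using X(1) Y(1) by simp
    qed
    show "(\<lambda>(P, f, Q, s, R, t, S). t) ` rsplits3 rt vs = {t \<in> rev_darts rt zs. rt (rt t) \<in> set vs}"
    proof (intro subset_antisym subsetI)
      fix t assume "t \<in> (\<lambda>(P, f, Q, s, R, t, S). t) ` rsplits3 rt vs"
      then obtain P f Q s R S where vs: "vs = P @ f # Q @ s # R @ t # S" and rv: "reversed rt f s t"
        by (auto simp: rsplits3_def)
      have du: "distinct vs" using dist by auto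
      have m: "f \<in> set vs" "s \<in> set vs" "t \<in> set vs" using vs by auto
      moreover have "idx vs f < idx vs s" "idx vs s < idx vs t" using du unfolding vs by auto
      ultimately have "t \<in> rev_darts rt zs"
        unfolding rev_darts_iff using rv idx_vs by (metis UnI2 add_less_cancel_left)
      then show "t \<in> {t \<in> rev_darts rt zs. rt (rt t) \<in> set vs}"
        using m rv by (simp add: reversed_def)
    next
      fix t assume "t \<in> {t \<in> rev_darts rt zs. rt (rt t) \<in> set vs}"
      then obtain f s where rv: "reversed rt f s t" and st: "t \<in> set us \<union> set vs" "s \<in> set us \<union> set vs"
        and f: "f \<in> set vs" and lt: "idx zs f < idx zs s" "idx zs s < idx zs t"
        unfolding mem_Collect_eq rev_darts_iff reversed_def by metis
      have "idx zs f \<ge> length us + 2" using f idx_vs by simp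
      then have st': "t \<in> set vs" "s \<in> set vs" using st lt idx_us_less by fastforce+
      then have "idx vs f < idx vs s" "idx vs s < idx vs t" using lt f idx_vs by auto
      then obtain P Q R S where "vs = P @ f # Q @ s # R @ t # S"
        using idx_less3E[OF _ f st'(2,1)] dist by (metis distinct.simps(2) distinct_append)
      then have "(P, f, Q, s, R, t, S) \<in> rsplits3 rt vs" using rv by (simp add: rsplits3_def)
      then show "t \<in> (\<lambda>(P, f, Q, s, R, t, S). t) ` rsplits3 rt vs" by (rule rev_image_eqI) simp
    qed
  qed
  then show ?thesis by (rule bij_betw_same_card)
qed

lemma rsplits21_card:
  "card (rsplits21 rt us vs) = card {t \<in> rev_darts rt zs. t \<in> set vs \<and> rt t \<in> set us}"
proof -
  have "bij_betw (\<lambda>((P, f, Q, s, R), (U, t, V)). t) (rsplits21 rt us vs)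
      {t \<in> rev_darts rt zs. t \<in> set vs \<and> rt t \<in> set us}"
    unfolding bij_betw_def
  proof
    show "inj_on (\<lambda>((P, f, Q, s, R), (U, t, V)). t) (rsplits21 rt us vs)"
    proof (rule inj_onI)
      fix x y assume x: "x \<in> rsplits21 rt us vs" and y: "y \<in> rsplits21 rt us vs"
        and e: "(\<lambda>((P, f, Q, s, R), (U, t, V)). t) x = (\<lambda>((P, f, Q, s, R), (U, t, V)). t) y"
      obtain P f Q s R U t V where X: "x = ((P, f, Q, s, R), (U, t, V))" "us = P @ f # Q @ s # R"
        "vs = U @ t # V" "reversed rt f s t" using x by (auto simp: rsplits21_def)
      obtain P' f' Q' s' R' U' t' V' where Y: "y = ((P', f', Q', s', R'), (U', t', V'))"
        "us = P' @ f' # Q' @ s' # R'" "vs = U' @ t' # V'" "reversed rt f' s' t'"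
        using y by (auto simp: rsplits21_def)
      have ts: "t' = t" "s' = s" "f' = f" using e X Y by (auto simp: reversed_def)
      have eq: "P @ f # Q @ s # R = P' @ f # Q' @ s # R'" "U @ t # V = U' @ t # V'"
        using X(2,3) Y(2,3) ts by simp_all
      have d: "distinct (P @ f # Q @ s # R)" "distinct (U @ t # V)" using dist X(2,3) by auto
      from d(1) split_unique[OF d(1) eq(1)]
      have 1: "P = P'" "Q @ s # R = Q' @ s # R'" "distinct (Q @ s # R)" by auto
      from split_unique[OF this(3,2)] 1 split_unique[OF d(2) eq(2)] ts
      show "x = y" using X(1) Y(1) by simp
    qed
    show "(\<lambda>((P, f, Q, s, R), (U, t, V)). t) ` rsplits21 rt us vs
        = {t \<in> rev_darts rt zs. t \<in> set vs \<and> rt t \<in> set us}"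
    proof (intro subset_antisym subsetI)
      fix t assume "t \<in> (\<lambda>((P, f, Q, s, R), (U, t, V)). t) ` rsplits21 rt us vs"
      then obtain P f Q s R U V where us: "us = P @ f # Q @ s # R" and vs: "vs = U @ t # V"
        and rv: "reversed rt f s t"
        by (auto simp: rsplits21_def)
      have du: "distinct us" using dist by auto
      have m: "f \<in> set us" "s \<in> set us" "t \<in> set vs" using us vs by auto
      moreover have "idx us f < idx us s" using du unfolding us by auto
      moreover have "idx zs s < idx zs t" using idx_us_less[OF m(2)] idx_vs[OF m(3)] by linarith
      ultimately have "t \<in> rev_darts rt zs"
        unfolding rev_darts_iff using rv idx_us by (metis Suc_less_eq UnI1 UnI2)
      then show "t \<in> {t \<in> rev_darts rt zs. t \<in> set vs \<and> rt t \<in> set us}"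
        using m rv by (simp add: reversed_def)
    next
      fix t assume "t \<in> {t \<in> rev_darts rt zs. t \<in> set vs \<and> rt t \<in> set us}"
      then obtain f s where rv: "reversed rt f s t" and f: "f \<in> set us \<union> set vs"
        and st: "s \<in> set us" "t \<in> set vs" and lt: "idx zs f < idx zs s" "idx zs s < idx zs t"
        unfolding mem_Collect_eq rev_darts_iff reversed_def by metis
      have "idx zs s < length us + 2" using st idx_us_less by blast
      then have f': "f \<in> set us" using f lt idx_vs by fastforce
      then have "idx us f < idx us s" using lt st idx_us by auto
      then obtain P Q R where "us = P @ f # Q @ s # R"
        using idx_lessE[OF _ f' st(1)] dist by (metis distinct.simps(2) distinct_append)
      moreover obtain U V where "vs = U @ t # V" using st(2) by (meson split_list)
      ultimately have "((P, f, Q, s, R), (U, t, V)) \<in> rsplits21 rt us vs"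
        using rv by (simp add: rsplits21_def)
      then show "t \<in> (\<lambda>((P, f, Q, s, R), (U, t, V)). t) ` rsplits21 rt us vs"
        by (rule rev_image_eqI) simp
    qed
  qed
  then show ?thesis by (rule bij_betw_same_card)
qed

lemma rsplits12_card:
  "card (rsplits12 rt us vs) = card {t \<in> rev_darts rt zs. rt t \<in> set vs \<and> rt (rt t) \<in> set us}"
proof -
  have "bij_betw (\<lambda>((P, f, Q), (U, s, R, t, V)). t) (rsplits12 rt us vs)
      {t \<in> rev_darts rt zs. rt t \<in> set vs \<and> rt (rt t) \<in> set us}"
    unfolding bij_betw_def
  proof
    show "inj_on (\<lambda>((P, f, Q), (U, s, R, t, V)). t) (rsplits12 rt us vs)"
    proof (rule inj_onI)
      fix x y assume x: "x \<in> rsplits12 rt us vs" and y: "y \<in> rsplits12 rt us vs"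
        and e: "(\<lambda>((P, f, Q), (U, s, R, t, V)). t) x = (\<lambda>((P, f, Q), (U, s, R, t, V)). t) y"
      obtain P f Q s R U t V where X: "x = ((P, f, Q), (U, s, R, t, V))" "us = P @ f # Q"
        "vs = U @ s # R @ t # V" "reversed rt f s t" using x by (auto simp: rsplits12_def)
      obtain P' f' Q' s' R' U' t' V' where Y: "y = ((P', f', Q'), (U', s', R', t', V'))"
        "us = P' @ f' # Q'" "vs = U' @ s' # R' @ t' # V'" "reversed rt f' s' t'"
        using y by (auto simp: rsplits12_def)
      have ts: "t' = t" "s' = s" "f' = f" using e X Y by (auto simp: reversed_def)
      have eq: "P @ f # Q = P' @ f # Q'" "U @ s # R @ t # V = U' @ s # R' @ t # V'"
        using X(2,3) Y(2,3) ts by simp_all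
      have d: "distinct (P @ f # Q)" "distinct (U @ s # R @ t # V)" using dist X(2,3) by auto
      from d(2) split_unique[OF d(2) eq(2)]
      have 1: "U = U'" "R @ t # V = R' @ t # V'" "distinct (R @ t # V)" by auto
      from split_unique[OF this(3,2)] 1 split_unique[OF d(1) eq(1)] ts
      show "x = y" using X(1) Y(1) by simp
    qed
    show "(\<lambda>((P, f, Q), (U, s, R, t, V)). t) ` rsplits12 rt us vs
        = {t \<in> rev_darts rt zs. rt t \<in> set vs \<and> rt (rt t) \<in> set us}"
    proof (intro subset_antisym subsetI)
      fix t assume "t \<in> (\<lambda>((P, f, Q), (U, s, R, t, V)). t) ` rsplits12 rt us vs"
      then obtain P f Q s R U V where us: "us = P @ f # Q" and vs: "vs = U @ s # R @ t # V"
        and rv: "reversed rt f s t"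
        by (auto simp: rsplits12_def)
      have du: "distinct vs" using dist by auto
      have m: "f \<in> set us" "s \<in> set vs" "t \<in> set vs" using us vs by auto
      moreover have "idx vs s < idx vs t" using du unfolding vs by auto
      moreover have "idx zs f < idx zs s" using idx_us_less[OF m(1)] idx_vs[OF m(2)] by linarith
      ultimately have "t \<in> rev_darts rt zs"
        unfolding rev_darts_iff using rv idx_vs by (metis add_less_cancel_left UnI1 UnI2)
      then show "t \<in> {t \<in> rev_darts rt zs. rt t \<in> set vs \<and> rt (rt t) \<in> set us}"
        using m rv by (simp add: reversed_def)
    next
      fix t assume "t \<in> {t \<in> rev_darts rt zs. rt t \<in> set vs \<and> rt (rt t) \<in> set us}"
      then obtain f s where rv: "reversed rt f s t" and t: "t \<in> set us \<union> set vs"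
        and st: "f \<in> set us" "s \<in> set vs" and lt: "idx zs f < idx zs s" "idx zs s < idx zs t"
        unfolding mem_Collect_eq rev_darts_iff reversed_def by metis
      have "idx zs s \<ge> length us + 2" using st idx_vs by simp
      then have t': "t \<in> set vs" using t lt idx_us_less by fastforce
      then have "idx vs s < idx vs t" using lt st idx_vs by auto
      then obtain U R V where "vs = U @ s # R @ t # V"
        using idx_lessE[OF _ st(2) t'] dist by (metis distinct.simps(2) distinct_append)
      moreover obtain P Q where "us = P @ f # Q" using st(1) by (meson split_list)
      ultimately have "((P, f, Q), (U, s, R, t, V)) \<in> rsplits12 rt us vs"
        using rv by (simp add: rsplits12_def)
      then show "t \<in> (\<lambda>((P, f, Q), (U, s, R, t, V)). t) ` rsplits12 rt us vs"
        by (rule rev_image_eqI) simp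
    qed
  qed
  then show ?thesis by (rule bij_betw_same_card)
qed

text \<open>Running through f, s, t in order one can pass from the first word to the second but
  never back, which leaves four cases.\<close>

lemma rev_darts_split:
  "card (rev_darts rt zs) = card (rsplits3 rt us) + card (rsplits21 rt us vs)
     + card (rsplits12 rt us vs) + card (rsplits3 rt vs)"
proof -
  let ?R = "rev_darts rt zs"
  let ?A = "{t \<in> ?R. t \<in> set us}" and ?B = "{t \<in> ?R. t \<in> set vs \<and> rt t \<in> set us}"
  let ?C = "{t \<in> ?R. rt t \<in> set vs \<and> rt (rt t) \<in> set us}" and ?D = "{t \<in> ?R. rt (rt t) \<in> set vs}"
  have fin: "finite ?R" by (simp add: rev_darts_def)
  have disj: "set us \<inter> set vs = {}" using dist by auto
  have mono: "(t \<in> set us \<longrightarrow> rt t \<in> set us) \<and> (rt t \<in> set us \<longrightarrow> rt (rt t) \<in> set us) \<and>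
     t \<in> set us \<union> set vs \<and> rt t \<in> set us \<union> set vs \<and> rt (rt t) \<in> set us \<union> set vs" if "t \<in> ?R" for t
  proof -
    from that obtain f s where rv: "rt t = s" "rt s = f"
      and *: "f \<in> set us \<union> set vs" "s \<in> set us \<union> set vs" "t \<in> set us \<union> set vs"
      and lt: "idx zs f < idx zs s" "idx zs s < idx zs t"
      unfolding rev_darts_iff reversed_def by blast
    have "s \<in> set us" if "t \<in> set us" using that * lt idx_us_less[OF that] idx_vs[of s] by auto
    moreover have "f \<in> set us" if "s \<in> set us" using that * lt idx_us_less[OF that] idx_vs[of f] by auto
    ultimately show ?thesis using * rv by blast
  qed
  have "?R = (?A \<union> ?B) \<union> (?C \<union> ?D)" using mono by blast
  moreover have "(?A \<union> ?B) \<inter> (?C \<union> ?D) = {}" "?A \<inter> ?B = {}" "?C \<inter> ?D = {}"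
    using mono disj by blast+
  ultimately have "card ?R = card ?A + card ?B + (card ?C + card ?D)"
    using fin by (metis (no_types, lifting) card_Un_disjoint finite_Un)
  then show ?thesis using rsplits3_us rsplits21_card rsplits12_card rsplits3_vs by simp
qed

end

lemma uni_rsplits3:
  assumes m: "(rt, op, r, us) \<in> uni D x"
  shows "card (rev_darts rt (r # us)) = card (rsplits3 rt us)"
proof -
  let ?zs = "r # us"
  have cp: "cubic_pair D rt op" and D: "set (r # us) = D" and r: "rt r = r"
    and dist: "distinct (r # us)" using m by (auto simp: uni_def face_list_def)
  have idx_us: "idx ?zs a = Suc (idx us a)" if "a \<in> set us" for a
    using dist that by (subst idx_Cons) auto
  have "bij_betw (\<lambda>(P, f, Q, s, R, t, S). t) (rsplits3 rt us) (rev_darts rt ?zs)"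
    unfolding bij_betw_def
  proof
    show "inj_on (\<lambda>(P, f, Q, s, R, t, S). t) (rsplits3 rt us)"
    proof (rule inj_onI)
      fix x y assume x: "x \<in> rsplits3 rt us" and y: "y \<in> rsplits3 rt us"
        and e: "(\<lambda>(P, f, Q, s, R, t, S). t) x = (\<lambda>(P, f, Q, s, R, t, S). t) y"
      obtain P f Q s R t S where X: "x = (P, f, Q, s, R, t, S)" "us = P @ f # Q @ s # R @ t # S"
        "reversed rt f s t" using x by (auto simp: rsplits3_def)
      obtain P' f' Q' s' R' t' S' where Y: "y = (P', f', Q', s', R', t', S')"
        "us = P' @ f' # Q' @ s' # R' @ t' # S'" "reversed rt f' s' t'"
        using y by (auto simp: rsplits3_def)
      have ts: "t' = t" "s' = s" "f' = f" using e X Y by (auto simp: reversed_def)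
      have eq: "P @ f # Q @ s # R @ t # S = P' @ f # Q' @ s # R' @ t # S'"
        using X(2) Y(2) ts by simp
      have "distinct (P @ f # Q @ s # R @ t # S)" using dist X(2) by auto
      from this split_unique[OF this eq]
      have 1: "P = P'" "Q @ s # R @ t # S = Q' @ s # R' @ t # S'" "distinct (Q @ s # R @ t # S)" by auto
      from this(3) split_unique[OF this(3,2)]
      have 2: "Q = Q'" "R @ t # S = R' @ t # S'" "distinct (R @ t # S)" by auto
      from split_unique[OF 2(3,2)] 1 2 ts
      show "x = y" using X(1) Y(1) by simp
    qed
    show "(\<lambda>(P, f, Q, s, R, t, S). t) ` rsplits3 rt us = rev_darts rt ?zs"
    proof (intro subset_antisym subsetI)
      fix t assume "t \<in> (\<lambda>(P, f, Q, s, R, t, S). t) ` rsplits3 rt us"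
      then obtain P f Q s R S where us: "us = P @ f # Q @ s # R @ t # S" and rv: "reversed rt f s t"
        by (auto simp: rsplits3_def)
      have du: "distinct us" using dist by auto
      have "f \<in> set us" "s \<in> set us" "t \<in> set us" using us by auto
      moreover have "idx us f < idx us s" "idx us s < idx us t" using du unfolding us by auto
      ultimately show "t \<in> rev_darts rt ?zs"
        using rv idx_us by (simp add: rev_darts_def reversed_def)
    next
      fix t assume t: "t \<in> rev_darts rt ?zs"
      define s f where "s = rt t" and "f = rt s"
      have lt: "idx ?zs f < idx ?zs s" "idx ?zs s < idx ?zs t" and td: "t \<in> D"
        using t D by (auto simp: rev_darts_def s_def f_def)
      have sf: "s \<in> D" "f \<in> D" "rt f = t"
        using td cubic_pairD[OF cp] by (auto simp: s_def f_def)
      have "t \<noteq> r" "s \<noteq> r" using lt r by (auto simp: s_def)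
      moreover have "f \<noteq> r"
      proof
        assume "f = r"
        then have "t = f" using sf(3) r by simp
        then show False using lt by simp
      qed
      ultimately have in_us: "f \<in> set us" "s \<in> set us" "t \<in> set us" using td sf D by auto
      have "idx us f < idx us s" "idx us s < idx us t" using lt in_us idx_us by auto
      then obtain P Q R S where "us = P @ f # Q @ s # R @ t # S"
        using idx_less3E[OF _ in_us] dist by (metis distinct.simps(2))
      then have "(P, f, Q, s, R, t, S) \<in> rsplits3 rt us"
        using sf by (simp add: rsplits3_def reversed_def s_def f_def)
      then show "t \<in> (\<lambda>(P, f, Q, s, R, t, S). t) ` rsplits3 rt us" by (rule rev_image_eqI) simp
    qed
  qed
  then show ?thesis by (metis bij_betw_same_card)
qed

lemma duo_rsplits:
  assumes m: "(rt, op, r, us, q, vs) \<in> duo D x y"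
  shows "card (rev_darts rt (r # us @ q # vs)) = card (rsplits3 rt us) + card (rsplits21 rt us vs)
     + card (rsplits12 rt us vs) + card (rsplits3 rt vs)"
proof -
  have cp: "cubic_pair D rt op" and D: "set (r # us @ q # vs) = D"
    using m by (auto simp: duo_def)
  interpret two_words rt r q us vs
  proof
    show "distinct (r # us @ q # vs)" "rt r = r" "rt q = q" using m by (auto simp: duo_def face_list_def)
    show "rt d \<in> set (r # us @ q # vs)" "rt (rt (rt d)) = d" if "d \<in> set (r # us @ q # vs)" for d
      using that cubic_pairD(6,7)[OF cp, of d] unfolding D by blast+
  qed
  show ?thesis by (rule rev_darts_split)
qed

lemma finite_distinct_lists: "finite D \<Longrightarrow> finite {xs. distinct xs \<and> set xs \<subseteq> D}"
proof -
  assume D: "finite D"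
  have "{xs. distinct xs \<and> set xs \<subseteq> D} = {xs. set xs \<subseteq> D \<and> distinct xs}" by blast
  then show ?thesis using finite_subset_distinct[OF D] by (simp only:)
qed

lemma finite_uni: "finite D \<Longrightarrow> finite (uni D x)"
proof -
  assume D: "finite D"
  let ?P = "{p. p permutes D}" and ?L = "{xs. distinct xs \<and> set xs \<subseteq> D}"
  have "uni D x \<subseteq> ?P \<times> ?P \<times> D \<times> ?L"
    by (auto simp: uni_def cubic_pair_def face_list_def)
  then show ?thesis
    by (rule finite_subset) (intro finite_cartesian_product finite_permutations finite_distinct_lists D)
qed

lemma finite_duo: "finite D \<Longrightarrow> finite (duo D x y)"
proof -
  assume D: "finite D"
  let ?P = "{p. p permutes D}" and ?L = "{xs. distinct xs \<and> set xs \<subseteq> D}"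
  have "duo D x y \<subseteq> ?P \<times> ?P \<times> D \<times> ?L \<times> D \<times> ?L"
    by (auto simp: duo_def cubic_pair_def face_list_def)
  then show ?thesis
    by (rule finite_subset) (intro finite_cartesian_product finite_permutations finite_distinct_lists D)
qed

lemma finite_rsplits:
  "finite (rsplits3 rt us)" "finite (rsplits21 rt us vs)" "finite (rsplits12 rt us vs)"
proof -
  have "rsplits3 rt us \<subseteq> splits3 (\<lambda>_. True) us" by (auto simp: rsplits3_def splits3_def)
  then show "finite (rsplits3 rt us)" using finite_splits(4) finite_subset by blast
  have "rsplits21 rt us vs \<subseteq> splits2' (\<lambda>_. True) us \<times> splits1 (\<lambda>_. True) vs"
    by (auto simp: rsplits21_def splits2'_def splits1_def)
  then show "finite (rsplits21 rt us vs)"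
    using finite_cartesian_product[OF finite_splits(3,1)] finite_subset by blast
  have "rsplits12 rt us vs \<subseteq> splits1 (\<lambda>_. True) us \<times> splits2' (\<lambda>_. True) vs"
    by (auto simp: rsplits12_def splits2'_def splits1_def)
  then show "finite (rsplits12 rt us vs)"
    using finite_cartesian_product[OF finite_splits(1,3)] finite_subset by blast
qed

section \<open>Rearrangement of face words under gluing\<close>

lemma path_word1:
  "path g (r # (P @ f # Q) @ [z]) \<longleftrightarrow> path g (r # P @ [f]) \<and> path g (f # Q @ [z])"
  using path_two[of g r P f "Q @ [z]"] by simp

lemma path_word2:
  "path g (r # (P @ f # Q @ s # R) @ [z]) \<longleftrightarrow>
     path g (r # P @ [f]) \<and> path g (f # Q @ [s]) \<and> path g (s # R @ [z])"
  using path_two[of g r P f "Q @ s # R @ [z]"] path_two[of g f Q s "R @ [z]"] by simp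

lemma path_word3:
  "path g (r # (P @ f # Q @ s # R @ t # S) @ [z]) \<longleftrightarrow>
     path g (r # P @ [f]) \<and> path g (f # Q @ [s]) \<and> path g (s # R @ [t]) \<and> path g (t # S @ [z])"
  using path_two[of g r P f "Q @ s # R @ t # S @ [z]"] path_two[of g f Q s "R @ t # S @ [z]"]
    path_two[of g s R t "S @ [z]"] by simp

context
  fixes f s t :: nat and rt rt' :: "nat \<Rightarrow> nat"
  assumes dist: "f \<noteq> s" "s \<noteq> t" "f \<noteq> t" and rt': "rt' = cyc3 f s t \<circ> rt"
begin

text \<open>The three darts cut the faces into stretches which survive unchanged; gluing and cutting
  merely permute their ends. The effect on faces is therefore found by reassembling
  stretches.\<close>

lemma seg:
  assumes "set xs \<inter> {f, s, t} = {}"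
  shows "path (rt' \<circ> op) (x # xs @ [f]) \<longleftrightarrow> path (rt \<circ> op) (x # xs @ [s])"
    and "path (rt' \<circ> op) (x # xs @ [s]) \<longleftrightarrow> path (rt \<circ> op) (x # xs @ [t])"
    and "path (rt' \<circ> op) (x # xs @ [t]) \<longleftrightarrow> path (rt \<circ> op) (x # xs @ [f])"
    and "r \<notin> {f, s, t} \<Longrightarrow> path (rt' \<circ> op) (x # xs @ [r]) \<longleftrightarrow> path (rt \<circ> op) (x # xs @ [r])"
proof -
  have *: "path (rt' \<circ> op) (x # xs @ [cyc3 f s t a]) \<longleftrightarrow> path (rt \<circ> op) (x # xs @ [a])" for a
    by (rule path_cyc3[OF dist assms]) (simp add: rt')
  have c: "cyc3 f s t s = f" "cyc3 f s t t = s" "cyc3 f s t f = t" "r \<notin> {f, s, t} \<Longrightarrow> cyc3 f s t r = r"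
    using dist by (simp_all add: cyc3_def)
  show "path (rt' \<circ> op) (x # xs @ [f]) \<longleftrightarrow> path (rt \<circ> op) (x # xs @ [s])" using *[of s] c by simp
  show "path (rt' \<circ> op) (x # xs @ [s]) \<longleftrightarrow> path (rt \<circ> op) (x # xs @ [t])" using *[of t] c by simp
  show "path (rt' \<circ> op) (x # xs @ [t]) \<longleftrightarrow> path (rt \<circ> op) (x # xs @ [f])" using *[of f] c by simp
  show "r \<notin> {f, s, t} \<Longrightarrow> path (rt' \<circ> op) (x # xs @ [r]) \<longleftrightarrow> path (rt \<circ> op) (x # xs @ [r])"
    using *[of r] c by simp
qed

lemma cubic_pair_glue_iff:
  assumes "{f, s, t} \<subseteq> D"
  shows "cubic_pair D rt' op \<and> reversed rt' f s t \<longleftrightarrow> cubic_pair D rt op \<and> rt f = f \<and> rt s = s \<and> rt t = t"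
  using glue_iff[of f D s t rt op] dist assms unfolding rt' reversed_def by auto

lemma glue_fix:
  assumes "cubic_pair D rt op" "rt f = f" "rt s = s" "rt t = t"
  shows "set xs \<inter> {f, s, t} = {} \<Longrightarrow> num_fix rt' xs = num_fix rt xs"
    and "rt' f \<noteq> f" "rt' s \<noteq> s" "rt' t \<noteq> t"
    and "r \<notin> {f, s, t} \<Longrightarrow> rt' r = r \<longleftrightarrow> rt r = r"
proof -
  have inj: "inj rt" using cubic_pairD(8)[OF assms(1)] .
  show *: "set xs \<inter> {f, s, t} = {} \<Longrightarrow> num_fix rt' xs = num_fix rt xs" for xs
    unfolding rt' using dist assms(2-4) inj by (intro num_fix_glue) auto
  show "rt' f \<noteq> f" "rt' s \<noteq> s" "rt' t \<noteq> t"
    using dist assms by (simp_all add: rt' cyc3_def)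
  show "r \<notin> {f, s, t} \<Longrightarrow> rt' r = r \<longleftrightarrow> rt r = r"
    using *[of "[r]"] by (auto split: if_splits)
qed

text \<open>In the glued face the stretches starting at r, f, s, t end at f, s, t, r; after the cut
  they end at s, t, f, r and join up to a single word again. A vertex that agrees with the word
  would instead break the face into three.\<close>

lemma uni_glue:
  "(rt', op, r, P @ f # Q @ s # R @ t # S) \<in> uni D x \<and> reversed rt' f s t \<longleftrightarrow>
   (rt, op, r, P @ s # R @ f # Q @ t # S) \<in> uni D (x + 3) \<and> rt s = s \<and> rt f = f \<and> rt t = t"
  (is "?l \<longleftrightarrow> ?r")
proof (cases "distinct (r # P @ f # Q @ s # R @ t # S) \<and> set (r # P @ f # Q @ s # R @ t # S) = D")
  case False
  have "mset (r # P @ f # Q @ s # R @ t # S) = mset (r # P @ s # R @ f # Q @ t # S)" by simp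
  then have "distinct (r # P @ f # Q @ s # R @ t # S) = distinct (r # P @ s # R @ f # Q @ t # S)"
    "set (r # P @ f # Q @ s # R @ t # S) = set (r # P @ s # R @ f # Q @ t # S)"
    by (rule mset_eq_imp_distinct_iff, rule mset_eq_setD)
  with False show ?thesis unfolding uni_def face_list_def mem_Collect_eq prod.case by blast
next
  case True
  have "mset (r # P @ f # Q @ s # R @ t # S) = mset (r # P @ s # R @ f # Q @ t # S)" by simp
  then have eqs: "distinct (r # P @ f # Q @ s # R @ t # S) = distinct (r # P @ s # R @ f # Q @ t # S)"
    "set (r # P @ f # Q @ s # R @ t # S) = set (r # P @ s # R @ f # Q @ t # S)"
    by (rule mset_eq_imp_distinct_iff, rule mset_eq_setD)
  have d: "distinct (r # P @ f # Q @ s # R @ t # S)" "distinct (r # P @ s # R @ f # Q @ t # S)"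
    and D: "set (r # P @ f # Q @ s # R @ t # S) = D" "set (r # P @ s # R @ f # Q @ t # S) = D"
    using True eqs by blast+
  have sub: "{f, s, t} \<subseteq> D" and rn: "r \<notin> {f, s, t}"
    and av: "set P \<inter> {f, s, t} = {}" "set Q \<inter> {f, s, t} = {}" "set R \<inter> {f, s, t} = {}" "set S \<inter> {f, s, t} = {}"
    using d(1) D(1) by auto
  have face: "face_list (rt' \<circ> op) r (P @ f # Q @ s # R @ t # S) \<longleftrightarrow>
      face_list (rt \<circ> op) r (P @ s # R @ f # Q @ t # S)"
    unfolding face_list_def path_word3 seg[OF av(1)] seg[OF av(2)] seg[OF av(3)] seg(4)[OF av(4) rn]
    using d by blast
  show ?thesis
  proof (cases "cubic_pair D rt op \<and> rt f = f \<and> rt s = s \<and> rt t = t")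
    case False
    then show ?thesis
      using cubic_pair_glue_iff[OF sub, of op] unfolding uni_def mem_Collect_eq prod.case by blast
  next
    case True
    then have cp: "cubic_pair D rt op" "rt f = f" "rt s = s" "rt t = t" by blast+
    have cp': "cubic_pair D rt' op" "reversed rt' f s t"
      using cubic_pair_glue_iff[OF sub, of op] cp by blast+
    have "num_fix rt (P @ s # R @ f # Q @ t # S) = num_fix rt' (P @ f # Q @ s # R @ t # S) + 3"
      using glue_fix(1)[OF cp av(1)] glue_fix(1)[OF cp av(2)] glue_fix(1)[OF cp av(3)]
        glue_fix(1)[OF cp av(4)] glue_fix(2-4)[OF cp] cp by simp
    then have "num_fix rt' (P @ f # Q @ s # R @ t # S) = x \<longleftrightarrow>
        num_fix rt (P @ s # R @ f # Q @ t # S) = x + 3" by simp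
    then show ?thesis
      using cp cp' D face glue_fix(5)[OF cp rn] unfolding uni_def mem_Collect_eq prod.case by blast
  qed
qed

lemma duo_glue3:
  "(rt', op, r, P @ f # Q @ s # R @ t # S, q, vs) \<in> duo D x y \<and> reversed rt' f s t \<longleftrightarrow>
   (rt, op, r, P @ s # R @ f # Q @ t # S, q, vs) \<in> duo D (x + 3) y \<and> rt s = s \<and> rt f = f \<and> rt t = t"
proof -
  let ?us = "P @ f # Q @ s # R @ t # S" and ?us' = "P @ s # R @ f # Q @ t # S"
  have "mset (r # ?us) = mset (r # ?us')" by simp
  then have eqs: "distinct (r # ?us) = distinct (r # ?us')" "set (r # ?us) = set (r # ?us')"
    by (rule mset_eq_imp_distinct_iff, rule mset_eq_setD)
  show ?thesis
  proof (cases "distinct (r # ?us) \<and> distinct (q # vs) \<and> set (r # ?us) \<inter> set (q # vs) = {} \<and>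
      set (r # ?us) \<union> set (q # vs) = D")
    case False
    with eqs show ?thesis unfolding duo_def face_list_def mem_Collect_eq prod.case by blast
  next
    case True
    then have d: "distinct (r # ?us)" "distinct (r # ?us')" "distinct (q # vs)"
      and D: "set (r # ?us) \<union> set (q # vs) = D" "set (r # ?us') \<union> set (q # vs) = D"
      and disj: "set (r # ?us) \<inter> set (q # vs) = {}" "set (r # ?us') \<inter> set (q # vs) = {}"
      using eqs by blast+
    have sub: "{f, s, t} \<subseteq> D" and rn: "r \<notin> {f, s, t}" and qn: "q \<notin> {f, s, t}"
      and av: "set P \<inter> {f, s, t} = {}" "set Q \<inter> {f, s, t} = {}" "set R \<inter> {f, s, t} = {}"
        "set S \<inter> {f, s, t} = {}" "set vs \<inter> {f, s, t} = {}"
      using d(1) D(1) disj by auto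
    have face: "face_list (rt' \<circ> op) r ?us \<longleftrightarrow> face_list (rt \<circ> op) r ?us'"
      unfolding face_list_def path_word3 seg[OF av(1)] seg[OF av(2)] seg[OF av(3)] seg(4)[OF av(4) rn]
      using d by blast
    have face2: "face_list (rt' \<circ> op) q vs \<longleftrightarrow> face_list (rt \<circ> op) q vs"
      unfolding face_list_def seg(4)[OF av(5) qn] by blast
    show ?thesis
    proof (cases "cubic_pair D rt op \<and> rt f = f \<and> rt s = s \<and> rt t = t")
      case False
      then show ?thesis
        using cubic_pair_glue_iff[OF sub, of op] unfolding duo_def mem_Collect_eq prod.case by blast
    next
      case True
      then have cp: "cubic_pair D rt op" "rt f = f" "rt s = s" "rt t = t" by blast+
      have cp': "cubic_pair D rt' op" "reversed rt' f s t"
        using cubic_pair_glue_iff[OF sub, of op] cp by blast+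
      have "num_fix rt ?us' = num_fix rt' ?us + 3"
        using glue_fix(1)[OF cp av(1)] glue_fix(1)[OF cp av(2)] glue_fix(1)[OF cp av(3)]
          glue_fix(1)[OF cp av(4)] glue_fix(2-4)[OF cp] cp by simp
      then have "num_fix rt' ?us = x \<longleftrightarrow> num_fix rt ?us' = x + 3" by simp
      then show ?thesis
        using cp cp' D disj face face2 glue_fix(5)[OF cp rn] glue_fix(5)[OF cp qn] glue_fix(1)[OF cp av(5)]
        unfolding duo_def mem_Collect_eq prod.case by metis
    qed
  qed
qed

text \<open>After the cut the stretch starting at f ends at t, so it moves with its \<open>k\<close>
  leaves into the second face. The first face gains the leaf s, the second one the leaves f and t,
  whence \<open>x + 1 - k\<close> and \<open>y + k + 2\<close>; the bound on \<open>k\<close> makes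
  the subtraction exact.\<close>

lemma duo_glue21:
  assumes k: "k \<le> x"
  shows "(rt', op, r, P @ f # Q @ s # R, q, U @ t # V) \<in> duo D x y \<and> reversed rt' f s t \<and> num_fix rt' Q = k
   \<longleftrightarrow> (rt, op, r, P @ s # R, q, U @ f # Q @ t # V) \<in> duo D (x + 1 - k) (y + k + 2) \<and>
     rt s = s \<and> rt f = f \<and> rt t = t \<and> num_fix rt Q = k"
proof -
  let ?us = "P @ f # Q @ s # R" and ?vs = "U @ t # V" and ?us' = "P @ s # R" and ?vs' = "U @ f # Q @ t # V"
  have "mset ((r # ?us) @ q # ?vs) = mset ((r # ?us') @ q # ?vs')" by simp
  then have eqs: "distinct ((r # ?us) @ q # ?vs) = distinct ((r # ?us') @ q # ?vs')"
    "set ((r # ?us) @ q # ?vs) = set ((r # ?us') @ q # ?vs')"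
    by (rule mset_eq_imp_distinct_iff, rule mset_eq_setD)
  have duo_iff: "(g, op, r, us, q, vs) \<in> duo D x y \<longleftrightarrow> cubic_pair D g op \<and>
      distinct ((r # us) @ q # vs) \<and> set ((r # us) @ q # vs) = D \<and> path (g \<circ> op) (r # us @ [r]) \<and>
      path (g \<circ> op) (q # vs @ [q]) \<and> g r = r \<and> g q = q \<and> num_fix g us = x \<and> num_fix g vs = y"
    for g us vs x y
    unfolding duo_def face_list_def mem_Collect_eq prod.case distinct_append set_append by blast
  show ?thesis
  proof (cases "distinct ((r # ?us) @ q # ?vs) \<and> set ((r # ?us) @ q # ?vs) = D")
    case False
    with eqs show ?thesis unfolding duo_iff by blast
  next
    case True
    then have d: "distinct ((r # ?us) @ q # ?vs)" "distinct ((r # ?us') @ q # ?vs')"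
      and D: "set ((r # ?us) @ q # ?vs) = D" "set ((r # ?us') @ q # ?vs') = D"
      using eqs by blast+
    have sub: "{f, s, t} \<subseteq> D" and rn: "r \<notin> {f, s, t}" and qn: "q \<notin> {f, s, t}"
      and av: "set P \<inter> {f, s, t} = {}" "set Q \<inter> {f, s, t} = {}" "set R \<inter> {f, s, t} = {}"
        "set U \<inter> {f, s, t} = {}" "set V \<inter> {f, s, t} = {}"
      using d(1) D(1) by auto
    have face: "path (rt' \<circ> op) (r # ?us @ [r]) \<and> path (rt' \<circ> op) (q # ?vs @ [q]) \<longleftrightarrow>
        path (rt \<circ> op) (r # ?us' @ [r]) \<and> path (rt \<circ> op) (q # ?vs' @ [q])"
      unfolding path_word2 path_word1 seg[OF av(1)] seg[OF av(2)] seg[OF av(4)]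
        seg(4)[OF av(3) rn] seg(4)[OF av(5) qn]
      by blast
    show ?thesis
    proof (cases "cubic_pair D rt op \<and> rt f = f \<and> rt s = s \<and> rt t = t")
      case False
      then show ?thesis
        using cubic_pair_glue_iff[OF sub, of op] unfolding duo_iff by blast
    next
      case True
      then have cp: "cubic_pair D rt op" "rt f = f" "rt s = s" "rt t = t" by blast+
      have cp': "cubic_pair D rt' op" "reversed rt' f s t"
        using cubic_pair_glue_iff[OF sub, of op] cp by blast+
      note gf = glue_fix(1)[OF cp av(1)] glue_fix(1)[OF cp av(2)] glue_fix(1)[OF cp av(3)]
          glue_fix(1)[OF cp av(4)] glue_fix(1)[OF cp av(5)] glue_fix(2-4)[OF cp]
      have "num_fix rt ?us' + num_fix rt Q = num_fix rt' ?us + 1"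
        "num_fix rt ?vs' = num_fix rt' ?vs + num_fix rt Q + 2"
        using gf cp by simp_all
      then have "num_fix rt' ?us = x \<and> num_fix rt' ?vs = y \<and> num_fix rt' Q = k \<longleftrightarrow>
          num_fix rt ?us' = x + 1 - k \<and> num_fix rt ?vs' = y + k + 2 \<and> num_fix rt Q = k"
        using gf(2) k by auto
      then show ?thesis
        using cp cp' D d face glue_fix(5)[OF cp rn] glue_fix(5)[OF cp qn] unfolding duo_iff by blast
    qed
  qed
qed

end

section \<open>Bijections between reversed vertices and triples of leaves\<close>

lemma uni_distinct: "(rt, op, r, us) \<in> uni D x \<Longrightarrow> distinct us"
  by (simp add: uni_def face_list_def)

lemma duo_distinct: "(rt, op, r, us, q, vs) \<in> duo D x y \<Longrightarrow> distinct (us @ vs)"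
  by (auto simp: duo_def face_list_def)

text \<open>In the cut word the leaves appear in the order s, f, t. Conversely any three leaves of a
  word can be named in this way and glued, so a triple of leaves is subject to no condition.\<close>

lemma card_uni_glue:
  "card (SIGMA m : uni D x. case m of (rt, op, r, us) \<Rightarrow> rsplits3 rt us)
   = card (SIGMA m : uni D (x + 3). case m of (rt, op, r, us) \<Rightarrow> splits3 (\<lambda>d. rt d = d) us)"
  (is "card ?A = card ?B")
proof (rule bij_betw_same_card)
  let ?F = "\<lambda>((rt, op, r, us), (P, f, Q, s, R, t, S)).
    ((cyc3 f t s \<circ> rt, op, r, P @ s # R @ f # Q @ t # S), (P, s, R, f, Q, t, S))"
  let ?G = "\<lambda>((rt, op, r, us), (P, s, R, f, Q, t, S)).
    ((cyc3 f s t \<circ> rt, op, r, P @ f # Q @ s # R @ t # S), (P, f, Q, s, R, t, S))"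
  have A: "\<exists>rt op r P f Q s R t S. z = ((rt, op, r, P @ f # Q @ s # R @ t # S), (P, f, Q, s, R, t, S)) \<and>
      (rt, op, r, P @ f # Q @ s # R @ t # S) \<in> uni D x \<and> reversed rt f s t \<and> f \<noteq> s \<and> s \<noteq> t \<and> f \<noteq> t"
    if "z \<in> ?A" for z
    using that uni_distinct by (fastforce simp: rsplits3_def)
  have B: "\<exists>rt op r P f Q s R t S. z = ((rt, op, r, P @ s # R @ f # Q @ t # S), (P, s, R, f, Q, t, S)) \<and>
      (rt, op, r, P @ s # R @ f # Q @ t # S) \<in> uni D (x + 3) \<and> rt s = s \<and> rt f = f \<and> rt t = t \<and>
      f \<noteq> s \<and> s \<noteq> t \<and> f \<noteq> t"
    if "z \<in> ?B" for z
    using that uni_distinct by (fastforce simp: splits3_def)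
  show "bij_betw ?F ?A ?B"
  proof (rule bij_betw_byWitness[where f' = ?G])
    show "\<forall>z\<in>?A. ?G (?F z) = z"
    proof
      fix z assume "z \<in> ?A"
      from A[OF this] show "?G (?F z) = z" by (elim exE conjE) (simp add: glue_cut)
    qed
    show "\<forall>z\<in>?B. ?F (?G z) = z"
    proof
      fix z assume "z \<in> ?B"
      from B[OF this] show "?F (?G z) = z" by (elim exE conjE) (simp add: glue_cut)
    qed
    show "?F ` ?A \<subseteq> ?B"
    proof (rule image_subsetI)
      fix z assume zA: "z \<in> ?A"
      obtain rt op r P f Q s R t S where z: "z = ((rt, op, r, P @ f # Q @ s # R @ t # S), (P, f, Q, s, R, t, S))"
        and m: "(rt, op, r, P @ f # Q @ s # R @ t # S) \<in> uni D x" "reversed rt f s t"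
        and ne: "f \<noteq> s" "s \<noteq> t" "f \<noteq> t"
        using A[OF zA] by (elim exE conjE) (rule that; assumption)
      have "rt = cyc3 f s t \<circ> (cyc3 f t s \<circ> rt)" by (rule glue_cut(2)[OF ne, symmetric])
      from uni_glue[OF ne this, of op r P Q R S D x] m show "?F z \<in> ?B"
        unfolding z by (simp add: splits3_def)
    qed
    show "?G ` ?B \<subseteq> ?A"
    proof (rule image_subsetI)
      fix z assume zB: "z \<in> ?B"
      obtain rt op r P f Q s R t S where z: "z = ((rt, op, r, P @ s # R @ f # Q @ t # S), (P, s, R, f, Q, t, S))"
        and m: "(rt, op, r, P @ s # R @ f # Q @ t # S) \<in> uni D (x + 3)" "rt s = s" "rt f = f" "rt t = t"
        and ne: "f \<noteq> s" "s \<noteq> t" "f \<noteq> t"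
        using B[OF zB] by (elim exE conjE) (rule that; assumption)
      from uni_glue[OF ne refl, of rt op r P Q R S D x] m show "?G z \<in> ?A"
        unfolding z by (simp add: rsplits3_def)
    qed
  qed
qed

lemma card_duo_glue3:
  "card (SIGMA m : duo D x y. case m of (rt, op, r, us, q, vs) \<Rightarrow> rsplits3 rt us)
   = card (SIGMA m : duo D (x + 3) y. case m of (rt, op, r, us, q, vs) \<Rightarrow> splits3 (\<lambda>d. rt d = d) us)"
  (is "card ?A = card ?B")
proof (rule bij_betw_same_card)
  let ?F = "\<lambda>((rt, op, r, us, q, vs), (P, f, Q, s, R, t, S)).
    ((cyc3 f t s \<circ> rt, op, r, P @ s # R @ f # Q @ t # S, q, vs), (P, s, R, f, Q, t, S))"
  let ?G = "\<lambda>((rt, op, r, us, q, vs), (P, s, R, f, Q, t, S)).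
    ((cyc3 f s t \<circ> rt, op, r, P @ f # Q @ s # R @ t # S, q, vs), (P, f, Q, s, R, t, S))"
  have A: "\<exists>rt op r P f Q s R t S q vs. z = ((rt, op, r, P @ f # Q @ s # R @ t # S, q, vs), (P, f, Q, s, R, t, S)) \<and>
      (rt, op, r, P @ f # Q @ s # R @ t # S, q, vs) \<in> duo D x y \<and> reversed rt f s t \<and> f \<noteq> s \<and> s \<noteq> t \<and> f \<noteq> t"
    if "z \<in> ?A" for z
    using that duo_distinct by (fastforce simp: rsplits3_def)
  have B: "\<exists>rt op r P f Q s R t S q vs. z = ((rt, op, r, P @ s # R @ f # Q @ t # S, q, vs), (P, s, R, f, Q, t, S)) \<and>
      (rt, op, r, P @ s # R @ f # Q @ t # S, q, vs) \<in> duo D (x + 3) y \<and> rt s = s \<and> rt f = f \<and> rt t = t \<and>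
      f \<noteq> s \<and> s \<noteq> t \<and> f \<noteq> t"
    if "z \<in> ?B" for z
    using that duo_distinct by (fastforce simp: splits3_def)
  show "bij_betw ?F ?A ?B"
  proof (rule bij_betw_byWitness[where f' = ?G])
    show "\<forall>z\<in>?A. ?G (?F z) = z"
    proof
      fix z assume "z \<in> ?A"
      from A[OF this] show "?G (?F z) = z" by (elim exE conjE) (simp add: glue_cut)
    qed
    show "\<forall>z\<in>?B. ?F (?G z) = z"
    proof
      fix z assume "z \<in> ?B"
      from B[OF this] show "?F (?G z) = z" by (elim exE conjE) (simp add: glue_cut)
    qed
    show "?F ` ?A \<subseteq> ?B"
    proof (rule image_subsetI)
      fix z assume zA: "z \<in> ?A"
      obtain rt op r P f Q s R t S q vs where z: "z = ((rt, op, r, P @ f # Q @ s # R @ t # S, q, vs), (P, f, Q, s, R, t, S))"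
        and m: "(rt, op, r, P @ f # Q @ s # R @ t # S, q, vs) \<in> duo D x y" "reversed rt f s t"
        and ne: "f \<noteq> s" "s \<noteq> t" "f \<noteq> t"
        using A[OF zA] by (elim exE conjE) (rule that; assumption)
      have "rt = cyc3 f s t \<circ> (cyc3 f t s \<circ> rt)" by (rule glue_cut(2)[OF ne, symmetric])
      from duo_glue3[OF ne this, of op r P Q R S q vs D x y] m show "?F z \<in> ?B"
        unfolding z by (simp add: splits3_def)
    qed
    show "?G ` ?B \<subseteq> ?A"
    proof (rule image_subsetI)
      fix z assume zB: "z \<in> ?B"
      obtain rt op r P f Q s R t S q vs where z: "z = ((rt, op, r, P @ s # R @ f # Q @ t # S, q, vs), (P, s, R, f, Q, t, S))"
        and m: "(rt, op, r, P @ s # R @ f # Q @ t # S, q, vs) \<in> duo D (x + 3) y" "rt s = s" "rt f = f" "rt t = t"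
        and ne: "f \<noteq> s" "s \<noteq> t" "f \<noteq> t"
        using B[OF zB] by (elim exE conjE) (rule that; assumption)
      from duo_glue3[OF ne refl, of rt op r P Q R S q vs D x y] m show "?G z \<in> ?A"
        unfolding z by (simp add: rsplits3_def)
    qed
  qed
qed

lemma card_duo_glue21:
  assumes k: "k \<le> x"
  shows "card (SIGMA m : duo D x y. case m of (rt, op, r, us, q, vs) \<Rightarrow>
       {((P, f, Q, s, R), w) \<in> rsplits21 rt us vs. num_fix rt Q = k})
   = card (SIGMA m : duo D (x + 1 - k) (y + k + 2). case m of (rt, op, r, us, q, vs) \<Rightarrow>
       splits1 (\<lambda>d. rt d = d) us \<times> splits2 (\<lambda>d. rt d = d) k vs)"
  (is "card ?A = card ?B")
proof (rule bij_betw_same_card)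
  let ?F = "\<lambda>((rt, op, r, us, q, vs), ((P, f, Q, s, R), (U, t, V))).
    ((cyc3 f t s \<circ> rt, op, r, P @ s # R, q, U @ f # Q @ t # V), ((P, s, R), (U, f, Q, t, V)))"
  let ?G = "\<lambda>((rt, op, r, us, q, vs), ((P, s, R), (U, f, Q, t, V))).
    ((cyc3 f s t \<circ> rt, op, r, P @ f # Q @ s # R, q, U @ t # V), ((P, f, Q, s, R), (U, t, V)))"
  have A: "\<exists>rt op r P f Q s R q U t V. z = ((rt, op, r, P @ f # Q @ s # R, q, U @ t # V), ((P, f, Q, s, R), (U, t, V))) \<and>
      (rt, op, r, P @ f # Q @ s # R, q, U @ t # V) \<in> duo D x y \<and> reversed rt f s t \<and> num_fix rt Q = k \<and>
      f \<noteq> s \<and> s \<noteq> t \<and> f \<noteq> t"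
    if "z \<in> ?A" for z
    using that duo_distinct by (fastforce simp: rsplits21_def)
  have B: "\<exists>rt op r P f Q s R q U t V. z = ((rt, op, r, P @ s # R, q, U @ f # Q @ t # V), ((P, s, R), (U, f, Q, t, V))) \<and>
      (rt, op, r, P @ s # R, q, U @ f # Q @ t # V) \<in> duo D (x + 1 - k) (y + k + 2) \<and>
      rt s = s \<and> rt f = f \<and> rt t = t \<and> num_fix rt Q = k \<and> f \<noteq> s \<and> s \<noteq> t \<and> f \<noteq> t"
    if "z \<in> ?B" for z
    using that duo_distinct by (fastforce simp: splits1_def splits2_def num_fix_def)
  show "bij_betw ?F ?A ?B"
  proof (rule bij_betw_byWitness[where f' = ?G])
    show "\<forall>z\<in>?A. ?G (?F z) = z"
    proof
      fix z assume "z \<in> ?A"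
      from A[OF this] show "?G (?F z) = z" by (elim exE conjE) (simp add: glue_cut)
    qed
    show "\<forall>z\<in>?B. ?F (?G z) = z"
    proof
      fix z assume "z \<in> ?B"
      from B[OF this] show "?F (?G z) = z" by (elim exE conjE) (simp add: glue_cut)
    qed
    show "?F ` ?A \<subseteq> ?B"
    proof (rule image_subsetI)
      fix z assume zA: "z \<in> ?A"
      obtain rt op r P f Q s R q U t V where z: "z = ((rt, op, r, P @ f # Q @ s # R, q, U @ t # V), ((P, f, Q, s, R), (U, t, V)))"
        and m: "(rt, op, r, P @ f # Q @ s # R, q, U @ t # V) \<in> duo D x y" "reversed rt f s t" "num_fix rt Q = k"
        and ne: "f \<noteq> s" "s \<noteq> t" "f \<noteq> t"
        using A[OF zA] by (elim exE conjE) (rule that; assumption)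
      have "rt = cyc3 f s t \<circ> (cyc3 f t s \<circ> rt)" by (rule glue_cut(2)[OF ne, symmetric])
      from duo_glue21[OF ne this k, of op r P Q R q U V D y] m show "?F z \<in> ?B"
        unfolding z by (simp add: splits1_def splits2_def num_fix_def)
    qed
    show "?G ` ?B \<subseteq> ?A"
    proof (rule image_subsetI)
      fix z assume zB: "z \<in> ?B"
      obtain rt op r P f Q s R q U t V where z: "z = ((rt, op, r, P @ s # R, q, U @ f # Q @ t # V), ((P, s, R), (U, f, Q, t, V)))"
        and m: "(rt, op, r, P @ s # R, q, U @ f # Q @ t # V) \<in> duo D (x + 1 - k) (y + k + 2)"
          "rt s = s" "rt f = f" "rt t = t" "num_fix rt Q = k"
        and ne: "f \<noteq> s" "s \<noteq> t" "f \<noteq> t"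
        using B[OF zB] by (elim exE conjE) (rule that; assumption)
      from duo_glue21[OF ne refl k, of rt op r P Q R q U V D y] m show "?G z \<in> ?A"
        unfolding z by (simp add: rsplits21_def)
    qed
  qed
qed

lemma card_duo_swap: "card (duo D x y) = card (duo D y x)"
proof (rule bij_betw_same_card)
  let ?F = "\<lambda>(rt, op, r, us, q, vs). (rt, op, q, vs, r, us)"
  show "bij_betw ?F (duo D x y) (duo D y x)"
    by (rule bij_betw_byWitness[where f' = ?F]) (auto simp: duo_def)
qed

text \<open>Being reversed is invariant under cyclic shifts of the three darts, so exchanging the
  faces turns one kind of mixed vertex into the other.\<close>

lemma rsplits12_swap:
  "card (rsplits12 rt us vs) = card (rsplits21 rt vs us)"
proof (rule bij_betw_same_card)
  let ?F = "\<lambda>((P, f, Q), (U, s, R, t, V)). ((U, s, R, t, V), (P, f, Q))"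
  let ?G = "\<lambda>((U, s, R, t, V), (P, f, Q)). ((P, f, Q), (U, s, R, t, V))"
  show "bij_betw ?F (rsplits12 rt us vs) (rsplits21 rt vs us)"
    by (rule bij_betw_byWitness[where f' = ?G])
      (auto simp: rsplits12_def rsplits21_def reversed_def)
qed

section \<open>Recurrences for one and two rooted faces\<close>

lemma uni_fix: "(rt, op, r, us) \<in> uni D x \<Longrightarrow> length (filter (\<lambda>d. rt d = d) us) = x"
  by (simp add: uni_def num_fix_def)

lemma duo_fix:
  assumes "(rt, op, r, us, q, vs) \<in> duo D x y"
  shows "length (filter (\<lambda>d. rt d = d) us) = x \<and> length (filter (\<lambda>d. rt d = d) vs) = y"
  using assms by (simp_all add: duo_def num_fix_def)

lemma sum_affine:
  "(\<Sum>m\<in>S. 3 * a m + c) = 3 * (\<Sum>m\<in>S. a m) + c * card S" for c :: nat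
  by (simp add: sum.distrib sum_distrib_left)

lemma card_SIGMA_const:
  assumes "finite S" "\<And>m. m \<in> S \<Longrightarrow> finite (B m) \<and> card (B m) = c"
  shows "card (SIGMA m : S. B m) = c * card S"
  using assms by (simp add: card_SigmaI)

text \<open>Pairs of a map and a reversed vertex are counted twice: by \<open>uni_rev_darts\<close>
  every map has the same number of them, and cutting turns them into maps with three chosen
  leaves.\<close>

lemma uni_recurrence:
  assumes n: "card D = 2 * n" and fin: "finite D"
  shows "3 * ((x + 3) choose 3) * card (uni D (x + 3)) + (2 * n + 2 * (x + 1)) * card (uni D x)
       = 3 * (n + 1) * card (uni D x)"
proof -
  have "card (SIGMA m : uni D x. case m of (rt, op, r, us) \<Rightarrow> rsplits3 rt us)
      = (\<Sum>(rt, op, r, us)\<in>uni D x. card (rsplits3 rt us))"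
    by (subst card_SigmaI) (auto simp: finite_uni fin finite_rsplits intro!: sum.cong)
  moreover have "card (SIGMA m : uni D (x + 3). case m of (rt, op, r, us) \<Rightarrow> splits3 (\<lambda>d. rt d = d) us)
      = ((x + 3) choose 3) * card (uni D (x + 3))"
    by (rule card_SIGMA_const)
      (auto simp: finite_uni fin finite_splits card_splits3 dest!: uni_fix)
  ultimately have S: "(\<Sum>(rt, op, r, us)\<in>uni D x. card (rsplits3 rt us))
      = ((x + 3) choose 3) * card (uni D (x + 3))"
    using card_uni_glue[of D x] by (simp add: case_prod_beta)
  have "(\<Sum>(rt, op, r, us)\<in>uni D x. 3 * card (rsplits3 rt us) + (2 * n + 2 * (x + 1)))
      = (\<Sum>m\<in>uni D x. 3 * (n + 1))"
  proof (rule sum.cong[OF refl])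
    fix m assume "m \<in> uni D x"
    moreover obtain rt op r us where m: "m = (rt, op, r, us)" by (cases m) auto
    ultimately have mem: "(rt, op, r, us) \<in> uni D x" by simp
    show "(case m of (rt, op, r, us) \<Rightarrow> 3 * card (rsplits3 rt us) + (2 * n + 2 * (x + 1))) = 3 * (n + 1)"
      unfolding m prod.case using uni_rev_darts[OF mem n] uni_rsplits3[OF mem] by linarith
  qed
  moreover have "(\<Sum>(rt, op, r, us)\<in>uni D x. 3 * card (rsplits3 rt us) + (2 * n + 2 * (x + 1)))
      = 3 * (\<Sum>(rt, op, r, us)\<in>uni D x. card (rsplits3 rt us)) + (2 * n + 2 * (x + 1)) * card (uni D x)"
    unfolding case_prod_beta by (rule sum_affine)
  ultimately show ?thesis unfolding S sum_constant by (simp add: algebra_simps)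
qed

lemma sum_duo_swap:
  "(\<Sum>(rt, op, r, us, q, vs)\<in>duo D x y. h rt vs us) = (\<Sum>(rt, op, r, us, q, vs)\<in>duo D y x. h rt us vs)"
proof -
  let ?F = "\<lambda>(rt, op, r, us, q, vs). (rt, op, q, vs, r, us)"
  have "bij_betw ?F (duo D x y) (duo D y x)"
    by (rule bij_betw_byWitness[where f' = ?F]) (auto simp: duo_def)
  then show ?thesis
    using sum.reindex_bij_betw[of ?F "duo D x y" "duo D y x" "\<lambda>(rt, op, r, us, q, vs). h rt us vs"]
    by (simp add: case_prod_beta)
qed

lemma sum_rsplits3:
  assumes fin: "finite D"
  shows "(\<Sum>(rt, op, r, us, q, vs)\<in>duo D x y. card (rsplits3 rt us))
      = ((x + 3) choose 3) * card (duo D (x + 3) y)"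
proof -
  have "card (SIGMA m : duo D x y. case m of (rt, op, r, us, q, vs) \<Rightarrow> rsplits3 rt us)
      = (\<Sum>(rt, op, r, us, q, vs)\<in>duo D x y. card (rsplits3 rt us))"
    by (subst card_SigmaI) (auto simp: finite_duo fin finite_rsplits intro!: sum.cong)
  moreover have "card (SIGMA m : duo D (x + 3) y. case m of (rt, op, r, us, q, vs) \<Rightarrow> splits3 (\<lambda>d. rt d = d) us)
      = ((x + 3) choose 3) * card (duo D (x + 3) y)"
    by (rule card_SIGMA_const)
      (auto simp: finite_duo fin finite_splits card_splits3 dest!: duo_fix)
  ultimately show ?thesis
    using card_duo_glue3[of D x y] by (simp add: case_prod_beta)
qed

lemma card_rsplits21_gaps:
  assumes "num_fix rt us = x"
  shows "card (rsplits21 rt us vs)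
      = (\<Sum>k\<le>x. card {((P, f, Q, s, R), w) \<in> rsplits21 rt us vs. num_fix rt Q = k})"
proof -
  let ?S = "\<lambda>k. {((P, f, Q, s, R), w) \<in> rsplits21 rt us vs. num_fix rt Q = k}"
  have "rsplits21 rt us vs = (\<Union>k\<le>x. ?S k)"
    using assms by (auto simp: rsplits21_def)
  moreover have "card (\<Union>k\<le>x. ?S k) = (\<Sum>k\<le>x. card (?S k))"
  proof (rule card_UN_disjoint)
    have "?S k \<subseteq> rsplits21 rt us vs" for k by auto
    then show "\<forall>k\<in>{..x}. finite (?S k)" using finite_rsplits(2) finite_subset by blast
  qed auto
  ultimately show ?thesis by simp
qed

text \<open>For a fixed gap the leaf s is any of \<open>x + 1 - k\<close> leaves of the first face,
  and f, t are two of the \<open>y + k + 2\<close> leaves of the second with \<open>k\<close> leaves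
  between them, which leaves \<open>y + 1\<close> choices.\<close>

lemma sum_rsplits21:
  assumes fin: "finite D"
  shows "(\<Sum>(rt, op, r, us, q, vs)\<in>duo D x y. card (rsplits21 rt us vs))
      = (\<Sum>k\<le>x. (x + 1 - k) * (y + 1) * card (duo D (x + 1 - k) (y + k + 2)))"
proof -
  let ?S = "\<lambda>k rt us vs. {((P, f, Q, s, R), w) \<in> rsplits21 rt us vs. num_fix rt Q = k}"
  have fS: "finite (?S k rt us vs)" for k us vs and rt :: "nat \<Rightarrow> nat"
    by (rule finite_subset[OF _ finite_rsplits(2)[of rt us vs]]) auto
  have "(\<Sum>(rt, op, r, us, q, vs)\<in>duo D x y. card (rsplits21 rt us vs))
      = (\<Sum>(rt, op, r, us, q, vs)\<in>duo D x y. \<Sum>k\<le>x. card (?S k rt us vs))"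
    by (intro sum.cong refl) (auto simp: duo_def intro!: card_rsplits21_gaps)
  also have "\<dots> = (\<Sum>k\<le>x. \<Sum>(rt, op, r, us, q, vs)\<in>duo D x y. card (?S k rt us vs))"
    unfolding case_prod_beta by (rule sum.swap)
  also have "\<dots> = (\<Sum>k\<le>x. (x + 1 - k) * (y + 1) * card (duo D (x + 1 - k) (y + k + 2)))"
  proof (rule sum.cong[OF refl])
    fix k assume "k \<in> {..x}"
    then have k: "k \<le> x" by simp
    have "(\<Sum>(rt, op, r, us, q, vs)\<in>duo D x y. card (?S k rt us vs))
        = card (SIGMA m : duo D x y. case m of (rt, op, r, us, q, vs) \<Rightarrow> ?S k rt us vs)"
      by (subst card_SigmaI) (auto simp: finite_duo fin fS intro!: sum.cong)
    also have "\<dots> = card (SIGMA m : duo D (x + 1 - k) (y + k + 2). case m of (rt, op, r, us, q, vs) \<Rightarrow>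
       splits1 (\<lambda>d. rt d = d) us \<times> splits2 (\<lambda>d. rt d = d) k vs)"
      by (rule card_duo_glue21[OF k])
    also have "\<dots> = (x + 1 - k) * (y + 1) * card (duo D (x + 1 - k) (y + k + 2))"
      by (rule card_SIGMA_const)
        (auto simp: finite_duo fin finite_splits card_cartesian_product card_splits1 card_splits2
          dest!: duo_fix)
    finally show "(\<Sum>(rt, op, r, us, q, vs)\<in>duo D x y. card (?S k rt us vs))
        = (x + 1 - k) * (y + 1) * card (duo D (x + 1 - k) (y + k + 2))" .
  qed
  finally show ?thesis .
qed

lemma duo_recurrence:
  assumes n: "card D = 2 * n" and fin: "finite D"
  shows "3 * (((x + 3) choose 3) * card (duo D (x + 3) y) + ((y + 3) choose 3) * card (duo D x (y + 3))
      + (\<Sum>k\<le>x. (x + 1 - k) * (y + 1) * card (duo D (x + 1 - k) (y + k + 2)))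
      + (\<Sum>k\<le>y. (y + 1 - k) * (x + 1) * card (duo D (x + k + 2) (y + 1 - k))))
    + (2 * n + 2 * (x + y + 2)) * card (duo D x y) = 3 * (n + 2) * card (duo D x y)"
proof -
  let ?D = "duo D x y"
  have s3: "(\<Sum>(rt, op, r, us, q, vs)\<in>?D. card (rsplits3 rt vs)) = ((y + 3) choose 3) * card (duo D x (y + 3))"
    using sum_duo_swap[of "\<lambda>rt us vs. card (rsplits3 rt us)" D x y] sum_rsplits3[OF fin, of y x]
      card_duo_swap[of D "y + 3" x] by simp
  have "(\<Sum>(rt, op, r, us, q, vs)\<in>?D. card (rsplits12 rt us vs))
      = (\<Sum>k\<le>y. (y + 1 - k) * (x + 1) * card (duo D (y + 1 - k) (x + k + 2)))"
    unfolding rsplits12_swap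
    using sum_duo_swap[of "\<lambda>rt us vs. card (rsplits21 rt us vs)" D x y] sum_rsplits21[OF fin, of y x] by simp
  also have "\<dots> = (\<Sum>k\<le>y. (y + 1 - k) * (x + 1) * card (duo D (x + k + 2) (y + 1 - k)))"
    by (intro sum.cong refl) (metis card_duo_swap)
  finally have s12: "(\<Sum>(rt, op, r, us, q, vs)\<in>?D. card (rsplits12 rt us vs)) = \<dots>" .
  have "(\<Sum>(rt, op, r, us, q, vs)\<in>?D. 3 * (card (rsplits3 rt us) + card (rsplits21 rt us vs)
        + card (rsplits12 rt us vs) + card (rsplits3 rt vs)) + (2 * n + 2 * (x + y + 2)))
      = (\<Sum>m\<in>?D. 3 * (n + 2))"
  proof (rule sum.cong[OF refl])
    fix m assume "m \<in> ?D"
    moreover obtain rt op r us q vs where m: "m = (rt, op, r, us, q, vs)" by (cases m) auto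
    ultimately have mem: "(rt, op, r, us, q, vs) \<in> ?D" by simp
    show "(case m of (rt, op, r, us, q, vs) \<Rightarrow> 3 * (card (rsplits3 rt us) + card (rsplits21 rt us vs)
        + card (rsplits12 rt us vs) + card (rsplits3 rt vs)) + (2 * n + 2 * (x + y + 2))) = 3 * (n + 2)"
      unfolding m prod.case using duo_rev_darts[OF mem n] duo_rsplits[OF mem] by simp
  qed
  moreover have "(\<Sum>(rt, op, r, us, q, vs)\<in>?D. 3 * (card (rsplits3 rt us) + card (rsplits21 rt us vs)
        + card (rsplits12 rt us vs) + card (rsplits3 rt vs)) + (2 * n + 2 * (x + y + 2)))
      = 3 * ((\<Sum>(rt, op, r, us, q, vs)\<in>?D. card (rsplits3 rt us))
        + (\<Sum>(rt, op, r, us, q, vs)\<in>?D. card (rsplits21 rt us vs))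
        + (\<Sum>(rt, op, r, us, q, vs)\<in>?D. card (rsplits12 rt us vs))
        + (\<Sum>(rt, op, r, us, q, vs)\<in>?D. card (rsplits3 rt vs))) + (2 * n + 2 * (x + y + 2)) * card ?D"
    unfolding case_prod_beta sum_affine sum.distrib by (rule refl)
  ultimately show ?thesis
    unfolding sum_rsplits3[OF fin] sum_rsplits21[OF fin] s12 s3 by (simp add: algebra_simps)
qed

section \<open>Adding and removing a leaf\<close>

text \<open>This form suits arguments in which a closed set of darts is shown to be everything;
  \<open>connected_pair_rtrancl\<close> relates it to reachability.\<close>

definition connected_pair :: "nat set \<Rightarrow> (nat \<Rightarrow> nat) \<Rightarrow> (nat \<Rightarrow> nat) \<Rightarrow> bool" where
  "connected_pair D rt op \<longleftrightarrow> (\<forall>S. S \<subseteq> D \<and> S \<noteq> {} \<and> rt ` S \<subseteq> S \<and> op ` S \<subseteq> S \<longrightarrow> S = D)"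

lemma orbit_least: "a \<in> S \<Longrightarrow> (\<And>d. d \<in> S \<Longrightarrow> f d \<in> S) \<Longrightarrow> orbit f a \<subseteq> S"
proof
  fix b assume a: "a \<in> S" and cl: "\<And>d. d \<in> S \<Longrightarrow> f d \<in> S" and "b \<in> orbit f a"
  from this(3) show "b \<in> S" by induction (use a cl in auto)
qed

lemma self_in_orbit: "f permutes D \<Longrightarrow> finite D \<Longrightarrow> a \<in> orbit f a"
  by (intro permutation_self_in_orbit) (auto simp: permutation_permutes)

lemma orbit_eq: "f permutes D \<Longrightarrow> finite D \<Longrightarrow> b \<in> orbit f a \<Longrightarrow> orbit f b = orbit f a"
  by (metis orbit_eqI(1) orbit_swap orbit_trans self_in_orbit subset_antisym subsetI)

lemma orbit_closed: "b \<in> orbit f a \<Longrightarrow> f b \<in> orbit f a"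
  by (rule orbit.step)

text \<open>A leaf \<open>l\<close> is hung with its edge {u, l} on a new vertex (u, p, q) that
  subdivides the edge {e, e'} into {e, q} and {p, e'}. The choice of \<open>e\<close> among the two
  halves decides on which side the leaf lies, so there are as many insertions as darts.\<close>

locale growth =
  fixes D0 :: "nat set" and rt0 op0 :: "nat \<Rightarrow> nat" and u l p q e e' :: nat
  assumes cp0: "cubic_pair D0 rt0 op0" and fin: "finite D0"
    and new: "u \<notin> D0" "l \<notin> D0" "p \<notin> D0" "q \<notin> D0" "distinct [u, l, p, q]"
    and e: "e \<in> D0" and e': "e' = op0 e"
begin

definition "rt = rt0(u := p, p := q, q := u)"
definition "op = op0(u := l, l := u, e := q, q := e, p := e', e' := p)"
abbreviation "D \<equiv> D0 \<union> {u, l, p, q}"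

lemma new': "u \<noteq> l" "u \<noteq> p" "u \<noteq> q" "l \<noteq> p" "l \<noteq> q" "p \<noteq> q"
    "u \<noteq> e" "l \<noteq> e" "p \<noteq> e" "q \<noteq> e" "u \<noteq> e'" "l \<noteq> e'" "p \<noteq> e'" "q \<noteq> e'" "e \<noteq> e'" "e' \<in> D0" "op0 e' = e"
proof -
  show e'D: "e' \<in> D0" "op0 e' = e" "e \<noteq> e'"
    using cubic_pairD(3-5)[OF cp0 e] e' by auto
  then show "u \<noteq> l" "u \<noteq> p" "u \<noteq> q" "l \<noteq> p" "l \<noteq> q" "p \<noteq> q"
    "u \<noteq> e" "l \<noteq> e" "p \<noteq> e" "q \<noteq> e" "u \<noteq> e'" "l \<noteq> e'" "p \<noteq> e'" "q \<noteq> e'"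
    using new e by auto
qed

lemma rt_simps [simp]:
  "rt u = p" "rt p = q" "rt q = u" "rt l = l" "d \<in> D0 \<Longrightarrow> rt d = rt0 d"
proof -
  have "rt0 l = l" using cubic_pairD(1)[OF cp0] new(2) by (simp add: permutes_not_in)
  then show "rt u = p" "rt p = q" "rt q = u" "rt l = l" "d \<in> D0 \<Longrightarrow> rt d = rt0 d"
    using new new' by (auto simp: rt_def)
qed

lemma op_simps [simp]:
  "op u = l" "op l = u" "op e = q" "op q = e" "op p = e'" "op e' = p"
  "d \<in> D0 \<Longrightarrow> d \<noteq> e \<Longrightarrow> d \<noteq> e' \<Longrightarrow> op d = op0 d"
  using new new' by (auto simp: op_def)

lemma rt0_in: "d \<in> D0 \<Longrightarrow> rt0 d \<in> D0" and op0_in: "d \<in> D0 \<Longrightarrow> op0 d \<in> D0"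
  using cubic_pairD[OF cp0] by blast+

lemma op0_other: "d \<in> D0 \<Longrightarrow> d \<noteq> e \<Longrightarrow> d \<noteq> e' \<Longrightarrow> op0 d \<noteq> e \<and> op0 d \<noteq> e'"
  using cubic_pairD(5)[OF cp0] e' new'(17) by metis

lemma dart_cases:
  assumes "d \<in> D"
  obtains "d = u" | "d = l" | "d = p" | "d = q" | "d = e" | "d = e'" | "d \<in> D0" "d \<noteq> e" "d \<noteq> e'"
  using assms by blast

lemma cp: "cubic_pair D rt op"
proof -
  have r3: "rt (rt (rt d)) = d" if "d \<in> D" for d
  proof (cases "d \<in> D0")
    case True
    then show ?thesis using rt0_in cubic_pairD(7)[OF cp0] by simp
  next
    case False
    then show ?thesis using that by auto
  qed
  have o2: "op d \<in> D \<and> op d \<noteq> d \<and> op (op d) = d" if "d \<in> D" for d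
    using that
  proof (cases rule: dart_cases)
    case 7
    then show ?thesis using op0_other op0_in[OF 7(1)] cubic_pairD(4,5)[OF cp0 7(1)] by auto
  qed (use new' e in auto)
  have rD: "rt d \<in> D" if "d \<in> D" for d
    using that rt0_in by auto
  have out: "rt d = d" "op d = d" if "d \<notin> D" for d
  proof -
    have "rt0 d = d" "op0 d = d"
      using that cubic_pairD(1,2)[OF cp0] by (auto simp: permutes_not_in)
    moreover have "d \<noteq> e" "d \<noteq> e'" using that e new' by auto
    ultimately show "rt d = d" "op d = d" using that by (auto simp: rt_def op_def)
  qed
  have "bij_betw rt D D"
    by (rule bij_betw_byWitness[where f' = "\<lambda>d. rt (rt d)"]) (use r3 rD in blast)+
  moreover have "bij_betw op D D"
    by (rule bij_betw_byWitness[where f' = op]) (use o2 in blast)+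
  ultimately have "rt permutes D" "op permutes D"
    using out by (blast intro: bij_imp_permutes)+
  then show ?thesis using r3 o2 unfolding cubic_pair_def by blast
qed

lemma connected_iff: "connected_pair D rt op \<longleftrightarrow> connected_pair D0 rt0 op0"
proof
  assume c: "connected_pair D rt op"
  show "connected_pair D0 rt0 op0"
    unfolding connected_pair_def
  proof (intro allI impI)
    fix S assume S: "S \<subseteq> D0 \<and> S \<noteq> {} \<and> rt0 ` S \<subseteq> S \<and> op0 ` S \<subseteq> S"
    define S' where "S' = S \<union> (if e \<in> S then {u, l, p, q} else {})"
    have ee: "e \<in> S \<longleftrightarrow> e' \<in> S"
    proof -
      have "op0 ` S \<subseteq> S" using S by blast
      then show ?thesis using e' new'(17) by (metis image_subset_iff)
    qed
    have "rt ` S' \<subseteq> S'"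
    proof (rule image_subsetI)
      fix d assume d: "d \<in> S'"
      show "rt d \<in> S'"
      proof (cases "d \<in> S")
        case True
        then have "rt d = rt0 d" "rt0 d \<in> S" using S by auto
        then show ?thesis by (simp add: S'_def)
      next
        case False
        then have "e \<in> S" "d = u \<or> d = l \<or> d = p \<or> d = q"
          using d by (auto simp: S'_def split: if_splits)
        then show ?thesis by (auto simp: S'_def)
      qed
    qed
    moreover have "op ` S' \<subseteq> S'"
    proof (rule image_subsetI)
      fix d assume d: "d \<in> S'"
      then have "d \<in> D" using S by (auto simp: S'_def split: if_splits)
      then show "op d \<in> S'"
      proof (cases rule: dart_cases)
        case 7
        then have "d \<in> S" using d new by (auto simp: S'_def split: if_splits)
        then show ?thesis using 7 S by (auto simp: S'_def)
      next
        case 5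
        then have "e \<in> S" using d e new by (auto simp: S'_def split: if_splits)
        then show ?thesis using 5 by (simp add: S'_def)
      next
        case 6
        then have "e' \<in> S" using d new'(16) new by (auto simp: S'_def split: if_splits)
        then show ?thesis using 6 ee by (simp add: S'_def)
      qed (use d S new ee in \<open>auto simp: S'_def split: if_splits\<close>)
    qed
    moreover have "S' \<subseteq> D" "S' \<noteq> {}" using S by (auto simp: S'_def)
    ultimately have "S' = D" using c unfolding connected_pair_def by blast
    moreover have "S' \<inter> D0 = S" using S new by (auto simp: S'_def split: if_splits)
    ultimately show "S = D0" using new by auto
  qed
next
  assume c: "connected_pair D0 rt0 op0"
  show "connected_pair D rt op"
    unfolding connected_pair_def
  proof (intro allI impI)
    fix S assume S: "S \<subseteq> D \<and> S \<noteq> {} \<and> rt ` S \<subseteq> S \<and> op ` S \<subseteq> S"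
    then have cl: "d \<in> S \<Longrightarrow> rt d \<in> S" "d \<in> S \<Longrightarrow> op d \<in> S" for d by blast+
    have new_S: "e \<in> S \<or> e' \<in> S" if "u \<in> S \<or> l \<in> S \<or> p \<in> S \<or> q \<in> S"
      using that cl(2)[of l] cl(1)[of u] cl(2)[of p] cl(2)[of q] by auto
    have all_S: "u \<in> S \<and> l \<in> S \<and> p \<in> S \<and> q \<in> S \<and> e \<in> S \<and> e' \<in> S" if "e \<in> S \<or> e' \<in> S"
    proof -
      have "p \<in> S \<or> q \<in> S" using that cl(2)[of e] cl(2)[of e'] by auto
      then have "u \<in> S \<and> p \<in> S \<and> q \<in> S" using cl(1)[of u] cl(1)[of p] cl(1)[of q] by auto
      then show ?thesis using cl(2)[of u] cl(2)[of p] cl(2)[of q] by auto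
    qed
    let ?S = "S \<inter> D0"
    have "rt0 ` ?S \<subseteq> ?S" using cl(1) rt0_in by fastforce
    moreover have "op0 ` ?S \<subseteq> ?S"
    proof (rule image_subsetI)
      fix d assume d: "d \<in> ?S"
      show "op0 d \<in> ?S"
      proof (cases "d = e \<or> d = e'")
        case True
        then show ?thesis using d all_S e e' new' by auto
      next
        case False
        then show ?thesis using d cl(2)[of d] op0_in by auto
      qed
    qed
    moreover have "?S \<noteq> {}" using S new_S e new'(16) by blast
    ultimately have "?S = D0" using c unfolding connected_pair_def by blast
    then show "S = D" using S all_S e by blast
  qed
qed

abbreviation "\<gamma>0 \<equiv> rt0 \<circ> op0"
abbreviation "\<gamma> \<equiv> rt \<circ> op"

lemma face_step:
  "\<gamma> e = u" "\<gamma> u = l" "\<gamma> l = p" "\<gamma> p = \<gamma>0 e" "\<gamma> e' = q" "\<gamma> q = \<gamma>0 e'"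
  "d \<in> D0 \<Longrightarrow> d \<noteq> e \<Longrightarrow> d \<noteq> e' \<Longrightarrow> \<gamma> d = \<gamma>0 d"
  using e new'(16,17) op0_in[of d] by (simp_all add: e'[symmetric])

lemma \<gamma>0_perm: "\<gamma>0 permutes D0" and \<gamma>_perm: "\<gamma> permutes D" and finD: "finite D"
  using cubic_pairD(1,2)[OF cp0] cubic_pairD(1,2)[OF cp] fin by (auto intro: permutes_compose)

text \<open>Both halves of the new edge lie in the face of \<open>e\<close>, together with
  \<open>p\<close>; the face of \<open>e'\<close> only gains the half \<open>q\<close>. The two may
  be the same face.\<close>

definition "ext F = F \<union> (if e \<in> F then {u, l, p} else {}) \<union> (if e' \<in> F then {q} else {})"

lemma orbit_grow:
  assumes a: "a \<in> D0"
  shows "orbit \<gamma> a = ext (orbit \<gamma>0 a)"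
proof (rule subset_antisym)
  let ?O = "orbit \<gamma>0 a"
  have sub: "?O \<subseteq> D0" using orbit_least[OF a] \<gamma>0_perm by (metis permutes_in_image)
  show "orbit \<gamma> a \<subseteq> ext ?O"
  proof (rule orbit_least)
    show "a \<in> ext ?O" using self_in_orbit[OF \<gamma>0_perm fin] by (simp add: ext_def)
  next
    fix d assume d: "d \<in> ext ?O"
    then have "d \<in> D" using sub by (auto simp: ext_def split: if_splits)
    then show "\<gamma> d \<in> ext ?O"
    proof (cases rule: dart_cases)
      case 1
      then have "e \<in> ?O" using d sub new new' by (auto simp: ext_def split: if_splits)
      then show ?thesis using 1 by (simp only: face_step) (simp add: ext_def)
    next
      case 2
      then have "e \<in> ?O" using d sub new new' by (auto simp: ext_def split: if_splits)
      then show ?thesis using 2 by (simp only: face_step) (simp add: ext_def)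
    next
      case 3
      then have "e \<in> ?O" using d sub new new' by (auto simp: ext_def split: if_splits)
      then have "\<gamma>0 e \<in> ?O" by (rule orbit_closed)
      then show ?thesis using 3 by (simp only: face_step) (simp add: ext_def)
    next
      case 4
      then have "e' \<in> ?O" using d sub new new' by (auto simp: ext_def split: if_splits)
      then have "\<gamma>0 e' \<in> ?O" by (rule orbit_closed)
      then show ?thesis using 4 by (simp only: face_step) (simp add: ext_def)
    next
      case 5
      then have "e \<in> ?O" using d e new by (auto simp: ext_def split: if_splits)
      then show ?thesis using 5 by (simp only: face_step) (simp add: ext_def)
    next
      case 6
      then have "e' \<in> ?O" using d new'(16) new by (auto simp: ext_def split: if_splits)
      then show ?thesis using 6 by (simp only: face_step) (simp add: ext_def)
    next
      case 7
      then have "d \<in> ?O" using d new by (auto simp: ext_def split: if_splits)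
      then have "\<gamma>0 d \<in> ?O" by (rule orbit_closed)
      then show ?thesis using face_step(7)[OF 7] by (simp only:) (simp add: ext_def)
    qed
  qed
  let ?P = "orbit \<gamma> a"
  have eP: "u \<in> ?P \<and> l \<in> ?P \<and> p \<in> ?P \<and> \<gamma>0 e \<in> ?P" if "e \<in> ?P"
  proof -
    have "u \<in> ?P" using orbit_closed[OF that] unfolding face_step .
    then have l: "l \<in> ?P" using orbit_closed[of u \<gamma> a] unfolding face_step by blast
    then have p: "p \<in> ?P" using orbit_closed[of l \<gamma> a] unfolding face_step by blast
    then have "\<gamma>0 e \<in> ?P" using orbit_closed[of p \<gamma> a] unfolding face_step by blast
    then show ?thesis using \<open>u \<in> ?P\<close> l p by blast
  qed
  have e'P: "q \<in> ?P \<and> \<gamma>0 e' \<in> ?P" if "e' \<in> ?P"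
  proof -
    have "q \<in> ?P" using orbit_closed[OF that] unfolding face_step .
    moreover then have "\<gamma>0 e' \<in> ?P" using orbit_closed[of q \<gamma> a] unfolding face_step by blast
    ultimately show ?thesis by blast
  qed
  have "?O \<subseteq> ?P \<inter> D0"
  proof (rule orbit_least)
    show "a \<in> ?P \<inter> D0" using a self_in_orbit[OF \<gamma>_perm finD] by blast
  next
    fix d assume d: "d \<in> ?P \<inter> D0"
    then have "\<gamma>0 d \<in> D0" using \<gamma>0_perm by (metis IntD2 permutes_in_image)
    moreover have "\<gamma>0 d \<in> ?P"
    proof (cases "d = e \<or> d = e'")
      case True
      then show ?thesis using d eP e'P by blast
    next
      case False
      then show ?thesis using face_step(7)[of d] d orbit_closed[of d \<gamma> a] by (metis IntD1 IntD2)
    qed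
    ultimately show "\<gamma>0 d \<in> ?P \<inter> D0" by blast
  qed
  then show "ext ?O \<subseteq> ?P" using eP e'P by (auto simp: ext_def split: if_splits)
qed

lemma orbit_sub: "a \<in> D0 \<Longrightarrow> orbit \<gamma>0 a \<subseteq> D0"
  using orbit_least[of a D0 \<gamma>0] \<gamma>0_perm by (metis permutes_in_image)

text \<open>Every new dart lies in the face of \<open>e\<close> or of \<open>e'\<close>, so no face
  arises, and deleting the new darts recovers the old faces, so none are merged.\<close>

lemma faces_grow: "card (orbit \<gamma> ` D) = card (orbit \<gamma>0 ` D0)"
proof -
  have "orbit \<gamma> e = orbit \<gamma> u" "orbit \<gamma> u = orbit \<gamma> l" "orbit \<gamma> l = orbit \<gamma> p" "orbit \<gamma> e' = orbit \<gamma> q"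
    using orbit_eq[OF \<gamma>_perm finD orbit.base, of e] orbit_eq[OF \<gamma>_perm finD orbit.base, of u]
      orbit_eq[OF \<gamma>_perm finD orbit.base, of l] orbit_eq[OF \<gamma>_perm finD orbit.base, of e']
    unfolding face_step by blast+
  then have "orbit \<gamma> ` D = orbit \<gamma> ` D0"
    using e new'(16) unfolding image_Un image_insert image_empty by blast
  also have "\<dots> = ext ` orbit \<gamma>0 ` D0" using orbit_grow by (auto simp: image_image)
  also have "card \<dots> = card (orbit \<gamma>0 ` D0)"
  proof (rule card_image)
    show "inj_on ext (orbit \<gamma>0 ` D0)"
    proof (rule inj_onI)
      fix F G assume "F \<in> orbit \<gamma>0 ` D0" "G \<in> orbit \<gamma>0 ` D0" and eq: "ext F = ext G"
      then have "F \<subseteq> D0" "G \<subseteq> D0" using orbit_sub by auto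
      then have "ext F \<inter> D0 = F" "ext G \<inter> D0 = G" using new by (auto simp: ext_def split: if_splits)
      then show "F = G" using eq by metis
    qed
  qed
  finally show ?thesis .
qed

end

text \<open>Maps with \<open>k\<close> faces rooted at a leaf, with \<open>x\<close> further leaves in the root face and \<open>y\<close> leaves
  in all other faces.\<close>

definition pmaps :: "nat set \<Rightarrow> nat \<Rightarrow> nat \<Rightarrow> nat \<Rightarrow> ((nat \<Rightarrow> nat) \<times> (nat \<Rightarrow> nat) \<times> nat) set" where
  "pmaps D k x y = {(rt, op, r). cubic_pair D rt op \<and> connected_pair D rt op \<and> r \<in> D \<and> rt r = r \<and>
     card (orbit (rt \<circ> op) ` D) = k \<and> card {d \<in> orbit (rt \<circ> op) r. rt d = d} = Suc x \<and>
     card {d \<in> D - orbit (rt \<circ> op) r. rt d = d} = y}"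

lemma connectedD:
  "connected_pair D rt op \<Longrightarrow> S \<subseteq> D \<Longrightarrow> S \<noteq> {} \<Longrightarrow> rt ` S \<subseteq> S \<Longrightarrow> op ` S \<subseteq> S \<Longrightarrow> S = D"
  by (simp add: connected_pair_def)

lemma cubic_pairI:
  assumes "\<And>d. d \<in> D \<Longrightarrow> rt d \<in> D \<and> rt (rt (rt d)) = d"
    and "\<And>d. d \<in> D \<Longrightarrow> op d \<in> D \<and> op d \<noteq> d \<and> op (op d) = d"
    and "\<And>d. d \<notin> D \<Longrightarrow> rt d = d" "\<And>d. d \<notin> D \<Longrightarrow> op d = d"
  shows "cubic_pair D rt op"
proof -
  have "bij_betw rt D D"
    by (rule bij_betw_byWitness[where f' = "\<lambda>d. rt (rt d)"]) (use assms(1) in blast)+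
  moreover have "bij_betw op D D"
    by (rule bij_betw_byWitness[where f' = op]) (use assms(2) in blast)+
  ultimately have "rt permutes D" "op permutes D"
    using assms(3,4) by (blast intro: bij_imp_permutes)+
  then show ?thesis using assms(1,2) unfolding cubic_pair_def by blast
qed

section \<open>Leaf counts under growth\<close>

context growth
begin

lemma fix_in: "{d \<in> orbit \<gamma> a. rt d = d} = {d \<in> orbit \<gamma>0 a. rt0 d = d} \<union> (if e \<in> orbit \<gamma>0 a then {l} else {})"
  if a: "a \<in> D0"
proof (intro set_eqI)
  fix d
  show "d \<in> {d \<in> orbit \<gamma> a. rt d = d} \<longleftrightarrow>
      d \<in> {d \<in> orbit \<gamma>0 a. rt0 d = d} \<union> (if e \<in> orbit \<gamma>0 a then {l} else {})"
  proof (cases "d \<in> D0")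
    case True
    then have "d \<noteq> u \<and> d \<noteq> l \<and> d \<noteq> p \<and> d \<noteq> q" using new by auto
    then show ?thesis unfolding orbit_grow[OF a] ext_def using True by auto
  next
    case False
    then have "d \<notin> orbit \<gamma>0 a" using orbit_sub[OF a] by blast
    then show ?thesis unfolding orbit_grow[OF a] ext_def using new' by auto
  qed
qed

lemma fix_out: "{d \<in> D - orbit \<gamma> a. rt d = d}
    = {d \<in> D0 - orbit \<gamma>0 a. rt0 d = d} \<union> (if e \<in> orbit \<gamma>0 a then {} else {l})"
  if a: "a \<in> D0"
proof (intro set_eqI)
  fix d
  show "d \<in> {d \<in> D - orbit \<gamma> a. rt d = d} \<longleftrightarrow>
      d \<in> {d \<in> D0 - orbit \<gamma>0 a. rt0 d = d} \<union> (if e \<in> orbit \<gamma>0 a then {} else {l})"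
  proof (cases "d \<in> D0")
    case True
    then have "d \<noteq> u \<and> d \<noteq> l \<and> d \<noteq> p \<and> d \<noteq> q" using new by auto
    then show ?thesis unfolding orbit_grow[OF a] ext_def using True by auto
  next
    case False
    then have "d \<notin> orbit \<gamma>0 a" using orbit_sub[OF a] by blast
    then show ?thesis unfolding orbit_grow[OF a] ext_def using new' False by auto
  qed
qed

lemma pmaps_grow:
  assumes r: "r \<in> D0"
  shows "(rt, op, r) \<in> pmaps D k (if e \<in> orbit \<gamma>0 r then Suc x else x) (if e \<in> orbit \<gamma>0 r then y else Suc y)
    \<longleftrightarrow> (rt0, op0, r) \<in> pmaps D0 k x y"
proof -
  have "finite (orbit \<gamma>0 r)" using orbit_sub[OF r] fin finite_subset by blast
  then have c1: "card {d \<in> orbit \<gamma> r. rt d = d}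
      = card {d \<in> orbit \<gamma>0 r. rt0 d = d} + (if e \<in> orbit \<gamma>0 r then 1 else 0)"
    unfolding fix_in[OF r] using orbit_sub[OF r] new(2) by (auto simp: card_insert_if)
  have c2: "card {d \<in> D - orbit \<gamma> r. rt d = d}
      = card {d \<in> D0 - orbit \<gamma>0 r. rt0 d = d} + (if e \<in> orbit \<gamma>0 r then 0 else 1)"
    unfolding fix_out[OF r] using fin new(2) by (auto simp: card_insert_if)
  show ?thesis
    unfolding pmaps_def mem_Collect_eq prod.case c1 c2 faces_grow connected_iff
    using cp cp0 r by (auto split: if_splits)
qed

end

text \<open>A map with a single edge is excluded: removing its other leaf would remove the root as
  well.\<close>

locale pruning =
  fixes D :: "nat set" and rt op :: "nat \<Rightarrow> nat" and r l :: nat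
  assumes cpD: "cubic_pair D rt op" and finD: "finite D" and conn: "connected_pair D rt op"
    and r: "r \<in> D" "rt r = r" and l: "l \<in> D" "rt l = l" "l \<noteq> r" and big: "card D \<noteq> 2"
begin

definition "u = op l"
definition "p = rt u"
definition "q = rt p"
definition "e = op q"
definition "e' = op p"
definition "D0 = D - {u, l, p, q}"
text \<open>Permutations of the smaller set have to fix all other labels, so the removed darts are
  reset to fixed points, while the two outer halves of the subdivided edge are joined again.\<close>

definition "rt0 = rt(u := u, p := p, q := q)"
definition "op0 = op(u := u, l := l, p := p, q := q, e := e', e' := e)"

lemma prune_basic:
  "u \<in> D" "p \<in> D" "q \<in> D" "e \<in> D" "e' \<in> D" "op u = l" "rt q = u" "op e = q" "op e' = p"
  "distinct [u, l, p, q]" "op p \<noteq> q"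
proof -
  note c = cubic_pairD[OF cpD]
  show in_D: "u \<in> D" "p \<in> D" "q \<in> D" "e \<in> D" "e' \<in> D"
    using c(3,6) l by (auto simp: u_def p_def q_def e_def e'_def)
  show eqs: "op u = l" "rt q = u" "op e = q" "op e' = p"
    using c(5)[OF l(1)] c(7)[OF in_D(1)] c(5)[OF in_D(3)] c(5)[OF in_D(2)]
    by (simp_all add: u_def p_def q_def e_def e'_def)
  have inj: "rt a = rt b \<Longrightarrow> a = b" for a b using c(8) by (metis injD)
  have ul: "u \<noteq> l" using c(4)[OF l(1)] by (simp add: u_def)
  \<comment> \<open>Otherwise the edge of \<open>l\<close> would have leaves at both ends and be the
    whole map.\<close>
  have "p \<noteq> u"
  proof
    assume "p = u"
    then have "rt ` {l, u} \<subseteq> {l, u}" "op ` {l, u} \<subseteq> {l, u}"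
      using l(2) eqs p_def[symmetric] u_def[symmetric] by simp_all
    then have "{l, u} = D" using l(1) in_D(1) by (intro connectedD[OF conn]) simp_all
    then have "card D = 2" using ul by auto
    then show False using big by simp
  qed
  moreover have "p \<noteq> l" using ul inj[of u l] l by (auto simp: p_def)
  moreover have "q \<noteq> p" using calculation(1) inj[of p u] by (auto simp: q_def p_def)
  moreover have "q \<noteq> l" using calculation(2) inj[of p l] l by (auto simp: q_def)
  moreover have "q \<noteq> u" using calculation(1) inj[of q u] eqs by (auto simp: p_def)
  ultimately show dist: "distinct [u, l, p, q]" using ul by auto
  \<comment> \<open>Otherwise the vertex would carry a loop, and the four darts would be the whole
    map; but \<open>l\<close> is the only fixed point among them, so the root could not be
    there.\<close>
  show "op p \<noteq> q"
  proof
    assume pq: "op p = q"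
    then have "op q = p" using c(5)[OF in_D(2)] by simp
    then have "rt ` {l, u, p, q} \<subseteq> {l, u, p, q}" "op ` {l, u, p, q} \<subseteq> {l, u, p, q}"
      using l(2) eqs pq p_def[symmetric] q_def[symmetric] u_def[symmetric] by simp_all
    then have "{l, u, p, q} = D" using l(1) in_D(1-3) by (intro connectedD[OF conn]) simp_all
    then have "r \<in> {l, u, p, q}" using r by simp
    moreover have "rt u \<noteq> u" "rt p \<noteq> p" "rt q \<noteq> q"
      using dist eqs(2) p_def[symmetric] q_def[symmetric] by auto
    ultimately show False using r l by auto
  qed
qed

lemma prune_e: "e \<in> D0" "e' \<in> D0" "e \<noteq> e'"
proof -
  note c = cubic_pairD[OF cpD] and b = prune_basic
  have inj: "op a = op b \<Longrightarrow> a = b" for a b using c(9) by (metis injD)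
  have "op q \<noteq> q" "op p \<noteq> p" using c(4) b by blast+
  moreover have "op q \<noteq> p" using b(11) c(5)[OF b(3)] by auto
  moreover have "op q \<noteq> u" "op p \<noteq> u" using inj[of q l] inj[of p l] b(10) by (auto simp: u_def)
  moreover have "op q \<noteq> l" "op p \<noteq> l" using inj[of q u] inj[of p u] b(6,10) by auto
  moreover have "op p \<noteq> q" by (rule b(11))
  ultimately show "e \<in> D0" "e' \<in> D0" using b(4,5) by (auto simp: D0_def e_def e'_def)
  show "e \<noteq> e'" using inj[of q p] b(10) by (auto simp: e_def e'_def)
qed

lemma prune_cubic: "cubic_pair D0 rt0 op0"
proof -
  note c = cubic_pairD[OF cpD] and b = prune_basic
  have rt_in: "rt d \<in> D0" if "d \<in> D0" for d
  proof -
    have "rt d \<noteq> u" "rt d \<noteq> p" "rt d \<noteq> q" "rt d \<noteq> l"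
      using that c(8) b(7) l(2) unfolding D0_def p_def q_def by (metis DiffD2 injD insertCI)+
    then show ?thesis using that c(6) by (auto simp: D0_def)
  qed
  have rt0_eq: "rt0 d = rt d" if "d \<in> D0" for d
    using that by (auto simp: rt0_def D0_def)
  have op_in: "op d \<in> D0" if "d \<in> D0" "d \<noteq> e" "d \<noteq> e'" for d
  proof -
    have d: "d \<in> D" using that by (simp add: D0_def)
    have "op d \<noteq> u" "op d \<noteq> l" "op d \<noteq> p" "op d \<noteq> q"
      using that c(5)[OF d] b(6) unfolding D0_def u_def e_def e'_def by auto
    then show ?thesis using c(3)[OF d] by (simp add: D0_def)
  qed
  have op_ne: "op d \<noteq> e" "op d \<noteq> e'" if "d \<in> D0" for d
    using that c(5)[of d] b(8,9) by (auto simp: D0_def)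
  have op0_eq: "op0 d = op d" if "d \<in> D0" "d \<noteq> e" "d \<noteq> e'" for d
    using that by (auto simp: op0_def D0_def)
  have op0_e: "op0 e = e'" "op0 e' = e" using prune_e by (auto simp: op0_def)
  show ?thesis
  proof (rule cubic_pairI)
    fix d assume d: "d \<in> D0"
    then show "rt0 d \<in> D0 \<and> rt0 (rt0 (rt0 d)) = d"
      using rt_in rt0_eq c(7)[of d] by (simp add: D0_def)
    show "op0 d \<in> D0 \<and> op0 d \<noteq> d \<and> op0 (op0 d) = d"
    proof (cases "d = e \<or> d = e'")
      case True
      then show ?thesis using op0_e prune_e by auto
    next
      case False
      then show ?thesis
        using d op_in[of d] op_ne[of d] op0_eq c(4,5)[of d] by (simp add: D0_def)
    qed
  next
    fix d assume d: "d \<notin> D0"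
    then have out: "d \<notin> D \<or> d \<in> {u, l, p, q}" by (auto simp: D0_def)
    then show "rt0 d = d" using c(1) l(2) by (auto simp: rt0_def permutes_not_in)
    have ne: "d \<noteq> e" "d \<noteq> e'" using d prune_e by blast+
    have "op d = d" if "d \<notin> {u, l, p, q}" using out that c(2) by (blast intro: permutes_not_in)
    then show "op0 d = d" using ne unfolding op0_def fun_upd_apply by (cases "d \<in> {u, l, p, q}") simp_all
  qed
qed

lemma prune_growth: "growth D0 rt0 op0 u l p q e e'"
proof
  show "cubic_pair D0 rt0 op0" by (rule prune_cubic)
  show "finite D0" using finD by (simp add: D0_def)
  show "u \<notin> D0" "l \<notin> D0" "p \<notin> D0" "q \<notin> D0" by (auto simp: D0_def)
  show "distinct [u, l, p, q]" by (rule prune_basic(10))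
  show "e \<in> D0" by (rule prune_e)
  show "e' = op0 e" using prune_e by (auto simp: op0_def)
qed

sublocale g: growth D0 rt0 op0 u l p q e e'
  by (rule prune_growth)

lemma grow_prune: "g.rt = rt" "g.op = op" "D0 \<union> {u, l, p, q} = D" "r \<in> D0"
proof -
  show "g.rt = rt"
    unfolding g.rt_def unfolding rt0_def using prune_basic(7) by (simp add: fun_eq_iff p_def q_def)
  show "g.op = op"
    unfolding g.op_def unfolding op0_def
  proof (rule ext)
    fix d
    have eqs: "op u = l" "op l = u" "op e = q" "op q = e" "op p = e'" "op e' = p"
      using prune_basic by (simp_all add: u_def e_def e'_def)
    show "(op(u := u, l := l, p := p, q := q, e := e', e' := e, u := l, l := u, e := q, q := e, p := e', e' := p)) d = op d"
      using eqs by simp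
  qed
  show "D0 \<union> {u, l, p, q} = D" using prune_basic l by (auto simp: D0_def)
  have "rt u \<noteq> u" "rt p \<noteq> p" "rt q \<noteq> q"
    using prune_basic(7,10) p_def[symmetric] q_def[symmetric] by auto
  then show "r \<in> D0" using r l by (auto simp: D0_def)
qed

end

section \<open>Double counting of leaf insertions\<close>

definition side :: "bool \<Rightarrow> nat set \<Rightarrow> (nat \<Rightarrow> nat) \<times> (nat \<Rightarrow> nat) \<times> nat \<Rightarrow> nat set" where
  "side b D m = (case m of (rt, op, r) \<Rightarrow>
     if b then orbit (rt \<circ> op) r else D - orbit (rt \<circ> op) r)"

definition side_leaves :: "bool \<Rightarrow> nat set \<Rightarrow> (nat \<Rightarrow> nat) \<times> (nat \<Rightarrow> nat) \<times> nat \<Rightarrow> nat set" where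
  "side_leaves b D m = (case m of (rt, op, r) \<Rightarrow> {l \<in> side b D m. rt l = l \<and> l \<noteq> r})"

text \<open>The labels of the four new darts, in the order u, l, p, q.\<close>

definition quads :: "nat set \<Rightarrow> nat list set" where
  "quads D = {t. length t = 4 \<and> distinct t \<and> set t \<subseteq> D}"

definition prune where
  "prune = (\<lambda>((rt, op, r), l). let u = op l; p = rt u; q = rt p; e = op q; e' = op p in
     ([u, l, p, q], (rt(u := u, p := p, q := q),
        op(u := u, l := l, p := p, q := q, e := e', e' := e), r), e))"

definition grow where
  "grow = (\<lambda>(t, (rt, op, r), e). let u = t ! 0; l = t ! 1; p = t ! 2; q = t ! 3; e' = op e in
     ((rt(u := p, p := q, q := u),
       op(u := l, l := u, e := q, q := e, p := e', e' := p), r), l))"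

lemma orbit_in: "f permutes D \<Longrightarrow> a \<in> D \<Longrightarrow> orbit f a \<subseteq> D"
  by (rule orbit_least) (simp_all add: permutes_in_image)

lemma quadsE:
  assumes "t \<in> quads D"
  obtains u l p q where "t = [u, l, p, q]" "distinct [u, l, p, q]" "{u, l, p, q} \<subseteq> D"
proof -
  have "length t = 4" using assms by (simp add: quads_def)
  then obtain u l p q where "t = [u, l, p, q]"
    by (auto simp: numeral_eq_Suc length_Suc_conv)
  then show ?thesis using that assms by (auto simp: quads_def)
qed

context growth
begin

lemma grow_eq: "grow ([u, l, p, q], (rt0, op0, r), e) = ((rt, op, r), l)"
  by (simp add: grow_def rt_def op_def e'[symmetric] Let_def)

lemma prune_eq: "prune ((rt, op, r), l) = ([u, l, p, q], (rt0, op0, r), e)"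
proof -
  have "rt(u := u, p := p, q := q) = rt0"
  proof (rule ext)
    fix d
    show "(rt(u := u, p := p, q := q)) d = rt0 d"
      using cubic_pairD(1)[OF cp0] new new'
      by (cases "d \<in> {u, p, q}") (auto simp: rt_def permutes_not_in)
  qed
  moreover have "op(u := u, l := l, p := p, q := q, e := e', e' := e) = op0"
  proof (rule ext)
    fix d
    have "op0 u = u" "op0 l = l" "op0 p = p" "op0 q = q"
      using cubic_pairD(2)[OF cp0] new by (simp_all add: permutes_not_in)
    then show "(op(u := u, l := l, p := p, q := q, e := e', e' := e)) d = op0 d"
      unfolding op_def using new' e' by simp
  qed
  ultimately show ?thesis unfolding prune_def by (simp add: Let_def)
qed

lemma side_grow: "r \<in> D0 \<Longrightarrow> l \<in> side b D (rt, op, r) \<longleftrightarrow> e \<in> side b D0 (rt0, op0, r)"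
proof -
  assume r: "r \<in> D0"
  have "l \<in> orbit \<gamma> r \<longleftrightarrow> e \<in> orbit \<gamma>0 r"
    unfolding orbit_grow[OF r] ext_def using orbit_sub[OF r] new new' by auto
  then show ?thesis using e by (simp add: side_def)
qed

lemma pmaps_grow_side:
  assumes r: "r \<in> D0" and s: "e \<in> side b D0 (rt0, op0, r)"
  shows "(rt, op, r) \<in> pmaps D k (if b then Suc x else x) (if b then y else Suc y)
    \<longleftrightarrow> (rt0, op0, r) \<in> pmaps D0 k x y"
proof -
  have "e \<in> orbit \<gamma>0 r \<longleftrightarrow> b" using s by (auto simp: side_def split: if_splits)
  then show ?thesis using pmaps_grow[OF r, of k x y] by simp
qed

end

lemma finite_pmaps: "finite D \<Longrightarrow> finite (pmaps D k x y)"
proof -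
  assume D: "finite D"
  have "pmaps D k x y \<subseteq> {p. p permutes D} \<times> {p. p permutes D} \<times> D"
    by (auto simp: pmaps_def cubic_pair_def)
  then show ?thesis by (rule finite_subset) (intro finite_cartesian_product finite_permutations D)
qed

lemma finite_side: "finite D \<Longrightarrow> m \<in> pmaps D k x y \<Longrightarrow> finite (side b D m)"
proof -
  assume D: "finite D" and "m \<in> pmaps D k x y"
  then obtain rt op r where m: "m = (rt, op, r)" "cubic_pair D rt op" "r \<in> D" by (auto simp: pmaps_def)
  then have "orbit (rt \<circ> op) r \<subseteq> D"
    by (intro orbit_in) (auto simp: cubic_pair_def intro: permutes_compose)
  then show ?thesis using D finite_subset by (auto simp: m side_def)
qed

text \<open>A removed leaf is remembered by its four labels and by the dart at which it has to be
  inserted again; that dart lies in the root face exactly if the leaf does. The labels of the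
  smaller map are those left over.\<close>

lemma growth_bij:
  fixes b :: bool and x y :: nat
  assumes fin: "finite D" and big: "card D \<noteq> 2"
  defines "X \<equiv> if b then Suc x else x" and "Y \<equiv> if b then y else Suc y"
  shows "bij_betw prune (SIGMA m : pmaps D k X Y. side_leaves b D m)
     (SIGMA t : quads D. SIGMA m : pmaps (D - set t) k x y. side b (D - set t) m)"
    (is "bij_betw _ ?L ?R")
proof (rule bij_betw_byWitness[where f' = grow])
  have L: "prune z \<in> ?R \<and> grow (prune z) = z" if z: "z \<in> ?L" for z
  proof -
    from z obtain rt op r l where zz: "z = ((rt, op, r), l)" and m: "(rt, op, r) \<in> pmaps D k X Y"
      and l: "l \<in> side_leaves b D (rt, op, r)" by auto
    have lD: "l \<in> side b D (rt, op, r)" "rt l = l" "l \<noteq> r" using l by (auto simp: side_leaves_def)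
    have mm: "cubic_pair D rt op" "connected_pair D rt op" "r \<in> D" "rt r = r"
      using m by (auto simp: pmaps_def)
    have "orbit (rt \<circ> op) r \<subseteq> D"
      using mm by (intro orbit_in) (auto simp: cubic_pair_def intro: permutes_compose)
    then have "l \<in> D" using lD by (auto simp: side_def split: if_splits)
    then interpret pr: pruning D rt op r l
      using mm lD fin big by unfold_locales auto
    note gp = pr.grow_prune
    have pe: "prune z = ([pr.u, l, pr.p, pr.q], (pr.rt0, pr.op0, r), pr.e)"
      using pr.g.prune_eq[of r] unfolding gp zz .
    have ge: "grow ([pr.u, l, pr.p, pr.q], (pr.rt0, pr.op0, r), pr.e) = z"
      using pr.g.grow_eq[of r] unfolding gp zz .
    have s: "pr.e \<in> side b pr.D0 (pr.rt0, pr.op0, r)"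
      using pr.g.side_grow[OF gp(4), of b] lD(1) unfolding gp by blast
    have "(pr.rt0, pr.op0, r) \<in> pmaps pr.D0 k x y"
      using pr.g.pmaps_grow_side[OF gp(4) s, of k x y] m unfolding gp X_def Y_def by blast
    moreover have "[pr.u, l, pr.p, pr.q] \<in> quads D"
      using pr.prune_basic(1-3,10) \<open>l \<in> D\<close> by (simp add: quads_def)
    moreover have "pr.D0 = D - set [pr.u, l, pr.p, pr.q]" by (simp add: pr.D0_def)
    ultimately show ?thesis using s unfolding pe ge by simp
  qed
  have R: "grow w \<in> ?L \<and> prune (grow w) = w" if w: "w \<in> ?R" for w
  proof -
    from w obtain t rt0 op0 r e where ww: "w = (t, (rt0, op0, r), e)" and t: "t \<in> quads D"
      and m: "(rt0, op0, r) \<in> pmaps (D - set t) k x y" and s: "e \<in> side b (D - set t) (rt0, op0, r)"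
      by auto
    from t obtain u l p q where tt: "t = [u, l, p, q]" and d: "distinct [u, l, p, q]"
      and sub: "{u, l, p, q} \<subseteq> D" by (rule quadsE)
    let ?D0 = "D - set t"
    have mm: "cubic_pair ?D0 rt0 op0" "r \<in> ?D0" using m by (auto simp: pmaps_def)
    have "orbit (rt0 \<circ> op0) r \<subseteq> ?D0"
      using mm by (intro orbit_in) (auto simp: cubic_pair_def intro: permutes_compose)
    then have eD: "e \<in> ?D0" using s by (auto simp: side_def split: if_splits)
    interpret g: growth ?D0 rt0 op0 u l p q e "op0 e"
      using mm(1) fin d eD by unfold_locales (auto simp: tt)
    have DD: "?D0 \<union> {u, l, p, q} = D" using sub tt by auto
    have ge: "grow w = ((g.rt, g.op, r), l)" using g.grow_eq unfolding ww tt .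
    have "(g.rt, g.op, r) \<in> pmaps D k X Y"
      using g.pmaps_grow_side[OF mm(2) s, of k x y] m unfolding DD X_def Y_def by blast
    moreover have "l \<in> side b D (g.rt, g.op, r)" using g.side_grow[OF mm(2), of b] s unfolding DD by blast
    moreover have "l \<noteq> r" using mm(2) tt by auto
    ultimately show ?thesis using g.prune_eq[of r] unfolding ge by (simp add: side_leaves_def ww tt)
  qed
  show "\<forall>z\<in>?L. grow (prune z) = z" "prune ` ?L \<subseteq> ?R" using L by blast+
  show "\<forall>w\<in>?R. prune (grow w) = w" "grow ` ?R \<subseteq> ?L" using R by blast+
qed

lemma finite_quads: "finite D \<Longrightarrow> finite (quads D)"
  by (rule finite_subset[of _ "{t. set t \<subseteq> D \<and> length t = 4}"])
    (auto simp: quads_def intro: finite_lists_length_eq)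

lemma card_quads:
  assumes "card D = n + 4" "finite D"
  shows "card (quads D) * fact n = fact (n + 4)"
proof -
  have "card (quads D) = \<Prod>{n + 1..n + 4}"
    using card_lists_distinct_length_eq[of D 4] assms by (simp add: quads_def)
  also have "{n + 1..n + 4} = {n + 1, n + 2, n + 3, n + 4}" by auto
  finally show ?thesis by (simp add: numeral_eq_Suc algebra_simps)
qed

lemma card_side_leaves:
  assumes m: "m \<in> pmaps D k x y" and fin: "finite D"
  shows "card (side_leaves True D m) = x" "card (side_leaves False D m) = y"
proof -
  obtain rt op r where mm: "m = (rt, op, r)" and r: "r \<in> D" "rt r = r" and cp: "cubic_pair D rt op"
    and c: "card {d \<in> orbit (rt \<circ> op) r. rt d = d} = Suc x" "card {d \<in> D - orbit (rt \<circ> op) r. rt d = d} = y"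
    using m by (auto simp: pmaps_def)
  have "r \<in> orbit (rt \<circ> op) r"
    using cp fin by (intro self_in_orbit) (auto simp: cubic_pair_def intro: permutes_compose)
  then have "side_leaves True D m = {d \<in> orbit (rt \<circ> op) r. rt d = d} - {r}"
    "side_leaves False D m = {d \<in> D - orbit (rt \<circ> op) r. rt d = d}"
    "r \<in> {d \<in> orbit (rt \<circ> op) r. rt d = d}"
    using r by (auto simp: side_leaves_def side_def mm)
  then show "card (side_leaves True D m) = x" "card (side_leaves False D m) = y"
    using c by (simp_all only: card_Diff_singleton)
qed

lemma growth_count:
  assumes fin: "finite D" and big: "card D \<noteq> 2"
  shows "Suc x * card (pmaps D k (Suc x) y)
      = (\<Sum>t\<in>quads D. \<Sum>m\<in>pmaps (D - set t) k x y. card (side True (D - set t) m))"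
    and "Suc y * card (pmaps D k x (Suc y))
      = (\<Sum>t\<in>quads D. \<Sum>m\<in>pmaps (D - set t) k x y. card (side False (D - set t) m))"
proof -
  have R: "card (SIGMA t : quads D. SIGMA m : pmaps (D - set t) k x y. side b (D - set t) m)
      = (\<Sum>t\<in>quads D. \<Sum>m\<in>pmaps (D - set t) k x y. card (side b (D - set t) m))" for b
  proof -
    have f: "finite (SIGMA m : pmaps (D - set t) k x y. side b (D - set t) m)" for t
      using fin by (intro finite_SigmaI finite_pmaps finite_side) auto
    have "card (SIGMA m : pmaps (D - set t) k x y. side b (D - set t) m)
        = (\<Sum>m\<in>pmaps (D - set t) k x y. card (side b (D - set t) m))" for t
      using fin by (intro card_SigmaI finite_pmaps ballI finite_side) auto
    then show ?thesis using f by (subst card_SigmaI) (auto simp: fin finite_quads)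
  qed
  have L: "card (SIGMA m : pmaps D k X Y. side_leaves b D m) = c * card (pmaps D k X Y)"
    if "\<And>m. m \<in> pmaps D k X Y \<Longrightarrow> card (side_leaves b D m) = c" for X Y b c
  proof (rule card_SIGMA_const)
    show "finite (pmaps D k X Y)" by (rule finite_pmaps[OF fin])
  next
    fix m assume m: "m \<in> pmaps D k X Y"
    have "side_leaves b D m \<subseteq> side b D m" by (cases m) (auto simp: side_leaves_def)
    then show "finite (side_leaves b D m) \<and> card (side_leaves b D m) = c"
      using that[OF m] finite_side[OF fin m] finite_subset by blast
  qed
  show "Suc x * card (pmaps D k (Suc x) y)
      = (\<Sum>t\<in>quads D. \<Sum>m\<in>pmaps (D - set t) k x y. card (side True (D - set t) m))"
    using bij_betw_same_card[OF growth_bij[OF fin big, where b = True and x = x and y = y and k = k]] R[of True]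
      L[of "Suc x" y True "Suc x"] card_side_leaves(1)[OF _ fin] by simp
  show "Suc y * card (pmaps D k x (Suc y))
      = (\<Sum>t\<in>quads D. \<Sum>m\<in>pmaps (D - set t) k x y. card (side False (D - set t) m))"
    using bij_betw_same_card[OF growth_bij[OF fin big, where b = False and x = x and y = y and k = k]] R[of False]
      L[of x "Suc y" False "Suc y"] card_side_leaves(2)[OF _ fin] by simp
qed

section \<open>Independence of the set of labels\<close>

definition conjp :: "(nat \<Rightarrow> nat) \<Rightarrow> (nat \<Rightarrow> nat) \<Rightarrow> nat \<Rightarrow> nat" where
  "conjp \<pi> f = \<pi> \<circ> f \<circ> inv \<pi>"

lemma conjp_apply: "bij \<pi> \<Longrightarrow> conjp \<pi> f (\<pi> a) = \<pi> (f a)"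
  by (simp add: conjp_def bij_is_inj inv_f_f)

lemma conjp_comp: "bij \<pi> \<Longrightarrow> conjp \<pi> f \<circ> conjp \<pi> g = conjp \<pi> (f \<circ> g)"
  by (auto simp: conjp_def fun_eq_iff bij_is_inj inv_f_f)

lemma conjp_inv: "bij \<pi> \<Longrightarrow> conjp (inv \<pi>) (conjp \<pi> f) = f"
  by (auto simp: conjp_def fun_eq_iff bij_is_inj inv_f_f inv_inv_eq)

lemma orbit_conjp:
  assumes "bij \<pi>"
  shows "orbit (conjp \<pi> f) (\<pi> a) = \<pi> ` orbit f a"
proof (intro subset_antisym subsetI)
  fix b assume "b \<in> orbit (conjp \<pi> f) (\<pi> a)"
  then show "b \<in> \<pi> ` orbit f a"
    by induction (auto simp: conjp_apply[OF assms] intro: orbit.intros)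
next
  fix b assume "b \<in> \<pi> ` orbit f a"
  then obtain c where c: "c \<in> orbit f a" "b = \<pi> c" by blast
  from c(1) have "\<pi> c \<in> orbit (conjp \<pi> f) (\<pi> a)"
  proof induction
    case base
    show ?case using orbit.base[of "conjp \<pi> f" "\<pi> a"] by (simp add: conjp_apply[OF assms])
  next
    case (step y)
    then show ?case using orbit.step[OF step.IH] by (simp add: conjp_apply[OF assms])
  qed
  then show "b \<in> orbit (conjp \<pi> f) (\<pi> a)" using c by simp
qed

lemma cubic_pair_conjp:
  assumes \<pi>: "bij \<pi>" and cp: "cubic_pair D rt op"
  shows "cubic_pair (\<pi> ` D) (conjp \<pi> rt) (conjp \<pi> op)"
proof (rule cubic_pairI)
  note c = cubic_pairD[OF cp]
  have inj: "\<pi> a = \<pi> b \<longleftrightarrow> a = b" for a b using \<pi> by (simp add: bij_is_inj inj_eq)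
  fix d
  { assume "d \<in> \<pi> ` D"
    then obtain a where a: "a \<in> D" "d = \<pi> a" by blast
    then show "conjp \<pi> rt d \<in> \<pi> ` D \<and> conjp \<pi> rt (conjp \<pi> rt (conjp \<pi> rt d)) = d"
      "conjp \<pi> op d \<in> \<pi> ` D \<and> conjp \<pi> op d \<noteq> d \<and> conjp \<pi> op (conjp \<pi> op d) = d"
      using c(3-7)[of a] by (simp_all add: conjp_apply[OF \<pi>] inj) }
  assume "d \<notin> \<pi> ` D"
  moreover obtain a where a: "d = \<pi> a" using \<pi> by (metis bij_pointE)
  ultimately have "a \<notin> D" by blast
  then show "conjp \<pi> rt d = d" "conjp \<pi> op d = d"
    using c(1,2) by (simp_all add: a conjp_apply[OF \<pi>] permutes_not_in)
qed

lemma connected_pair_conjp: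
  assumes \<pi>: "bij \<pi>" and c: "connected_pair D rt op"
  shows "connected_pair (\<pi> ` D) (conjp \<pi> rt) (conjp \<pi> op)"
  unfolding connected_pair_def
proof (intro allI impI, elim conjE)
  fix S assume S: "S \<subseteq> \<pi> ` D" "S \<noteq> {}" "conjp \<pi> rt ` S \<subseteq> S" "conjp \<pi> op ` S \<subseteq> S"
  let ?S = "\<pi> -` S"
  have "?S \<subseteq> D" using S(1) \<pi> by (auto dest: bij_is_inj injD)
  moreover have "?S \<noteq> {}" using S(2) \<pi> by (metis bij_is_surj ex_in_conv surjD vimageI2)
  moreover have "rt ` ?S \<subseteq> ?S" "op ` ?S \<subseteq> ?S"
    using S(3,4) by (auto simp: image_subset_iff conjp_apply[OF \<pi>, symmetric])
  ultimately have "?S = D" by (rule connectedD[OF c])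
  then show "S = \<pi> ` D" using \<pi> by (metis bij_is_surj surj_image_vimage_eq)
qed

lemma pmaps_conjp:
  assumes \<pi>: "bij \<pi>" and m: "(rt, op, r) \<in> pmaps D k x y"
  shows "(conjp \<pi> rt, conjp \<pi> op, \<pi> r) \<in> pmaps (\<pi> ` D) k x y"
proof -
  have inj: "inj \<pi>" "inj_on \<pi> A" for A
    using bij_is_inj[OF \<pi>] inj_on_subset by blast+
  have orb: "orbit (conjp \<pi> rt \<circ> conjp \<pi> op) (\<pi> a) = \<pi> ` orbit (rt \<circ> op) a" for a
    unfolding conjp_comp[OF \<pi>] by (rule orbit_conjp[OF \<pi>])
  have "orbit (conjp \<pi> rt \<circ> conjp \<pi> op) ` \<pi> ` D = (\<lambda>F. \<pi> ` F) ` orbit (rt \<circ> op) ` D"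
    by (auto simp: image_image orb)
  moreover have "inj_on (\<lambda>F. \<pi> ` F) X" for X
    by (rule inj_onI) (simp add: inj_image_eq_iff[OF inj(1)])
  ultimately have k: "card (orbit (conjp \<pi> rt \<circ> conjp \<pi> op) ` \<pi> ` D) = card (orbit (rt \<circ> op) ` D)"
    by (simp add: card_image)
  have fx: "{d \<in> \<pi> ` A. conjp \<pi> rt d = d} = \<pi> ` {d \<in> A. rt d = d}" for A
    by (auto simp: conjp_apply[OF \<pi>] inj_eq[OF inj(1)])
  have "{d \<in> \<pi> ` D - \<pi> ` orbit (rt \<circ> op) r. conjp \<pi> rt d = d}
      = \<pi> ` {d \<in> D - orbit (rt \<circ> op) r. rt d = d}"
    unfolding image_set_diff[OF inj(1), symmetric] by (rule fx)
  then show ?thesis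
    using m cubic_pair_conjp[OF \<pi>] connected_pair_conjp[OF \<pi>] k
    by (simp add: pmaps_def orb fx card_image[OF inj(2)] conjp_apply[OF \<pi>])
qed

lemma card_pmaps_image:
  assumes \<pi>: "bij \<pi>"
  shows "card (pmaps (\<pi> ` D) k x y) = card (pmaps D k x y)"
proof -
  let ?f = "\<lambda>\<pi> (rt, op, r). (conjp \<pi> rt, conjp \<pi> op, \<pi> r)"
  have i: "bij (inv \<pi>)" "inv (inv \<pi>) = \<pi>" "inv \<pi> ` \<pi> ` D = D"
    using \<pi> by (simp_all add: bij_imp_bij_inv inv_inv_eq bij_is_inj)
  have "bij_betw (?f \<pi>) (pmaps D k x y) (pmaps (\<pi> ` D) k x y)"
  proof (rule bij_betw_byWitness[where f' = "?f (inv \<pi>)"])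
    show "\<forall>m\<in>pmaps D k x y. ?f (inv \<pi>) (?f \<pi> m) = m"
      using \<pi> by (auto simp: conjp_inv bij_is_inj)
    show "\<forall>m\<in>pmaps (\<pi> ` D) k x y. ?f \<pi> (?f (inv \<pi>) m) = m"
      using conjp_inv[OF i(1)] \<pi> unfolding i(2) by (auto simp: bij_is_surj surj_f_inv_f)
    show "?f \<pi> ` pmaps D k x y \<subseteq> pmaps (\<pi> ` D) k x y"
      using pmaps_conjp[OF \<pi>] by fastforce
    show "?f (inv \<pi>) ` pmaps (\<pi> ` D) k x y \<subseteq> pmaps D k x y"
      using pmaps_conjp[OF i(1), of _ _ _ "\<pi> ` D"] unfolding i(3) by fastforce
  qed
  then show ?thesis by (metis bij_betw_same_card)
qed

lemma ex_bij_image: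
  fixes D D' :: "nat set"
  assumes "finite D" "finite D'" "card D = card D'"
  obtains \<pi> :: "nat \<Rightarrow> nat" where "bij \<pi>" "\<pi> ` D = D'"
proof -
  let ?E = "D \<union> D'"
  have "card (?E - D) = card (?E - D')"
    using assms by (simp add: card_Diff_subset)
  then obtain h k where h: "bij_betw h D D'" and k: "bij_betw k (?E - D) (?E - D')"
    using assms finite_same_card_bij by (metis finite_Diff finite_UnI)
  \<comment> \<open>Conjugation uses the inverse on all numbers, so the bijection is completed by
    one between the two differences and by the identity elsewhere.\<close>
  define \<pi> where "\<pi> = (\<lambda>d. if d \<in> D then h d else if d \<in> ?E then k d else d)"
  have b1: "bij_betw \<pi> D D'" using h by (rule bij_betw_cong[THEN iffD1, rotated]) (simp add: \<pi>_def)
  have b2: "bij_betw \<pi> (?E - D) (?E - D')"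
    using k by (rule bij_betw_cong[THEN iffD1, rotated]) (auto simp: \<pi>_def)
  have b3: "bij_betw \<pi> (- ?E) (- ?E)"
    by (rule bij_betw_cong[THEN iffD1, OF _ bij_betw_id]) (simp add: \<pi>_def)
  have "bij_betw \<pi> (D \<union> (?E - D)) (D' \<union> (?E - D'))"
    by (rule bij_betw_combine[OF b1 b2]) auto
  then have "bij_betw \<pi> ((D \<union> (?E - D)) \<union> - ?E) ((D' \<union> (?E - D')) \<union> - ?E)"
    by (rule bij_betw_combine[OF _ b3]) auto
  moreover have "(D \<union> (?E - D)) \<union> - ?E = UNIV" "(D' \<union> (?E - D')) \<union> - ?E = UNIV" by auto
  ultimately have "bij \<pi>" by simp
  moreover have "\<pi> ` D = D'" using b1 by (simp add: bij_betw_def)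
  ultimately show ?thesis by (rule that)
qed

lemma card_pmaps_cong:
  assumes "finite D" "finite D'" "card D = card D'"
  shows "card (pmaps D k x y) = card (pmaps D' k x y)"
  using ex_bij_image[OF assms] card_pmaps_image by metis

text \<open>Rooted maps have no automorphisms, so dividing the number of labelled maps by \<open>(2n)!\<close> gives the
  number of isomorphism classes.\<close>

definition N :: "nat \<Rightarrow> nat \<Rightarrow> nat \<Rightarrow> nat \<Rightarrow> real" where
  "N k n x y = real (card (pmaps {..<2 * n} k x y)) / fact (2 * n)"

lemma card_pmaps_N:
  assumes "finite D" "card D = 2 * n"
  shows "real (card (pmaps D k x y)) = fact (2 * n) * N k n x y"
  using card_pmaps_cong[of D "{..<2 * n}" k x y] assms by (simp add: N_def)

section \<open>Leaf insertion for the normalised counts\<close>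

lemma card_sides:
  assumes m: "m \<in> pmaps D k x y" and fin: "finite D"
  shows "card (side True D m) + card (side False D m) = card D"
proof -
  obtain rt op r where mm: "m = (rt, op, r)" and r: "r \<in> D" and cp: "cubic_pair D rt op"
    using m by (auto simp: pmaps_def)
  have "orbit (rt \<circ> op) r \<subseteq> D"
    using cp r by (intro orbit_in) (auto simp: cubic_pair_def intro: permutes_compose)
  then have "card D = card (orbit (rt \<circ> op) r) + card (D - orbit (rt \<circ> op) r)"
    using fin by (metis card_Diff_subset card_mono finite_subset le_add_diff_inverse)
  then show ?thesis by (simp add: side_def mm)
qed

lemma side_nonempty:
  assumes m: "m \<in> pmaps D 2 x y" and fin: "finite D"
  shows "1 \<le> card (side False D m)"
proof -
  obtain rt op r where mm: "m = (rt, op, r)" and r: "r \<in> D" and cp: "cubic_pair D rt op"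
    and k: "card (orbit (rt \<circ> op) ` D) = 2"
    using m by (auto simp: pmaps_def)
  have perm: "(rt \<circ> op) permutes D" using cp by (auto simp: cubic_pair_def intro: permutes_compose)
  have "D - orbit (rt \<circ> op) r \<noteq> {}"
  proof
    assume "D - orbit (rt \<circ> op) r = {}"
    then have "orbit (rt \<circ> op) ` D \<subseteq> {orbit (rt \<circ> op) r}" using orbit_eq[OF perm fin] by blast
    then have "card (orbit (rt \<circ> op) ` D) \<le> 1" using card_mono[of "{orbit (rt \<circ> op) r}"] by fastforce
    then show False using k by simp
  qed
  then show ?thesis using fin by (simp add: side_def mm Suc_le_eq card_gt_0_iff)
qed

lemma card_quads_real: "real (card (quads {..<2 * (n + 2)})) * fact (2 * n) = fact (2 * (n + 2))"
proof -
  have "card (quads {..<2 * (n + 2)}) * fact (2 * n) = fact (2 * n + 4)"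
    by (rule card_quads) auto
  then have "real (card (quads {..<2 * (n + 2)}) * fact (2 * n)) = real (fact (2 * n + 4))"
    by (simp only:)
  moreover have "2 * (n + 2) = 2 * n + 4" by simp
  ultimately show ?thesis by (simp only: of_nat_mult of_nat_fact)
qed

lemma quads_rest:
  assumes "t \<in> quads {..<2 * (n + 2)}"
  shows "card ({..<2 * (n + 2)} - set t) = 2 * n"
  using assms by (subst card_Diff_subset) (auto simp: quads_def distinct_card)

text \<open>The two sides together offer all 2n darts for an insertion. The choice of the four new
  labels contributes exactly the quotient of the factorials, which the normalisation
  absorbs.\<close>

lemma N_growth:
  "real (Suc x) * N k (n + 2) (Suc x) y + real (Suc y) * N k (n + 2) x (Suc y) = 2 * real n * N k n x y"
proof -
  let ?D = "{..<2 * (n + 2)}"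
  have big: "card ?D \<noteq> 2" "finite ?D" by auto
  have "Suc x * card (pmaps ?D k (Suc x) y) + Suc y * card (pmaps ?D k x (Suc y))
      = (\<Sum>t\<in>quads ?D. \<Sum>m\<in>pmaps (?D - set t) k x y.
          card (side True (?D - set t) m) + card (side False (?D - set t) m))"
    unfolding growth_count[OF big(2,1)] by (simp add: sum.distrib)
  also have "\<dots> = (\<Sum>t\<in>quads ?D. \<Sum>m\<in>pmaps (?D - set t) k x y. 2 * n)"
  proof (intro sum.cong refl)
    fix t m assume "t \<in> quads ?D" "m \<in> pmaps (?D - set t) k x y"
    then show "card (side True (?D - set t) m) + card (side False (?D - set t) m) = 2 * n"
      using card_sides[of m "?D - set t" k x y] quads_rest[of t n] by simp
  qed
  finally have "real (Suc x * card (pmaps ?D k (Suc x) y) + Suc y * card (pmaps ?D k x (Suc y)))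
      = (\<Sum>t\<in>quads ?D. real (card (pmaps (?D - set t) k x y)) * (2 * real n))"
    by (simp del: mult_Suc)
  also have "\<dots> = (\<Sum>t\<in>quads ?D. fact (2 * n) * N k n x y * (2 * real n))"
  proof (intro sum.cong refl)
    fix t assume "t \<in> quads ?D"
    then show "real (card (pmaps (?D - set t) k x y)) * (2 * real n) = fact (2 * n) * N k n x y * (2 * real n)"
      using card_pmaps_N[of "?D - set t" n k x y] quads_rest[of t n] by simp
  qed
  also have "\<dots> = (real (card (quads ?D)) * fact (2 * n)) * (2 * real n * N k n x y)"
    by (simp only: sum_constant of_nat_mult) (simp only: mult_ac)
  also have "\<dots> = fact (2 * (n + 2)) * (2 * real n * N k n x y)"
    by (simp only: card_quads_real)
  finally have eq: "real (Suc x * card (pmaps ?D k (Suc x) y) + Suc y * card (pmaps ?D k x (Suc y))) = \<dots>" .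
  have 1: "real (card (pmaps ?D k (Suc x) y)) = fact (2 * (n + 2)) * N k (n + 2) (Suc x) y"
    and 2: "real (card (pmaps ?D k x (Suc y))) = fact (2 * (n + 2)) * N k (n + 2) x (Suc y)"
    by (rule card_pmaps_N; simp)+
  have "fact (2 * (n + 2)) * (real (Suc x) * N k (n + 2) (Suc x) y + real (Suc y) * N k (n + 2) x (Suc y))
      = fact (2 * (n + 2)) * (2 * real n * N k n x y)"
    using eq unfolding of_nat_add[of "Suc x * _"] of_nat_mult 1 2 by (simp only: distrib_left mult_ac)
  then show ?thesis by (simp only: mult_left_cancel[OF fact_nonzero])
qed

text \<open>The leafless second face has at least one dart where a leaf can be inserted, and that
  leaf, being alone in its face, can be recovered.\<close>

lemma N_two_faces_le: "N 2 n x 0 \<le> N 2 (n + 2) x 1"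
proof -
  let ?D = "{..<2 * (n + 2)}"
  have big: "card ?D \<noteq> 2" "finite ?D" by auto
  have "(\<Sum>t\<in>quads ?D. \<Sum>m\<in>pmaps (?D - set t) 2 x 0. 1) \<le> card (pmaps ?D 2 x 1)"
  proof -
    have "(\<Sum>t\<in>quads ?D. \<Sum>m\<in>pmaps (?D - set t) 2 x 0. 1)
        \<le> (\<Sum>t\<in>quads ?D. \<Sum>m\<in>pmaps (?D - set t) 2 x 0. card (side False (?D - set t) m))"
      by (intro sum_mono side_nonempty) auto
    then show ?thesis using growth_count(2)[OF big(2,1), of 0 2 x] by simp
  qed
  then have "(\<Sum>t\<in>quads ?D. card (pmaps (?D - set t) 2 x 0)) \<le> card (pmaps ?D 2 x 1)" by simp
  then have "(\<Sum>t\<in>quads ?D. real (card (pmaps (?D - set t) 2 x 0))) \<le> real (card (pmaps ?D 2 x 1))"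
    by (metis of_nat_mono of_nat_sum)
  moreover have "(\<Sum>t\<in>quads ?D. real (card (pmaps (?D - set t) 2 x 0))) = (\<Sum>t\<in>quads ?D. fact (2 * n) * N 2 n x 0)"
  proof (intro sum.cong refl)
    fix t assume "t \<in> quads ?D"
    then show "real (card (pmaps (?D - set t) 2 x 0)) = fact (2 * n) * N 2 n x 0"
      using card_pmaps_N[of "?D - set t" n 2 x 0] quads_rest[of t n] by simp
  qed
  moreover have "(\<Sum>t\<in>quads ?D. fact (2 * n) * N 2 n x 0) = fact (2 * (n + 2)) * N 2 n x 0"
    unfolding card_quads_real[symmetric] by (simp only: sum_constant mult_ac)
  moreover have "real (card (pmaps ?D 2 x 1)) = fact (2 * (n + 2)) * N 2 (n + 2) x 1"
    by (rule card_pmaps_N; simp)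
  ultimately have "fact (2 * (n + 2)) * N 2 n x 0 \<le> fact (2 * (n + 2)) * N 2 (n + 2) x 1"
    by (simp only:)
  then show ?thesis by (simp only: mult_le_cancel_left_pos fact_gt_zero)
qed

section \<open>Pairs of rooted faces\<close>

lemma path_nth:
  "path p (r # xs) \<Longrightarrow> i < length (r # xs) \<Longrightarrow> (r # xs) ! i = (p ^^ i) r"
proof (induction i)
  case (Suc i)
  then have "p ((r # xs) ! i) = (r # xs) ! Suc i"
    by (auto simp: successively_conv_nth)
  then show ?case using Suc by simp
qed simp

definition flist :: "('a \<Rightarrow> 'a) \<Rightarrow> 'a \<Rightarrow> 'a list" where
  "flist p r = map (\<lambda>i. (p ^^ i) r) [1..<funpow_dist1 p r r]"

lemma face_list_flist:
  assumes "r \<in> orbit p r"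
  shows "face_list p r (flist p r)" "set (r # flist p r) = orbit p r"
proof -
  let ?n = "funpow_dist1 p r r"
  have L: "r # flist p r = map (\<lambda>i. (p ^^ i) r) [0..<?n]"
    unfolding flist_def by (simp add: upt_conv_Cons del: upt_Suc)
  have L1: "r # flist p r @ [r] = map (\<lambda>i. (p ^^ i) r) [0..<Suc ?n]"
    using L funpow_dist1_prop[OF assms] by simp
  show "set (r # flist p r) = orbit p r"
    unfolding L using orbit_conv_funpow_dist1[OF assms] by (simp only: set_map set_upt)
  have "path p (r # flist p r @ [r])"
    unfolding L1 successively_map by (auto simp: successively_conv_nth simp del: upt_Suc)
  moreover have "distinct (r # flist p r)"
    unfolding L distinct_map set_upt using inj_on_funpow_dist1[OF assms] by (simp only: distinct_upt simp_thms)
  ultimately show "face_list p r (flist p r)" by (simp add: face_list_def)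
qed

lemma face_list_set:
  assumes "face_list p r us" "r \<in> orbit p r"
  shows "set (r # us) = orbit p r"
proof (rule subset_antisym)
  show "orbit p r \<subseteq> set (r # us)"
  proof (rule orbit_least)
    fix d assume "d \<in> set (r # us)"
    from face_list_next[OF assms(1) this] show "p d \<in> set (r # us)"
    proof (elim disjE exE conjE)
      fix A B assume "r # us = A @ d # p d # B"
      then have "set (r # us) = set (A @ d # p d # B)" by (simp only:)
      then show ?thesis by simp
    qed simp
  qed simp
  show "set (r # us) \<subseteq> orbit p r"
  proof
    fix d assume "d \<in> set (r # us)"
    then obtain i where "i < length (r # us)" "(r # us) ! i = d" by (meson in_set_conv_nth)
    moreover have "(r # us @ [r]) ! i = (p ^^ i) r"
      using path_nth[of p r "us @ [r]" i] assms(1) calculation(1) by (simp add: face_list_def)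
    ultimately have "d = (p ^^ i) r" by (metis append_Cons nth_append)
    then show "d \<in> orbit p r" using funpow_in_orbit[OF assms(2)] by simp
  qed
qed

lemma face_list_unique:
  assumes "face_list p r us" "r \<in> orbit p r"
  shows "us = flist p r"
proof -
  note f = face_list_flist[OF assms(2)]
  have len: "length (r # us) = length (r # flist p r)"
    using face_list_set[OF assms] f assms(1) distinct_card[of "r # us"] distinct_card[of "r # flist p r"]
    by (simp only: face_list_def)
  have nth: "(r # xs) ! i = (p ^^ i) r" if "face_list p r xs" "i < length (r # xs)" for xs i
  proof -
    have "(r # xs @ [r]) ! i = (p ^^ i) r"
      using path_nth[of p r "xs @ [r]" i] that by (simp add: face_list_def)
    then show ?thesis using that(2) by (metis append_Cons nth_append)
  qed
  have "r # us = r # flist p r"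
    using nth[OF assms(1)] nth[OF f(1)] len by (intro nth_equalityI) auto
  then show ?thesis by simp
qed

lemma cubic_pair_face: "cubic_pair D rt op \<Longrightarrow> (rt \<circ> op) permutes D"
  by (auto simp: cubic_pair_def intro: permutes_compose)

lemma card_fix_orbit:
  assumes "face_list p r us" "set (r # us) = F" "rt r = r"
  shows "card {d \<in> F. rt d = d} = Suc (num_fix rt us)"
proof -
  have "distinct (r # us)" using assms(1) by (simp add: face_list_def)
  from card_fix_set[OF this, of rt] show ?thesis unfolding assms(2) using assms(3) by simp
qed

text \<open>The root determines the word of its face, so carrying the word along does not change the
  count. Connectivity holds because a closed set contains with each dart its whole face.\<close>

lemma uni_pmaps:
  assumes fin: "finite D"
  shows "card (uni D x) = card (pmaps D 1 x 0)"
proof (rule bij_betw_same_card)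
  let ?F = "\<lambda>(rt, op, r, us). (rt, op, r)" and ?G = "\<lambda>(rt, op, r). (rt, op, r, flist (rt \<circ> op) r)"
  have U: "(rt, op, r) \<in> pmaps D 1 x 0 \<and> us = flist (rt \<circ> op) r" if m: "(rt, op, r, us) \<in> uni D x" for rt op r us
  proof -
    let ?g = "rt \<circ> op"
    have cp: "cubic_pair D rt op" and fl: "face_list ?g r us" and D: "set (r # us) = D"
      and r: "rt r = r" and x: "num_fix rt us = x" using m by (auto simp: uni_def)
    note perm = cubic_pair_face[OF cp]
    have self: "a \<in> orbit ?g a" for a by (rule self_in_orbit[OF perm fin])
    have O: "orbit ?g r = D" using face_list_set[OF fl self] D by simp
    have Oa: "orbit ?g a = D" if "a \<in> D" for a using orbit_eq[OF perm fin, of a r] that O by simp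
    have "r \<in> D" using D by auto
    then have "orbit ?g ` D = {D}" using Oa by auto
    moreover have "connected_pair D rt op"
      unfolding connected_pair_def
    proof (intro allI impI, elim conjE)
      fix S assume S: "S \<subseteq> D" "S \<noteq> {}" "rt ` S \<subseteq> S" "op ` S \<subseteq> S"
      then obtain a where a: "a \<in> S" by blast
      have "orbit ?g a \<subseteq> S" by (rule orbit_least[OF a]) (use S in \<open>simp add: image_subset_iff\<close>)
      then show "S = D" using Oa a S by auto
    qed
    moreover have "{d \<in> D. d \<notin> D \<and> rt d = d} = {}" by blast
    then have e0: "card {d \<in> D. d \<notin> D \<and> rt d = d} = 0" by (simp only: card.empty)
    moreover have "card {d \<in> D. rt d = d} = Suc x" using card_fix_orbit[where rt = rt, OF fl D r] x by simp
    ultimately show ?thesis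
      using cp r \<open>r \<in> D\<close> O face_list_unique[OF fl self] e0 by (simp add: pmaps_def)
  qed
  have M: "(rt, op, r, flist (rt \<circ> op) r) \<in> uni D x" if m: "(rt, op, r) \<in> pmaps D 1 x 0" for rt op r
  proof -
    let ?g = "rt \<circ> op"
    have cp: "cubic_pair D rt op" and r: "r \<in> D" "rt r = r" and k: "card (orbit ?g ` D) = 1"
      and x: "card {d \<in> orbit ?g r. rt d = d} = Suc x" using m by (auto simp: pmaps_def)
    note perm = cubic_pair_face[OF cp]
    have self: "a \<in> orbit ?g a" for a by (rule self_in_orbit[OF perm fin])
    obtain F where F: "orbit ?g ` D = {F}" using k by (auto simp: card_1_singleton_iff)
    have "orbit ?g a = F" if "a \<in> D" for a using imageI[OF that, of "orbit ?g"] unfolding F by simp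
    then have "D \<subseteq> orbit ?g r" using self r(1) by blast
    then have O: "orbit ?g r = D" using orbit_in[OF perm r(1)] by auto
    note f = face_list_flist[OF self, of r]
    have "num_fix rt (flist ?g r) = x" using card_fix_orbit[where rt = rt, OF f(1) _ r(2), of "orbit ?g r"] f(2) x by simp
    then show ?thesis using cp f O r by (simp add: uni_def)
  qed
  show "bij_betw ?F (uni D x) (pmaps D 1 x 0)"
    by (rule bij_betw_byWitness[where f' = ?G]) (use U M in auto)
qed

text \<open>A pair of rooted faces is a connected two-face map or a pair of one-face maps.\<close>

definition linked :: "(nat \<Rightarrow> nat) \<times> (nat \<Rightarrow> nat) \<times> nat \<times> nat list \<times> nat \<times> nat list \<Rightarrow> bool" where
  "linked = (\<lambda>(rt, op, r, us, q, vs). \<exists>d\<in>set (r # us). op d \<notin> set (r # us))"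

text \<open>A connected pair is a two-face map rooted in the first face together with the choice of
  \<open>q\<close> among the \<open>y + 1\<close> leaves of the other face.\<close>

lemma duo_linked:
  assumes fin: "finite D"
  shows "card {m \<in> duo D x y. linked m} = Suc y * card (pmaps D 2 x (Suc y))"
proof -
  let ?S = "SIGMA m : pmaps D 2 x (Suc y). side_leaves False D m"
  let ?F = "\<lambda>(rt, op, r, us, q, vs). ((rt, op, r), q)"
  let ?G = "\<lambda>((rt, op, r), q). (rt, op, r, flist (rt \<circ> op) r, q, flist (rt \<circ> op) q)"
  have U: "((rt, op, r), q) \<in> ?S \<and> us = flist (rt \<circ> op) r \<and> vs = flist (rt \<circ> op) q"
    if m: "(rt, op, r, us, q, vs) \<in> duo D x y" "linked (rt, op, r, us, q, vs)" for rt op r us q vs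
  proof -
    let ?g = "rt \<circ> op"
    have cp: "cubic_pair D rt op" and fl: "face_list ?g r us" "face_list ?g q vs"
      and D: "set (r # us) \<union> set (q # vs) = D" and disj: "set (r # us) \<inter> set (q # vs) = {}"
      and r: "rt r = r" "rt q = q" and x: "num_fix rt us = x" "num_fix rt vs = y"
      using m(1) by (auto simp: duo_def)
    note perm = cubic_pair_face[OF cp]
    have self: "a \<in> orbit ?g a" for a by (rule self_in_orbit[OF perm fin])
    have O: "set (r # us) = orbit ?g r" "set (q # vs) = orbit ?g q"
      using face_list_set[OF fl(1) self] face_list_set[OF fl(2) self] by auto
    have rq: "r \<in> D" "q \<in> D" using D by auto
    have D': "D - orbit ?g r = orbit ?g q" "D = orbit ?g r \<union> orbit ?g q" using D disj O by blast+
    have "orbit ?g ` D = {orbit ?g r, orbit ?g q}"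
      using orbit_eq[OF perm fin] rq D'(2) by blast
    moreover have "orbit ?g r \<noteq> orbit ?g q" using disj O self by blast
    ultimately have k: "card (orbit ?g ` D) = 2" by simp
    \<comment> \<open>A closed set is a union of faces, and the edge of \<open>d\<close>, having one
      side in each face, forces it to contain both.\<close>
    have conn: "connected_pair D rt op"
      unfolding connected_pair_def
    proof (intro allI impI, elim conjE)
      fix S assume S: "S \<subseteq> D" "S \<noteq> {}" "rt ` S \<subseteq> S" "op ` S \<subseteq> S"
      have sub: "orbit ?g a \<subseteq> S" if "a \<in> S" for a by (rule orbit_least[OF that]) (use S in \<open>simp add: image_subset_iff\<close>)
      obtain d where d: "d \<in> orbit ?g r" "op d \<notin> orbit ?g r" using m(2) O by (auto simp: linked_def)
      have dD: "d \<in> D" using d D' by blast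
      then have d2: "op d \<in> orbit ?g q" using d(2) D'(2) cubic_pairD(3)[OF cp] by blast
      obtain a where a: "a \<in> S" using S by blast
      have "d \<in> S"
      proof (cases "a \<in> orbit ?g r")
        case True
        then show ?thesis using sub[OF a] orbit_eq[OF perm fin True] d by blast
      next
        case False
        then have "a \<in> orbit ?g q" using a S(1) D' by blast
        then have "op d \<in> S" using sub[OF a] orbit_eq[OF perm fin] d2 by blast
        then have "op (op d) \<in> S" using S(4) by blast
        then show ?thesis using cubic_pairD(5)[OF cp dD] by simp
      qed
      then have "d \<in> S" "op d \<in> S" using S(4) by blast+
      then have "orbit ?g r \<subseteq> S" "orbit ?g q \<subseteq> S"
        using sub orbit_eq[OF perm fin d(1)] orbit_eq[OF perm fin d2] by blast+
      then show "S = D" using S(1) D' by blast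
    qed
    have "card {d \<in> orbit ?g r. rt d = d} = Suc x" "card {d \<in> D - orbit ?g r. rt d = d} = Suc y"
      using card_fix_orbit[where rt = rt, OF fl(1) O(1) r(1)] card_fix_orbit[where rt = rt, OF fl(2) O(2) r(2)] x D'(1) by simp_all
    then have "(rt, op, r) \<in> pmaps D 2 x (Suc y)" using cp conn rq r k by (simp add: pmaps_def)
    moreover have "q \<in> D - orbit ?g r" using D'(1) self by blast
    then have "q \<in> side_leaves False D (rt, op, r)"
      using r self by (auto simp: side_leaves_def side_def)
    ultimately show ?thesis using face_list_unique[OF fl(1) self] face_list_unique[OF fl(2) self] by simp
  qed
  have M: "(rt, op, r, flist (rt \<circ> op) r, q, flist (rt \<circ> op) q) \<in> duo D x y \<and>
      linked (rt, op, r, flist (rt \<circ> op) r, q, flist (rt \<circ> op) q)"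
    if m: "(rt, op, r) \<in> pmaps D 2 x (Suc y)" and q: "q \<in> side_leaves False D (rt, op, r)" for rt op r q
  proof -
    let ?g = "rt \<circ> op"
    have cp: "cubic_pair D rt op" and conn: "connected_pair D rt op" and r: "r \<in> D" "rt r = r"
      and k: "card (orbit ?g ` D) = 2" and x: "card {d \<in> orbit ?g r. rt d = d} = Suc x"
        "card {d \<in> D - orbit ?g r. rt d = d} = Suc y" using m by (auto simp: pmaps_def)
    have q': "q \<in> D" "q \<notin> orbit ?g r" "rt q = q" using q by (auto simp: side_leaves_def side_def)
    note perm = cubic_pair_face[OF cp]
    have self: "a \<in> orbit ?g a" for a by (rule self_in_orbit[OF perm fin])
    have ne: "orbit ?g r \<noteq> orbit ?g q" using q' self by blast
    have sub: "{orbit ?g r, orbit ?g q} \<subseteq> orbit ?g ` D" using r q' by blast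
    have "card {orbit ?g r, orbit ?g q} = card (orbit ?g ` D)" using k ne by simp
    from card_subset_eq[OF finite_imageI[OF fin] sub this]
    have all: "orbit ?g ` D = {orbit ?g r, orbit ?g q}" by (rule sym)
    have disj: "orbit ?g r \<inter> orbit ?g q = {}"
    proof (rule ccontr)
      assume "orbit ?g r \<inter> orbit ?g q \<noteq> {}"
      then obtain c where "c \<in> orbit ?g r" "c \<in> orbit ?g q" by blast
      then have "orbit ?g r = orbit ?g q" using orbit_eq[OF perm fin, of c r] orbit_eq[OF perm fin, of c q] by simp
      then show False using ne by simp
    qed
    have D': "orbit ?g r \<union> orbit ?g q = D"
    proof
      show "orbit ?g r \<union> orbit ?g q \<subseteq> D"
        using orbit_in[OF perm r(1)] orbit_in[OF perm q'(1)] by (rule Un_least)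
      show "D \<subseteq> orbit ?g r \<union> orbit ?g q"
      proof
        fix a assume "a \<in> D"
        then have "orbit ?g a \<in> {orbit ?g r, orbit ?g q}" unfolding all[symmetric] by (rule imageI)
        then show "a \<in> orbit ?g r \<union> orbit ?g q" using self[of a] by (elim insertE) simp_all
      qed
    qed
    note f = face_list_flist[OF self, of r] and f' = face_list_flist[OF self, of q]
    have "num_fix rt (flist ?g r) = x"
      using card_fix_orbit[where rt = rt, OF f(1) f(2) r(2)] x by simp
    moreover have "D - orbit ?g r = orbit ?g q" using D' disj by blast
    then have "num_fix rt (flist ?g q) = y"
      using card_fix_orbit[where rt = rt, OF f'(1) f'(2) q'(3)] x by simp
    ultimately have "(rt, op, r, flist ?g r, q, flist ?g q) \<in> duo D x y"
      unfolding duo_def mem_Collect_eq prod.case f(2) f'(2) using cp f f' disj D' r q' by simp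
    \<comment> \<open>If \<open>op\<close> preserved the first face, so would \<open>rt\<close>,
      which is the face permutation after \<open>op\<close>; this contradicts connectivity.\<close>
    moreover have "\<exists>d\<in>orbit ?g r. op d \<notin> orbit ?g r"
    proof (rule ccontr)
      assume "\<not> ?thesis"
      then have cl: "op d \<in> orbit ?g r" if "d \<in> orbit ?g r" for d using that by blast
      have "rt d \<in> orbit ?g r" if "d \<in> orbit ?g r" for d
      proof -
        have "?g (op d) \<in> orbit ?g r" by (rule orbit_closed[OF cl[OF that]])
        moreover have "op (op d) = d" using that D' cubic_pairD(5)[OF cp] by blast
        ultimately show ?thesis by simp
      qed
      then have "orbit ?g r = D" using cl D' self by (intro connectedD[OF conn]) blast+
      then show False using q' by blast
    qed
    ultimately show ?thesis unfolding linked_def prod.case f(2) by blast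
  qed
  have U': "?F z \<in> ?S \<and> ?G (?F z) = z" if z: "z \<in> {m \<in> duo D x y. linked m}" for z
  proof -
    obtain rt op r us q vs where zz: "z = (rt, op, r, us, q, vs)" by (cases z)
    have "(rt, op, r, us, q, vs) \<in> duo D x y" "linked (rt, op, r, us, q, vs)" using z zz by auto
    from U[OF this] show ?thesis unfolding zz by simp
  qed
  have M': "?G w \<in> {m \<in> duo D x y. linked m} \<and> ?F (?G w) = w" if w: "w \<in> ?S" for w
  proof -
    obtain rt op r q where ww: "w = ((rt, op, r), q)" by (cases w) auto
    have "(rt, op, r) \<in> pmaps D 2 x (Suc y)" "q \<in> side_leaves False D (rt, op, r)" using w ww by auto
    from M[OF this] show ?thesis unfolding ww by simp
  qed
  have "bij_betw ?F {m \<in> duo D x y. linked m} ?S"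
    by (rule bij_betw_byWitness[where f' = ?G]) (use U' M' in blast)+
  then have "card {m \<in> duo D x y. linked m} = card ?S" by (rule bij_betw_same_card)
  also have "\<dots> = Suc y * card (pmaps D 2 x (Suc y))"
  proof (rule card_SIGMA_const)
    fix m assume m: "m \<in> pmaps D 2 x (Suc y)"
    have "side_leaves False D m \<subseteq> side False D m" by (cases m) (auto simp: side_leaves_def)
    then show "finite (side_leaves False D m) \<and> card (side_leaves False D m) = Suc y"
      using card_side_leaves(2)[OF m fin] finite_side[OF fin m] finite_subset by blast
  qed (rule finite_pmaps[OF fin])
  finally show ?thesis .
qed

section \<open>Separating an unlinked pair into two maps\<close>

definition restr :: "'a set \<Rightarrow> ('a \<Rightarrow> 'a) \<Rightarrow> 'a \<Rightarrow> 'a" where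
  "restr S f d = (if d \<in> S then f d else d)"

lemma face_list_cong:
  assumes "\<And>d. d \<in> set (r # us) \<Longrightarrow> p d = p' d"
  shows "face_list p r us \<longleftrightarrow> face_list p' r us"
proof -
  have "path p (a # xs @ [b]) \<longleftrightarrow> path p' (a # xs @ [b])" if "\<And>d. d \<in> set (a # xs) \<Longrightarrow> p d = p' d" for a b xs
    using that by (induction xs arbitrary: a) (simp_all add: successively_Cons)
  then show ?thesis using assms by (simp add: face_list_def)
qed

lemma cubic_pair_restr:
  assumes cp: "cubic_pair D rt op" and S: "S \<subseteq> D" "\<And>d. d \<in> S \<Longrightarrow> rt d \<in> S \<and> op d \<in> S"
  shows "cubic_pair S (restr S rt) (restr S op)"
  by (rule cubic_pairI) (use S cubic_pairD(4,5,7)[OF cp] in \<open>auto simp: restr_def\<close>)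

text \<open>Without a linking edge each face is closed under \<open>op\<close> and therefore under
  \<open>rt\<close>, so the structure falls apart into two one-face maps on complementary sets of
  labels.\<close>

lemma duo_unlinked:
  assumes fin: "finite D"
  shows "card {m \<in> duo D x y. \<not> linked m} = (\<Sum>S\<in>Pow D. card (uni S x) * card (uni (D - S) y))"
proof -
  let ?R = "SIGMA S : Pow D. uni S x \<times> uni (D - S) y"
  let ?L = "{m \<in> duo D x y. \<not> linked m}"
  let ?F = "\<lambda>(rt, op, r, us, q, vs). (set (r # us),
     (restr (set (r # us)) rt, restr (set (r # us)) op, r, us),
     (restr (D - set (r # us)) rt, restr (D - set (r # us)) op, q, vs))"
  let ?G = "\<lambda>(S, (rt1, op1, r, us), (rt2, op2, q, vs)).
     (\<lambda>d. if d \<in> S then rt1 d else rt2 d, \<lambda>d. if d \<in> S then op1 d else op2 d, r, us, q, vs)"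
  have L: "?F m \<in> ?R \<and> ?G (?F m) = m" if m: "m \<in> ?L" for m
  proof -
    obtain rt op r us q vs where mm: "m = (rt, op, r, us, q, vs)" by (cases m)
    have d: "(rt, op, r, us, q, vs) \<in> duo D x y" and nl: "\<not> linked (rt, op, r, us, q, vs)"
      using m mm by auto
    let ?S = "set (r # us)"
    have cp: "cubic_pair D rt op" and fl: "face_list (rt \<circ> op) r us" "face_list (rt \<circ> op) q vs"
      and D: "?S \<union> set (q # vs) = D" and disj: "?S \<inter> set (q # vs) = {}"
      and r: "rt r = r" "rt q = q" and x: "num_fix rt us = x" "num_fix rt vs = y"
      using d by (auto simp: duo_def)
    note c = cubic_pairD[OF cp]
    have S': "D - ?S = set (q # vs)" and SD: "?S \<subseteq> D" using D disj by blast+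
    have self: "a \<in> orbit (rt \<circ> op) a" for a by (rule self_in_orbit[OF cubic_pair_face[OF cp] fin])
    have cl1: "op d \<in> ?S" if "d \<in> ?S" for d using nl that by (auto simp: linked_def)
    have face_cl: "(rt \<circ> op) d \<in> set (r # us)" if "d \<in> set (r # us)" for d
      using that unfolding face_list_set[OF fl(1) self] by (rule orbit_closed)
    have face_cl2: "(rt \<circ> op) d \<in> set (q # vs)" if "d \<in> set (q # vs)" for d
      using that unfolding face_list_set[OF fl(2) self] by (rule orbit_closed)
    have cl2: "op d \<in> D - ?S" if "d \<in> D - ?S" for d
    proof -
      have "op d \<in> D" using that c(3) by blast
      moreover have "op d \<notin> ?S"
      proof
        assume "op d \<in> ?S"
        then have "op (op d) \<in> ?S" by (rule cl1)
        then show False using that c(5) by auto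
      qed
      ultimately show ?thesis by blast
    qed
    have rt1: "rt d \<in> ?S" if d: "d \<in> ?S" for d
    proof -
      have "rt (op (op d)) \<in> ?S" using face_cl[OF cl1[OF d]] by (simp only: comp_apply)
      moreover have "op (op d) = d" using SD d by (intro c(5)) blast
      ultimately show ?thesis by (simp only:)
    qed
    have rt2: "rt d \<in> D - ?S" if d: "d \<in> D - ?S" for d
    proof -
      have "op d \<in> set (q # vs)" using cl2[OF d] unfolding S' .
      then have "rt (op (op d)) \<in> set (q # vs)" using face_cl2 by (simp only: comp_apply)
      moreover have "op (op d) = d" using d by (intro c(5)) blast
      ultimately show ?thesis unfolding S' by (simp only:)
    qed
    have cp1: "cubic_pair ?S (restr ?S rt) (restr ?S op)"
      by (rule cubic_pair_restr[OF cp SD]) (use cl1 rt1 in blast)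
    have cp2: "cubic_pair (D - ?S) (restr (D - ?S) rt) (restr (D - ?S) op)"
      by (rule cubic_pair_restr[OF cp]) (use cl2 rt2 in blast)+
    have "face_list (restr ?S rt \<circ> restr ?S op) r us"
      using fl(1) face_list_cong[of r us "restr ?S rt \<circ> restr ?S op" "rt \<circ> op"] cl1
      by (simp add: restr_def)
    moreover have "num_fix (restr ?S rt) us = x"
      using x(1) num_fix_cong[of us "restr ?S rt" rt] by (simp add: restr_def)
    ultimately have 1: "(restr ?S rt, restr ?S op, r, us) \<in> uni ?S x"
      using cp1 r by (simp add: uni_def restr_def)
    have "face_list (restr (D - ?S) rt \<circ> restr (D - ?S) op) q vs"
      using fl(2) face_list_cong[of q vs "restr (D - ?S) rt \<circ> restr (D - ?S) op" "rt \<circ> op"] cl2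
      unfolding S' by (simp add: restr_def)
    moreover have "num_fix (restr (D - ?S) rt) vs = y"
      using x(2) num_fix_cong[of vs "restr (D - ?S) rt" rt] unfolding S' by (simp add: restr_def)
    ultimately have 2: "(restr (D - ?S) rt, restr (D - ?S) op, q, vs) \<in> uni (D - ?S) y"
      using cp2 r(2) S' unfolding uni_def mem_Collect_eq prod.case by (simp add: restr_def)
    have "(\<lambda>d. if d \<in> ?S then restr ?S f d else restr (D - ?S) f d) = f" if "f permutes D" for f
      using that SD by (auto simp: restr_def permutes_not_in fun_eq_iff)
    from this[OF c(1)] this[OF c(2)] show ?thesis
      using 1 2 SD unfolding mm by (simp del: list.set)
  qed
  have R: "?G w \<in> ?L \<and> ?F (?G w) = w" if w: "w \<in> ?R" for w
  proof -
    obtain S rt1 op1 r us rt2 op2 q vs where ww: "w = (S, (rt1, op1, r, us), (rt2, op2, q, vs))"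
      by (metis surj_pair)
    have SD: "S \<subseteq> D" and u1: "(rt1, op1, r, us) \<in> uni S x" and u2: "(rt2, op2, q, vs) \<in> uni (D - S) y"
      using w ww by auto
    have cp: "cubic_pair S rt1 op1" "cubic_pair (D - S) rt2 op2"
      and fl: "face_list (rt1 \<circ> op1) r us" "face_list (rt2 \<circ> op2) q vs"
      and set: "set (r # us) = S" "set (q # vs) = D - S" and r: "rt1 r = r" "rt2 q = q"
      and x: "num_fix rt1 us = x" "num_fix rt2 vs = y"
      using u1 u2 by (auto simp: uni_def)
    note c1 = cubic_pairD[OF cp(1)] and c2 = cubic_pairD[OF cp(2)]
    let ?rt = "\<lambda>d. if d \<in> S then rt1 d else rt2 d" and ?op = "\<lambda>d. if d \<in> S then op1 d else op2 d"
    have s2: "rt2 d \<notin> S \<and> op2 d \<notin> S" if "d \<in> D - S" for d using that c2(3,6) by blast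
    have out: "rt2 d = d" "op2 d = d" if "d \<notin> D - S" for d using that c2(1,2) by (simp_all add: permutes_not_in)
    have out1: "rt1 d = d" "op1 d = d" if "d \<notin> S" for d using that c1(1,2) by (simp_all add: permutes_not_in)
    have cpD: "cubic_pair D ?rt ?op"
    proof (rule cubic_pairI)
      fix d assume d: "d \<in> D"
      show "?rt d \<in> D \<and> ?rt (?rt (?rt d)) = d"
      proof (cases "d \<in> S")
        case True
        then show ?thesis using c1(6,7) SD by auto
      next
        case False
        then have ds: "d \<in> D - S" using d by blast
        then have "rt2 d \<in> D - S" "rt2 (rt2 d) \<in> D - S" using c2(6) by blast+
        then show ?thesis using False c2(7)[OF ds] by auto
      qed
      show "?op d \<in> D \<and> ?op d \<noteq> d \<and> ?op (?op d) = d"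
      proof (cases "d \<in> S")
        case True
        then show ?thesis using c1(3-5) SD by auto
      next
        case False
        then have ds: "d \<in> D - S" using d by blast
        then have "op2 d \<in> D - S" using c2(3) by blast
        then show ?thesis using False c2(4,5)[OF ds] by auto
      qed
    qed (use out SD in auto)
    have f1: "face_list (?rt \<circ> ?op) r us"
      using fl(1) face_list_cong[of r us "?rt \<circ> ?op" "rt1 \<circ> op1"] c1(3) unfolding set(1) by simp
    have f2: "face_list (?rt \<circ> ?op) q vs"
      using fl(2) face_list_cong[of q vs "?rt \<circ> ?op" "rt2 \<circ> op2"] s2 unfolding set(2) by simp
    have n1: "num_fix ?rt us = x"
    proof -
      have "num_fix ?rt us = num_fix rt1 us" by (rule num_fix_cong) (use set(1) in auto)
      then show ?thesis using x by simp
    qed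
    have n2: "num_fix ?rt vs = y"
    proof -
      have "d \<notin> S" if "d \<in> set vs" for d using that set(2) by auto
      then have "num_fix ?rt vs = num_fix rt2 vs" by (intro num_fix_cong) auto
      then show ?thesis using x by simp
    qed
    have rq: "r \<in> S" "q \<in> D - S" using set by auto
    have "(?rt, ?op, r, us, q, vs) \<in> duo D x y"
      unfolding duo_def mem_Collect_eq prod.case set using cpD f1 f2 n1 n2 r rq SD by auto
    moreover have "\<not> linked (?rt, ?op, r, us, q, vs)"
      unfolding linked_def prod.case set using c1(3) by auto
    moreover have "restr S ?rt = rt1" "restr S ?op = op1"
      "restr (D - S) ?rt = rt2" "restr (D - S) ?op = op2"
      using out out1 by (auto simp: restr_def fun_eq_iff)
    ultimately show ?thesis unfolding ww by (simp add: set del: list.set)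
  qed
  have "bij_betw ?F ?L ?R"
    by (rule bij_betw_byWitness[where f' = ?G]) (use L R in blast)+
  then have "card ?L = card ?R" by (rule bij_betw_same_card)
  also have "\<dots> = (\<Sum>S\<in>Pow D. card (uni S x) * card (uni (D - S) y))"
  proof -
    have "finite (uni S x \<times> uni (D - S) y)" if "S \<in> Pow D" for S
      using that fin finite_subset by (auto intro!: finite_cartesian_product finite_uni)
    then show ?thesis using fin by (subst card_SigmaI) (auto simp: card_cartesian_product)
  qed
  finally show ?thesis .
qed

lemma cubic_pair_even:
  assumes cp: "cubic_pair D rt op" and fin: "finite D"
  shows "even (card D)"
proof -
  note c = cubic_pairD[OF cp]
  let ?A = "{d \<in> D. op d < d}" and ?B = "{d \<in> D. d < op d}"
  have "bij_betw op ?A ?B"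
    by (rule bij_betw_byWitness[where f' = op]) (use c(3,5) in auto)
  then have "card ?A = card ?B" by (rule bij_betw_same_card)
  moreover have "D = ?A \<union> ?B" using c(4) by (auto simp: neq_iff)
  then have "card D = card (?A \<union> ?B)" by (simp only:)
  moreover have "card (?A \<union> ?B) = card ?A + card ?B"
    by (rule card_Un_disjoint) (use fin in auto)
  ultimately show ?thesis by simp
qed

lemma card_uni_odd: "finite D \<Longrightarrow> odd (card D) \<Longrightarrow> card (uni D x) = 0"
proof -
  assume "finite D" "odd (card D)"
  then have "uni D x = {}" using cubic_pair_even by (auto simp: uni_def)
  then show ?thesis by simp
qed

lemma card_uni_N: "finite D \<Longrightarrow> card D = 2 * n \<Longrightarrow> real (card (uni D x)) = fact (2 * n) * N 1 n x 0"
  using uni_pmaps card_pmaps_N by metis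

definition T :: "nat \<Rightarrow> nat \<Rightarrow> nat \<Rightarrow> real" where
  "T n x y = real (card (duo {..<2 * n} x y)) / fact (2 * n)"

text \<open>The number of label sets of size 2i is a binomial coefficient that cancels the
  factorials, as in a product of exponential generating functions. Sets of odd size carry no
  map.\<close>

lemma sum_uni_pairs:
  "real (\<Sum>S\<in>Pow {..<2 * n}. card (uni S x) * card (uni ({..<2 * n} - S) y))
    = fact (2 * n) * (\<Sum>i\<le>n. N 1 i x 0 * N 1 (n - i) y 0)"
proof -
  let ?D = "{..<2 * n}"
  let ?h = "\<lambda>S. real (card (uni S x) * card (uni (?D - S) y))"
  let ?E = "{S \<in> Pow ?D. even (card S)}"
  have fin: "finite S" if "S \<in> Pow ?D" for S using that finite_subset by blast
  have inner: "(\<Sum>S | S \<in> ?E \<and> card S div 2 = i. ?h S) = fact (2 * n) * (N 1 i x 0 * N 1 (n - i) y 0)"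
    if i: "i \<le> n" for i
  proof -
    have eq: "{S \<in> ?E. card S div 2 = i} = {S. S \<subseteq> ?D \<and> card S = 2 * i}" by auto
    have "?h S = (fact (2 * i) * fact (2 * n - 2 * i)) * (N 1 i x 0 * N 1 (n - i) y 0)"
      if "S \<in> {S. S \<subseteq> ?D \<and> card S = 2 * i}" for S
    proof -
      have S: "S \<subseteq> ?D" "card S = 2 * i" "finite S" using that fin by auto
      have "card (?D - S) = 2 * (n - i)" using S i by (simp add: card_Diff_subset)
      then have "real (card (uni (?D - S) y)) = fact (2 * (n - i)) * N 1 (n - i) y 0"
        by (intro card_uni_N) auto
      moreover have "real (card (uni S x)) = fact (2 * i) * N 1 i x 0"
        by (rule card_uni_N[OF S(3,2)])
      moreover have "2 * (n - i) = 2 * n - 2 * i" by simp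
      ultimately show ?thesis by (simp only: of_nat_mult mult_ac)
    qed
    then have "(\<Sum>S | S \<subseteq> ?D \<and> card S = 2 * i. ?h S)
        = (\<Sum>S | S \<subseteq> ?D \<and> card S = 2 * i. (fact (2 * i) * fact (2 * n - 2 * i)) * (N 1 i x 0 * N 1 (n - i) y 0))"
      by (rule sum.cong[OF refl])
    also have "\<dots> = real (2 * n choose (2 * i)) * ((fact (2 * i) * fact (2 * n - 2 * i)) * (N 1 i x 0 * N 1 (n - i) y 0))"
      using n_subsets[of ?D "2 * i"] by (simp only: sum_constant finite_lessThan card_lessThan)
    also have "\<dots> = (fact (2 * i) * fact (2 * n - 2 * i) * real (2 * n choose (2 * i))) * (N 1 i x 0 * N 1 (n - i) y 0)"
      by (simp only: mult_ac)
    also have "fact (2 * i) * fact (2 * n - 2 * i) * real (2 * n choose (2 * i)) = fact (2 * n)"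
    proof -
      have "fact (2 * i) * fact (2 * n - 2 * i) * (2 * n choose (2 * i)) = (fact (2 * n) :: nat)"
        using i by (intro binomial_fact_lemma) simp
      then have "real (fact (2 * i) * fact (2 * n - 2 * i) * (2 * n choose (2 * i))) = real (fact (2 * n))"
        by (simp only:)
      then show ?thesis by (simp only: of_nat_mult of_nat_fact)
    qed
    finally show ?thesis unfolding eq .
  qed
  have "real (\<Sum>S\<in>Pow ?D. card (uni S x) * card (uni (?D - S) y)) = (\<Sum>S\<in>Pow ?D. ?h S)" by (rule of_nat_sum)
  also have "\<dots> = (\<Sum>S\<in>?E. ?h S)"
  proof (rule sum.mono_neutral_right)
    show "\<forall>S\<in>Pow ?D - ?E. ?h S = 0"
    proof
      fix S assume "S \<in> Pow ?D - ?E"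
      then have "card (uni S x) = 0" using card_uni_odd[of S x] fin by blast
      then show "?h S = 0" by simp
    qed
  qed (simp_all, blast?)
  also have "\<dots> = (\<Sum>i\<le>n. \<Sum>S | S \<in> ?E \<and> card S div 2 = i. ?h S)"
  proof (rule sum.group[symmetric])
    have "card S div 2 \<le> n" if "S \<in> ?E" for S
    proof -
      have "card S \<le> card ?D" by (rule card_mono) (use that in simp_all)
      then show ?thesis by simp
    qed
    then show "(\<lambda>S. card S div 2) ` ?E \<subseteq> {..n}" unfolding image_subset_iff atMost_iff by blast
  qed simp_all
  also have "\<dots> = (\<Sum>i\<le>n. fact (2 * n) * (N 1 i x 0 * N 1 (n - i) y 0))"
    by (intro sum.cong refl inner) simp
  finally show ?thesis by (simp only: sum_distrib_left)
qed

lemma T_eq: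
  "T n x y = real (Suc y) * N 2 n x (Suc y) + (\<Sum>i\<le>n. N 1 i x 0 * N 1 (n - i) y 0)"
proof -
  let ?D = "{..<2 * n}"
  have "duo ?D x y = {m \<in> duo ?D x y. linked m} \<union> {m \<in> duo ?D x y. \<not> linked m}" by blast
  moreover have "card ({m \<in> duo ?D x y. linked m} \<union> {m \<in> duo ?D x y. \<not> linked m})
      = card {m \<in> duo ?D x y. linked m} + card {m \<in> duo ?D x y. \<not> linked m}"
    using finite_duo[of ?D x y] by (intro card_Un_disjoint) auto
  ultimately have "card (duo ?D x y) = Suc y * card (pmaps ?D 2 x (Suc y))
      + (\<Sum>S\<in>Pow ?D. card (uni S x) * card (uni (?D - S) y))"
    using duo_linked[of ?D x y] duo_unlinked[of ?D x y] by simp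
  then have "real (card (duo ?D x y)) = real (Suc y) * real (card (pmaps ?D 2 x (Suc y)))
      + fact (2 * n) * (\<Sum>i\<le>n. N 1 i x 0 * N 1 (n - i) y 0)"
    by (simp only: of_nat_add of_nat_mult sum_uni_pairs)
  then show ?thesis by (simp add: T_def N_def field_simps)
qed

lemma T_swap: "T n x y = T n y x"
  by (simp add: T_def card_duo_swap[of _ x y])

text \<open>Both sides count two-face maps with a root leaf in each face. Formally, \<open>T\<close>
  and its disconnected part are symmetric, hence so is the rest.\<close>

lemma N_two_faces_swap: "real (Suc y) * N 2 n x (Suc y) = real (Suc x) * N 2 n y (Suc x)"
proof -
  have "(\<Sum>i\<le>n. N 1 i x 0 * N 1 (n - i) y 0) = (\<Sum>i\<le>n. N 1 i y 0 * N 1 (n - i) x 0)"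
    by (rule sum.reindex_bij_witness[of _ "\<lambda>i. n - i" "\<lambda>i. n - i"]) auto
  then show ?thesis using T_swap[of n x y] by (simp add: T_eq)
qed

lemma N_one_face_rec:
  "3 * real ((x + 3) choose 3) * N 1 n (x + 3) 0 = (real n + 1 - 2 * real x) * N 1 n x 0"
proof -
  let ?D = "{..<2 * n}"
  have "3 * ((x + 3) choose 3) * card (uni ?D (x + 3)) + (2 * n + 2 * (x + 1)) * card (uni ?D x) = 3 * (n + 1) * card (uni ?D x)"
    by (rule uni_recurrence) auto
  then have "real (3 * ((x + 3) choose 3) * card (uni ?D (x + 3)) + (2 * n + 2 * (x + 1)) * card (uni ?D x)) = real (3 * (n + 1) * card (uni ?D x))"
    by (simp only:)
  then have "3 * real ((x + 3) choose 3) * real (card (uni ?D (x + 3))) = (real n + 1 - 2 * real x) * real (card (uni ?D x))"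
    by (simp add: algebra_simps)
  moreover have "real (card (uni ?D z)) = fact (2 * n) * N 1 n z 0" for z
    by (rule card_uni_N) auto
  ultimately have "fact (2 * n) * (3 * real ((x + 3) choose 3) * N 1 n (x + 3) 0) = fact (2 * n) * ((real n + 1 - 2 * real x) * N 1 n x 0)"
    by (simp only: mult_ac)
  then show ?thesis by (simp only: mult_left_cancel[OF fact_nonzero])
qed

lemma T_rec:
  "3 * (real ((x + 3) choose 3) * T n (x + 3) y + real ((y + 3) choose 3) * T n x (y + 3)
     + (\<Sum>k\<le>x. real (x + 1 - k) * real (y + 1) * T n (x + 1 - k) (y + k + 2))
     + (\<Sum>k\<le>y. real (y + 1 - k) * real (x + 1) * T n (x + k + 2) (y + 1 - k)))
   = (real n + 2 - 2 * real x - 2 * real y) * T n x y"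
proof -
  let ?D = "{..<2 * n}" and ?d = "\<lambda>x y. real (card (duo {..<2 * n} x y))"
  have "3 * (((x + 3) choose 3) * card (duo ?D (x + 3) y) + ((y + 3) choose 3) * card (duo ?D x (y + 3))
      + (\<Sum>k\<le>x. (x + 1 - k) * (y + 1) * card (duo ?D (x + 1 - k) (y + k + 2)))
      + (\<Sum>k\<le>y. (y + 1 - k) * (x + 1) * card (duo ?D (x + k + 2) (y + 1 - k))))
      + (2 * n + 2 * (x + y + 2)) * card (duo ?D x y) = 3 * (n + 2) * card (duo ?D x y)"
    by (rule duo_recurrence) auto
  from arg_cong[OF this, of real]
  have "3 * (real ((x + 3) choose 3) * ?d (x + 3) y + real ((y + 3) choose 3) * ?d x (y + 3)
      + (\<Sum>k\<le>x. real (x + 1 - k) * real (y + 1) * ?d (x + 1 - k) (y + k + 2))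
      + (\<Sum>k\<le>y. real (y + 1 - k) * real (x + 1) * ?d (x + k + 2) (y + 1 - k)))
      + (2 * real n + 2 * (real x + real y + 2)) * ?d x y = 3 * (real n + 2) * ?d x y"
    by (simp only: of_nat_add of_nat_mult of_nat_sum of_nat_numeral)
  moreover have "?d x y = fact (2 * n) * T n x y" for x y by (simp add: T_def)
  ultimately have "fact (2 * n) * (3 * (real ((x + 3) choose 3) * T n (x + 3) y + real ((y + 3) choose 3) * T n x (y + 3)
     + (\<Sum>k\<le>x. real (x + 1 - k) * real (y + 1) * T n (x + 1 - k) (y + k + 2))
     + (\<Sum>k\<le>y. real (y + 1 - k) * real (x + 1) * T n (x + k + 2) (y + 1 - k))))
   = fact (2 * n) * ((real n + 2 - 2 * real x - 2 * real y) * T n x y)"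
    by (simp add: sum_distrib_left distrib_left mult_ac) (simp add: algebra_simps)
  then show ?thesis by (simp only: mult_left_cancel[OF fact_nonzero])
qed

section \<open>Bounds on the number of leaves\<close>

lemma N_one_face: "y > 0 \<Longrightarrow> N 1 n x y = 0"
proof -
  assume y: "y > 0"
  have "pmaps {..<2 * n} 1 x y = {}"
  proof (rule equals0I)
    fix m assume m: "m \<in> pmaps {..<2 * n} 1 x y"
    let ?D = "{..<2 * n}"
    obtain rt op r where cp: "cubic_pair ?D rt op" and r: "r \<in> ?D" and k: "card (orbit (rt \<circ> op) ` ?D) = 1"
      and c: "card {d \<in> ?D - orbit (rt \<circ> op) r. rt d = d} = y"
      using m by (auto simp: pmaps_def)
    have self: "a \<in> orbit (rt \<circ> op) a" for a by (rule self_in_orbit[OF cubic_pair_face[OF cp]]) simp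
    obtain F where F: "orbit (rt \<circ> op) ` ?D = {F}" using k by (auto simp: card_1_singleton_iff)
    have "orbit (rt \<circ> op) a = F" if "a \<in> ?D" for a using imageI[OF that, of "orbit (rt \<circ> op)"] unfolding F by simp
    then have "?D - orbit (rt \<circ> op) r = {}" using self r by blast
    then have "{d \<in> ?D - orbit (rt \<circ> op) r. rt d = d} = {}" by blast
    then show False using c y by (simp only: card.empty)
  qed
  then show ?thesis by (simp add: N_def)
qed

text \<open>Listing the darts of the second face up to a dart whose edge leads to the first face makes
  the root the only exceptional dart of the count, as for a single face.\<close>

lemma two_faces_leaves:
  assumes m: "(rt, op, r) \<in> pmaps D 2 x y" and fin: "finite D" and n: "card D = 2 * n"
  shows "2 * (x + y + 1) \<le> n + 3"
proof -
  let ?g = "rt \<circ> op"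
  have cp: "cubic_pair D rt op" and con: "connected_pair D rt op" and r: "r \<in> D" "rt r = r"
    and k: "card (orbit ?g ` D) = 2"
    and x: "card {d \<in> orbit ?g r. rt d = d} = Suc x" "card {d \<in> D - orbit ?g r. rt d = d} = y"
    using m by (auto simp: pmaps_def)
  note c = cubic_pairD[OF cp] and perm = cubic_pair_face[OF cp]
  have self: "a \<in> orbit ?g a" for a by (rule self_in_orbit[OF perm fin])
  have OD: "orbit ?g a \<subseteq> D" if "a \<in> D" for a by (rule orbit_in[OF perm that])
  let ?O = "orbit ?g r"
  have ne: "D - ?O \<noteq> {}"
  proof
    assume "D - ?O = {}"
    then have "card (D - ?O) = 0" by (simp only: card.empty)
    then show False using side_nonempty[OF m fin] by (simp add: side_def)
  qed
  have gcl: "?g d \<in> D - ?O" if "d \<in> D - ?O" for d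
  proof -
    have "?g d \<notin> ?O"
    proof
      assume "?g d \<in> ?O"
      then have "orbit ?g (?g d) = ?O" by (rule orbit_eq[OF perm fin])
      moreover have "orbit ?g (?g d) = orbit ?g d" by (rule orbit_eq[OF perm fin orbit.base])
      ultimately show False using self[of d] that by blast
    qed
    moreover have "?g d \<in> D" using that perm by (metis DiffD1 permutes_in_image)
    ultimately show ?thesis by blast
  qed
  have "\<exists>e. e \<in> D - ?O \<and> op e \<in> ?O"
  proof (rule ccontr)
    assume no: "\<not> ?thesis"
    have oc: "op d \<in> D - ?O" if "d \<in> D - ?O" for d using no c(3) that by blast
    have rc: "rt d \<in> D - ?O" if "d \<in> D - ?O" for d
    proof -
      have "rt (op (op d)) \<in> D - ?O" using gcl[OF oc[OF that]] by (simp only: comp_apply)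
      then show ?thesis using c(5) that by simp
    qed
    have "D - ?O = D"
      by (rule connectedD[OF con _ ne]) (use oc rc in \<open>simp_all add: image_subset_iff\<close>)
    then show False using self r by blast
  qed
  then obtain e where e: "e \<in> D - ?O" "op e \<in> ?O" by blast
  define q where "q = ?g e"
  have qD: "q \<in> D - ?O" unfolding q_def by (rule gcl[OF e(1)])
  have Oq: "orbit ?g q = orbit ?g e" unfolding q_def by (rule orbit_eq[OF perm fin orbit.base])
  have neq: "orbit ?g q \<noteq> ?O" using self[of q] qD by blast
  have sub: "orbit ?g d \<in> {?O, orbit ?g q}" if "d \<in> D" for d
  proof (rule ccontr)
    assume a: "orbit ?g d \<notin> {?O, orbit ?g q}"
    have "{orbit ?g d, ?O, orbit ?g q} \<subseteq> orbit ?g ` D" using that r(1) qD by blast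
    then have "card {orbit ?g d, ?O, orbit ?g q} \<le> 2" using card_mono fin k by (metis finite_imageI)
    then show False using a neq by auto
  qed
  have Deq: "D = ?O \<union> orbit ?g q"
  proof
    show "D \<subseteq> ?O \<union> orbit ?g q" using sub self by blast
    show "?O \<union> orbit ?g q \<subseteq> D" using OD[OF r(1)] OD[of q] qD by blast
  qed
  have disj: "?O \<inter> orbit ?g q = {}" using orbit_eq[OF perm fin] neq by blast
  define us where "us = flist ?g r"
  define vs where "vs = flist ?g q"
  have fl: "face_list ?g r us" "set (r # us) = ?O" "face_list ?g q vs" "set (q # vs) = orbit ?g q"
    unfolding us_def vs_def using face_list_flist[OF self] by simp_all
  let ?zs = "(r # us) @ (q # vs)"
  have dist: "distinct ?zs" using fl disj unfolding face_list_def distinct_append by blast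
  have Dz: "set ?zs = D" unfolding set_append using fl Deq by blast
  have last: "e = last (q # vs)"
  proof -
    have "e \<in> set (q # vs)" unfolding fl Oq by (rule self)
    from face_list_next[OF fl(3) this] show ?thesis
    proof (elim disjE exE conjE)
      fix A B assume a: "q # vs = A @ e # ?g e # B"
      have "distinct (q # vs)" using fl(3) by (simp add: face_list_def)
      then show ?thesis using a by (cases A) (auto simp: q_def)
    qed
  qed
  have inj: "rt a = rt b \<longleftrightarrow> a = b" for a b using c(8) by (metis injD)
  have rO: "r \<in> ?O" by (rule self)
  have "3 * card (rev_darts rt ?zs) + 2 * n + 2 * num_fix rt ?zs = 3 * (n + card {r})"
  proof (rule rev_darts_card[OF cp dist Dz n])
    show "{r} \<subseteq> D" using r by simp
  next
    fix d assume d: "d \<in> D - {r}"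
    have oo: "op (op d) = d" using d c(5) by auto
    have od: "op d \<in> set (r # us) \<or> op d \<in> set (q # vs)" using d c(3) Deq unfolding fl by blast
    have g: "?g (op d) = rt d" using oo by simp
    have rd: "rt d \<noteq> r" using d r inj[of d r] by auto
    show "idx ?zs (rt d) \<le> idx ?zs d \<longleftrightarrow> idx ?zs (op d) < idx ?zs d"
    proof (cases "op d = e")
      case True
      \<comment> \<open>Here \<open>rt d\<close> is \<open>q\<close>, which does not follow
        \<open>e\<close> in the word. But \<open>d\<close> lies in the first word while
        \<open>q\<close> and \<open>e\<close> lie in the second, so both comparisons fail.\<close>
      then have dO: "d \<in> set (r # us)" using e(2) oo unfolding fl by simp
      have "idx ?zs d < length (r # us)" using idx_append1[OF dO] idx_less[OF dO] by metis
      moreover have nq: "z \<notin> set (r # us)" if "z \<in> set (q # vs)" for z using that disj unfolding fl by blast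
      have "rt d = q" using True oo by (simp add: q_def)
      then have "idx ?zs (rt d) = length (r # us) + idx (q # vs) q" using idx_append[OF nq] by simp
      moreover have "e \<in> set (q # vs)" using last by simp
      then have "idx ?zs e = length (r # us) + idx (q # vs) e" using idx_append[OF nq] by blast
      ultimately show ?thesis unfolding True by linarith
    next
      case False
      have "(\<exists>A B. r # us = A @ op d # rt d # B) \<or> (\<exists>A B. q # vs = A @ op d # rt d # B)"
        using od face_list_next[OF fl(1), of "op d"] face_list_next[OF fl(3), of "op d"] rd False last
        unfolding g by blast
      then have "\<exists>A B. ?zs = A @ op d # rt d # B"
      proof (elim disjE exE)
        fix A B assume "r # us = A @ op d # rt d # B"
        then have "?zs = A @ op d # rt d # (B @ q # vs)" by (metis append.assoc append_Cons)
        then show ?thesis by blast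
      next
        fix A B assume "q # vs = A @ op d # rt d # B"
        then have "?zs = ((r # us) @ A) @ op d # rt d # B" by simp
        then show ?thesis by blast
      qed
      then show ?thesis using next_idx_iff[OF cp dist Dz] d by blast
    qed
  next
    fix d assume "d \<in> {r}"
    then show "idx ?zs (rt d) \<le> idx ?zs d \<and> idx ?zs d \<le> idx ?zs (op d)"
      using r by simp
  qed
  moreover have "num_fix rt ?zs = Suc x + y"
  proof -
    have d2: "distinct (r # us)" "distinct (q # vs)" using fl by (simp_all add: face_list_def)
    have "D - ?O = orbit ?g q" using Deq disj by blast
    then show ?thesis using x card_fix_set[OF d2(1), of rt] card_fix_set[OF d2(2), of rt]
      unfolding fl num_fix_simps(3) by simp
  qed
  ultimately show ?thesis by simp
qed

text \<open>This only uses that the number of reversed vertices, 2g + 1 for this choice of words, is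
  not negative. The bound is weaker than the one from the genus, but it suffices to start inductions
  that go down from many leaves.\<close>

lemma N_two_faces_zero: "2 * (x + y + 1) > n + 3 \<Longrightarrow> N 2 n x y = 0"
proof -
  assume a: "2 * (x + y + 1) > n + 3"
  have "pmaps {..<2 * n} 2 x y = {}"
  proof (rule equals0I)
    fix m assume "m \<in> pmaps {..<2 * n} 2 x y"
    moreover obtain rt op r where "m = (rt, op, r)" by (cases m)
    ultimately show False using two_faces_leaves[of rt op r "{..<2 * n}" x y n] a by simp
  qed
  then show ?thesis by (simp add: N_def)
qed

lemma N_nonneg: "N k n x y \<ge> 0"
  by (simp add: N_def)

text \<open>The recurrence equates a nonnegative number with a negative multiple of
  \<open>N 1 n x 0\<close>.\<close>

lemma N_one_face_zero: "2 * x > n + 1 \<Longrightarrow> N 1 n x 0 = 0"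
proof -
  assume "2 * x > n + 1"
  then have a: "real n + 1 - 2 * real x < 0" by linarith
  have "0 \<le> (real n + 1 - 2 * real x) * N 1 n x 0"
    unfolding N_one_face_rec[symmetric] using N_nonneg by simp
  then show ?thesis using a N_nonneg[of 1 n x 0] by (metis linorder_not_less mult_neg_pos order_le_less)
qed

section \<open>Consequences of the recurrences\<close>

text \<open>One-face maps with a marked leaf besides the root and \<open>x\<close> further leaves; two-face maps with a
  root leaf in each face and, roots included, \<open>x\<close> and \<open>y\<close> leaves in the faces.\<close>

definition B :: "nat \<Rightarrow> nat \<Rightarrow> real" where
  "B i x = real (Suc x) * N 1 i (Suc x) 0"

definition F :: "nat \<Rightarrow> nat \<Rightarrow> nat \<Rightarrow> real" where
  "F n x y = (case x of 0 \<Rightarrow> 0 | Suc z \<Rightarrow> real y * N 2 n z y)"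

lemma F_simps [simp]: "F n 0 y = 0" "F n x 0 = 0" "F n (Suc x) y = real y * N 2 n x y"
  by (auto simp: F_def split: nat.split)

lemma F_swap: "F n x y = F n y x"
  using N_two_faces_swap[of "y - 1" n "x - 1"] by (cases x; cases y) simp_all

lemma F_zero: "2 * (x + y) > n + 3 \<Longrightarrow> F n x y = 0"
  using N_two_faces_zero[of n "x - 1" y] by (cases x) auto

lemma B_nonneg: "B i x \<ge> 0"
  by (simp add: B_def N_nonneg)

lemma B_zero: "i \<le> 2 * x \<Longrightarrow> B i x = 0"
  using N_one_face_zero[of i "Suc x"] by (simp add: B_def)

section \<open>Recurrences for rooted leaves\<close>

lemma choose3: "real ((x + 3) choose 3) = real (x + 1) * real (x + 2) * real (x + 3) / 6"
proof (induction x)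
  case (Suc x)
  have c2: "real (m choose 2) = real m * (real m - 1) / 2" for m
    by (induction m) (simp_all add: numeral_2_eq_2 field_simps)
  have "real ((Suc x + 3) choose 3) = real ((x + 3) choose 3) + real ((x + 3) choose 2)"
    by (simp add: numeral_3_eq_3 numeral_2_eq_2)
  then show ?case unfolding Suc.IH c2 by (simp add: field_simps)
qed simp

lemma B_step3: "3 * real ((x + 3) choose 3) * B i (x + 3) = (real i - 1 - 2 * real x) * B i x"
proof -
  have "3 * real ((Suc x + 3) choose 3) * N 1 i (Suc x + 3) 0 = (real i + 1 - 2 * real (Suc x)) * N 1 i (Suc x) 0"
    by (rule N_one_face_rec)
  then have N: "(real i - 1 - 2 * real x) * N 1 i (Suc x) 0
      = 3 * (real (Suc x + 1) * real (Suc x + 2) * real (Suc x + 3) / 6) * N 1 i (Suc x + 3) 0"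
    unfolding choose3 by simp
  have "(real i - 1 - 2 * real x) * B i x = real (Suc x) * ((real i - 1 - 2 * real x) * N 1 i (Suc x) 0)"
    by (simp add: B_def)
  also have "\<dots> = 3 * (real (x + 1) * real (x + 2) * real (x + 3) / 6) * (real (Suc (x + 3)) * N 1 i (Suc (x + 3)) 0)"
    unfolding N by simp
  also have "\<dots> = 3 * real ((x + 3) choose 3) * B i (x + 3)"
    unfolding choose3 B_def ..
  finally show ?thesis by simp
qed

lemma B_grow: "real (Suc x) * B (i + 2) (Suc x) = 2 * real i * B i x"
proof -
  have "real (Suc (Suc x)) * N 1 (i + 2) (Suc (Suc x)) 0 = 2 * real i * N 1 i (Suc x) 0"
    using N_growth[of "Suc x" 1 i 0] N_one_face[of "Suc 0" "i + 2" "Suc x"] by simp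
  then show ?thesis by (simp add: B_def)
qed

lemma T_F: "T n x y = F n (Suc x) (Suc y) + (\<Sum>i\<le>n. N 1 i x 0 * N 1 (n - i) y 0)"
  by (simp add: T_eq)

text \<open>Partial sums of \<open>T\<close> along the line on which the two leaf numbers add up to
  \<open>s + 1\<close>. The mixed terms of the recurrence are of this form, and a difference in
  \<open>x\<close> leaves a single value of \<open>T\<close>.\<close>

definition G :: "nat \<Rightarrow> nat \<Rightarrow> nat \<Rightarrow> real" where
  "G n s x = (\<Sum>i<x. real (Suc i) * T n (Suc i) (s - i))"

lemma G_Suc: "G n s (Suc x) = G n s x + real (Suc x) * T n (Suc x) (s - x)"
  by (simp add: G_def)

text \<open>The one-face recurrence applies to each factor, and the coefficients (i + 1 - 2x) and (n
  - i + 1 - 2y) add up to a number independent of i. Disconnected pairs thus cancel from the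
  recurrence of \<open>T\<close> except in its mixed terms.\<close>

lemma pairs_rec:
  "3 * (real ((x + 3) choose 3) * (\<Sum>i\<le>n. N 1 i (x + 3) 0 * N 1 (n - i) y 0)
      + real ((y + 3) choose 3) * (\<Sum>i\<le>n. N 1 i x 0 * N 1 (n - i) (y + 3) 0))
    = (real n + 2 - 2 * real x - 2 * real y) * (\<Sum>i\<le>n. N 1 i x 0 * N 1 (n - i) y 0)"
proof -
  have "3 * (real ((x + 3) choose 3) * (N 1 i (x + 3) 0 * N 1 (n - i) y 0)
      + real ((y + 3) choose 3) * (N 1 i x 0 * N 1 (n - i) (y + 3) 0))
    = (real n + 2 - 2 * real x - 2 * real y) * (N 1 i x 0 * N 1 (n - i) y 0)" if "i \<le> n" for i
  proof -
    have "3 * (real ((x + 3) choose 3) * (N 1 i (x + 3) 0 * N 1 (n - i) y 0)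
      + real ((y + 3) choose 3) * (N 1 i x 0 * N 1 (n - i) (y + 3) 0))
      = (3 * real ((x + 3) choose 3) * N 1 i (x + 3) 0) * N 1 (n - i) y 0
      + N 1 i x 0 * (3 * real ((y + 3) choose 3) * N 1 (n - i) (y + 3) 0)"
      by (simp only: distrib_left mult_ac)
    then show ?thesis unfolding N_one_face_rec using that by (simp add: of_nat_diff algebra_simps)
  qed
  then have "(\<Sum>i\<le>n. 3 * (real ((x + 3) choose 3) * (N 1 i (x + 3) 0 * N 1 (n - i) y 0)
      + real ((y + 3) choose 3) * (N 1 i x 0 * N 1 (n - i) (y + 3) 0)))
    = (\<Sum>i\<le>n. (real n + 2 - 2 * real x - 2 * real y) * (N 1 i x 0 * N 1 (n - i) y 0))"
    by (intro sum.cong) auto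
  then show ?thesis by (simp only: sum.distrib sum_distrib_left[symmetric])
qed

text \<open>\<open>T_rec\<close> minus \<open>pairs_rec\<close>. Since \<open>F\<close> counts the
  roots as leaves, both indices are one larger, which changes the constant 2 to 6 and the upper
  index of the binomials from x + 3 to x + 2.\<close>

lemma F_rec:
  "(real n + 6 - 2 * real (x + y)) * F n x y
    = 3 * (real ((x + 2) choose 3) * F n (x + 3) y + real ((y + 2) choose 3) * F n x (y + 3)
        + real y * G n (x + y) x + real x * G n (x + y) y)"
proof (cases "x = 0 \<or> y = 0")
  case True
  then show ?thesis by (auto simp: G_def binomial_eq_0)
next
  case False
  then obtain a b where xy: "x = Suc a" "y = Suc b" by (metis not0_implies_Suc)
  let ?s = "x + y"
  have G1: "(\<Sum>k\<le>a. real (a + 1 - k) * real (b + 1) * T n (a + 1 - k) (b + k + 2)) = real y * G n ?s x"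
  proof -
    have "(\<Sum>k\<le>a. real (a + 1 - k) * real (b + 1) * T n (a + 1 - k) (b + k + 2))
        = (\<Sum>i<Suc a. real y * (real (Suc i) * T n (Suc i) (?s - i)))"
      by (rule sum.reindex_bij_witness[of _ "\<lambda>i. a - i" "\<lambda>k. a - k"])
        (auto simp: xy Suc_diff_le intro!: arg_cong2[where f = "T n"])
    then show ?thesis by (simp only: G_def xy sum_distrib_left)
  qed
  have G2: "(\<Sum>k\<le>b. real (b + 1 - k) * real (a + 1) * T n (a + k + 2) (b + 1 - k)) = real x * G n ?s y"
  proof -
    have "(\<Sum>k\<le>b. real (b + 1 - k) * real (a + 1) * T n (a + k + 2) (b + 1 - k))
        = (\<Sum>k\<le>b. real (b + 1 - k) * real (a + 1) * T n (b + 1 - k) (a + k + 2))"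
      by (subst T_swap) (rule refl)
    also have "\<dots> = (\<Sum>i<Suc b. real x * (real (Suc i) * T n (Suc i) (?s - i)))"
      by (rule sum.reindex_bij_witness[of _ "\<lambda>i. b - i" "\<lambda>k. b - k"])
        (auto simp: xy Suc_diff_le intro!: arg_cong2[where f = "T n"])
    finally show ?thesis by (simp only: G_def xy sum_distrib_left)
  qed
  have k: "real n + 2 - 2 * real a - 2 * real b = real n + 6 - 2 * real ?s" by (simp add: xy)
  let ?P = "\<lambda>a b. \<Sum>i\<le>n. N 1 i a 0 * N 1 (n - i) b 0"
  have t: "T n a b = F n x y + ?P a b" "T n (a + 3) b = F n (x + 3) y + ?P (a + 3) b"
    "T n a (b + 3) = F n x (y + 3) + ?P a (b + 3)"
    unfolding T_F by (simp_all add: xy)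
  have i: "a + 3 = x + 2" "b + 3 = y + 2" by (simp_all add: xy)
  note r = T_rec[of a n b, unfolded G1 G2 k t] and p = pairs_rec[of a n b, unfolded k]
  show ?thesis using r p unfolding i by (simp only: distrib_left)
qed

definition S :: "nat \<Rightarrow> nat \<Rightarrow> nat \<Rightarrow> real" where
  "S n x y = (\<Sum>i\<le>n. (real (n - i) - real i) * (B i x * B (n - i) y))"

lemma sum_flip: "(\<Sum>i\<le>n. h i (n - i)) = (\<Sum>i\<le>n. h (n - i) i)" for h :: "nat \<Rightarrow> nat \<Rightarrow> real"
  by (rule sum.reindex_bij_witness[of _ "\<lambda>i. n - i" "\<lambda>i. n - i"]) auto

lemma S_swap: "S n y x = - S n x y"
  using sum_flip[where h = "\<lambda>i j. (real j - real i) * (B i y * B j x)" and n = n]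
  by (simp add: S_def sum_negf[symmetric] algebra_simps)

lemma sum_shift:
  fixes h :: "nat \<Rightarrow> real"
  assumes "\<And>i. i < k \<Longrightarrow> h i = 0"
  shows "(\<Sum>i\<le>n + k. h i) = (\<Sum>i\<le>n. h (i + k))"
proof -
  have "(\<Sum>i\<le>n + k. h i) = (\<Sum>i\<in>{k..n + k}. h i)"
    by (rule sum.mono_neutral_right) (use assms in auto)
  also have "\<dots> = (\<Sum>i\<le>n. h (i + k))"
    by (rule sum.reindex_bij_witness[of _ "\<lambda>i. i + k" "\<lambda>i. i - k"]) auto
  finally show ?thesis .
qed

lemma B_small: "i < 2 \<Longrightarrow> B i (Suc x) = 0"
  by (rule B_zero) simp

text \<open>Removes a leaf from the first map inside a convolution; the two lowest terms vanish by
  \<open>B_small\<close>, so the summation can be shifted.\<close>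

lemma sum_B_grow_left:
  "real (Suc x) * (\<Sum>i\<le>n + 2. h i (n + 2 - i) * (B i (Suc x) * B (n + 2 - i) y))
    = (\<Sum>i\<le>n. 2 * real i * h (i + 2) (n - i) * (B i x * B (n - i) y))"
proof -
  have "(\<Sum>i\<le>n + 2. h i (n + 2 - i) * (B i (Suc x) * B (n + 2 - i) y))
      = (\<Sum>i\<le>n. h (i + 2) (n - i) * (B (i + 2) (Suc x) * B (n - i) y))"
    using sum_shift[of 2 "\<lambda>i. h i (n + 2 - i) * (B i (Suc x) * B (n + 2 - i) y)" n] by (simp add: B_small)
  then have "real (Suc x) * (\<Sum>i\<le>n + 2. h i (n + 2 - i) * (B i (Suc x) * B (n + 2 - i) y))
      = (\<Sum>i\<le>n. h (i + 2) (n - i) * ((real (Suc x) * B (i + 2) (Suc x)) * B (n - i) y))"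
    by (simp only: sum_distrib_left mult_ac)
  then show ?thesis unfolding B_grow by (simp only: mult_ac)
qed

lemma sum_B_grow_right:
  "real (Suc y) * (\<Sum>i\<le>n + 2. h i (n + 2 - i) * (B i x * B (n + 2 - i) (Suc y)))
    = (\<Sum>i\<le>n. 2 * real (n - i) * h i (n - i + 2) * (B i x * B (n - i) y))"
proof -
  have "(\<Sum>i\<le>n + 2. h i (n + 2 - i) * (B i x * B (n + 2 - i) (Suc y)))
      = (\<Sum>i\<le>n + 2. h (n + 2 - i) i * (B i (Suc y) * B (n + 2 - i) x))"
    using sum_flip[where h = "\<lambda>i j. h i j * (B i x * B j (Suc y))" and n = "n + 2"] by (simp only: mult_ac)
  moreover have "(\<Sum>i\<le>n. 2 * real i * h (n - i) (i + 2) * (B i y * B (n - i) x))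
      = (\<Sum>i\<le>n. 2 * real (n - i) * h i (n - i + 2) * (B i x * B (n - i) y))"
    using sum_flip[where h = "\<lambda>i j. 2 * real i * h j (i + 2) * (B i y * B j x)" and n = n] by (simp only: mult_ac)
  ultimately show ?thesis using sum_B_grow_left[where x = y and n = n and h = "\<lambda>i j. h j i" and y = x] by simp
qed

lemma choose3': "real ((x + 2) choose 3) = real x * real (x + 1) * real (x + 2) / 6"
proof (cases x)
  case (Suc z)
  then have "x + 2 = z + 3" by simp
  then show ?thesis using choose3[of z] Suc by (simp only:) simp
qed (simp add: binomial_eq_0)

lemma B_step3': "real (x + 1) * real (x + 2) * real (x + 3) * B i (x + 3) = 2 * (real i - 1 - 2 * real x) * B i x"
  using B_step3[of x i] unfolding choose3 by (simp add: field_simps)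

lemma F_rec':
  "(real n + 6 - 2 * real (x + y)) * F n x y
    = real x * real (x + 1) * real (x + 2) / 2 * F n (x + 3) y
      + real y * real (y + 1) * real (y + 2) / 2 * F n x (y + 3)
      + 3 * real y * G n (x + y) x + 3 * real x * G n (x + y) y"
  using F_rec[of n x y] unfolding choose3' by (simp only: distrib_left mult_ac times_divide_eq_left times_divide_eq_right)

section \<open>The difference equation for a fixed number of leaves\<close>

definition Q :: "nat \<Rightarrow> nat \<Rightarrow> nat \<Rightarrow> real" where
  "Q n x y = F n (Suc x) y - F n x (Suc y)"

definition P :: "nat \<Rightarrow> nat \<Rightarrow> nat \<Rightarrow> real" where
  "P n x y = (\<Sum>i\<le>n. N 1 i x 0 * N 1 (n - i) y 0)"

lemma Q_swap: "Q n y x = - Q n x y"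
  using F_swap[of n "Suc y" x] F_swap[of n y "Suc x"] by (simp add: Q_def)

text \<open>The prefactors are linear and the increments of \<open>G\<close> are single values of
  \<open>T\<close>, so a second difference removes all the partial sums. Both lines of increments
  run through the same two values because \<open>T\<close> is symmetric.\<close>

lemma G_second_difference:
  assumes s: "s = x + y + 2"
  shows "real y * G n s (x + 2) + real (x + 2) * G n s y
      - 2 * (real (y + 1) * G n s (x + 1) + real (x + 1) * G n s (y + 1))
      + (real (y + 2) * G n s x + real x * G n s (y + 2))
    = - real (x + 2) * T n (x + 2) (y + 1) - real (y + 2) * T n (x + 1) (y + 2)"
proof -
  have Gx: "G n s (x + 1) = G n s x + real (x + 1) * T n (x + 1) (y + 2)"
    "G n s (x + 2) = G n s (x + 1) + real (x + 2) * T n (x + 2) (y + 1)"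
    using G_Suc[of n s x] G_Suc[of n s "x + 1"] s by (simp_all add: numeral_2_eq_2)
  have "s - y = x + 2" "s - (y + 1) = x + 1" using s by simp_all
  then have Gy: "G n s (y + 1) = G n s y + real (y + 1) * T n (x + 2) (y + 1)"
    "G n s (y + 2) = G n s (y + 1) + real (y + 2) * T n (x + 1) (y + 2)"
    using G_Suc[of n s y] G_Suc[of n s "y + 1"] T_swap[of n "y + 1" "x + 2"] T_swap[of n "y + 2" "x + 1"]
    by (simp_all add: numeral_2_eq_2)
  show ?thesis unfolding Gx(2) Gy(2) unfolding Gx(1) Gy(1) by (simp add: algebra_simps)
qed

text \<open>A first difference of \<open>Q\<close> is a second difference of \<open>F\<close>, so
  three instances of \<open>F_rec'\<close> combine. The part of \<open>T\<close> coming from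
  connected maps joins the cubic terms; the disconnected part stays as inhomogeneity.\<close>

lemma Q_rec:
  "(real n + 2 - 2 * real (x + y)) * (Q n (x + 1) y - Q n x (y + 1))
    = (real (x + 2) * real (x + 3) * real (x + 4) * Q n (x + 4) y
        + real (x + 2) * real (x + 3) * (2 - real x) * Q n (x + 3) (y + 1)
        - real (y + 2) * real (y + 3) * real (y + 4) * Q n x (y + 4)
        - real (y + 2) * real (y + 3) * (2 - real y) * Q n (x + 1) (y + 3)) / 2
      - 3 * (real (x + 2) * P n (x + 2) (y + 1) + real (y + 2) * P n (x + 1) (y + 2))"
  (is "_ = ?R")
proof -
  let ?c = "real n + 2 - 2 * real (x + y)" and ?s = "x + y + 2"
  have s: "x + 2 + y = ?s" "x + 1 + (y + 1) = ?s" "x + (y + 2) = ?s" by simp_all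
  have c: "real n + 6 - 2 * real ?s = ?c" by simp
  have t: "T n (x + 2) (y + 1) = F n (x + 3) (y + 2) + P n (x + 2) (y + 1)"
    "T n (x + 1) (y + 2) = F n (x + 2) (y + 3) + P n (x + 1) (y + 2)"
    unfolding T_F P_def by (simp_all add: eval_nat_numeral)
  note f1 = F_rec'[of n "x + 2" y, unfolded s c] and f2 = F_rec'[of n "x + 1" "y + 1", unfolded s c]
    and f3 = F_rec'[of n x "y + 2", unfolded s c]
  have n: "x + 2 + 3 = x + 5" "x + 1 + 3 = x + 4" "x + 2 + 1 = x + 3" "x + 2 + 2 = x + 4" "x + 1 + 1 = x + 2" "x + 1 + 2 = x + 3"
    "y + 2 + 3 = y + 5" "y + 1 + 3 = y + 4" "y + 2 + 1 = y + 3" "y + 2 + 2 = y + 4" "y + 1 + 1 = y + 2" "y + 1 + 2 = y + 3" for x y :: nat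
    by simp_all
  have q: "Q n (x + 1) y = F n (x + 2) y - F n (x + 1) (y + 1)" "Q n x (y + 1) = F n (x + 1) (y + 1) - F n x (y + 2)"
    "Q n (x + 4) y = F n (x + 5) y - F n (x + 4) (y + 1)" "Q n (x + 3) (y + 1) = F n (x + 4) (y + 1) - F n (x + 3) (y + 2)"
    "Q n x (y + 4) = F n (x + 1) (y + 4) - F n x (y + 5)" "Q n (x + 1) (y + 3) = F n (x + 2) (y + 3) - F n (x + 1) (y + 4)"
    unfolding Q_def by (simp_all add: eval_nat_numeral)
  have "?c * (Q n (x + 1) y - Q n x (y + 1)) = ?c * F n (x + 2) y - 2 * (?c * F n (x + 1) (y + 1)) + ?c * F n x (y + 2)"
    unfolding q by (simp only: algebra_simps)
  also have "\<dots> = (real (x + 2) * real (x + 3) * real (x + 4) / 2 * F n (x + 5) y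
      + real y * real (y + 1) * real (y + 2) / 2 * F n (x + 2) (y + 3))
      - 2 * (real (x + 1) * real (x + 2) * real (x + 3) / 2 * F n (x + 4) (y + 1)
        + real (y + 1) * real (y + 2) * real (y + 3) / 2 * F n (x + 1) (y + 4))
      + (real x * real (x + 1) * real (x + 2) / 2 * F n (x + 3) (y + 2)
        + real (y + 2) * real (y + 3) * real (y + 4) / 2 * F n x (y + 5))
      + 3 * (real y * G n ?s (x + 2) + real (x + 2) * G n ?s y
      - 2 * (real (y + 1) * G n ?s (x + 1) + real (x + 1) * G n ?s (y + 1))
      + (real (y + 2) * G n ?s x + real x * G n ?s (y + 2)))"
    unfolding f1 f2 f3 n by (simp only: algebra_simps)
  \<comment> \<open>Regrouping into differences, the coefficient of
    \<open>F n (x + 4) (y + 1)\<close> leaves the factor 2 - x = (x + 4) - 2(x + 1). At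
    \<open>F n (x + 3) (y + 2)\<close> the terms then match because the mixed terms supply exactly
    -3(x + 2).\<close>
  also have "\<dots> = ?R"
    unfolding G_second_difference[OF refl] unfolding t q of_nat_add of_nat_numeral of_nat_1
    by (simp add: field_simps del: F_simps add_2_eq_Suc' add_Suc_right)
  finally show ?thesis .
qed

text \<open>Both sums come from the one convolution \<open>?R\<close> with a leaf more in each map:
  removing the leaf from the second map gives half of it, removing it from the first gives minus the
  other half.\<close>

lemma B_cross:
  "(\<Sum>i\<le>n. real (n - i) * (real (n - i) + 2 - real i) / real (Suc y) * (B i (Suc x) * B (n - i) y))
    + (\<Sum>i\<le>n. real i * (real i + 2 - real (n - i)) / real (Suc x) * (B i x * B (n - i) (Suc y))) = 0"
proof -
  let ?R = "\<Sum>i\<le>n + 2. (real (n + 2 - i) - real i) * (B i (Suc x) * B (n + 2 - i) (Suc y))"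
  have cancel: "real (Suc z) * R / (2 * real (Suc z)) = R / 2" "real (Suc z) * R / (- 2 * real (Suc z)) = - R / 2" for z and R :: real
    by (simp_all add: field_simps del: of_nat_Suc)
  have "(\<Sum>i\<le>n. real (n - i) * (real (n - i) + 2 - real i) / real (Suc y) * (B i (Suc x) * B (n - i) y))
      = (\<Sum>i\<le>n. 2 * real (n - i) * (real (n - i + 2) - real i) * (B i (Suc x) * B (n - i) y)) / (2 * real (Suc y))"
    unfolding sum_divide_distrib by (intro sum.cong refl) (simp add: field_simps)
  also have "\<dots> = ?R / 2"
    unfolding sum_B_grow_right[where h = "\<lambda>i j. real j - real i", symmetric] by (rule cancel)
  finally have 1: "(\<Sum>i\<le>n. real (n - i) * (real (n - i) + 2 - real i) / real (Suc y) * (B i (Suc x) * B (n - i) y)) = ?R / 2" .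
  have "(\<Sum>i\<le>n. real i * (real i + 2 - real (n - i)) / real (Suc x) * (B i x * B (n - i) (Suc y)))
      = (\<Sum>i\<le>n. 2 * real i * (real (n - i) - real (i + 2)) * (B i x * B (n - i) (Suc y))) / (- 2 * real (Suc x))"
    unfolding sum_divide_distrib by (intro sum.cong refl) (simp add: field_simps)
  also have "\<dots> = - ?R / 2"
    unfolding sum_B_grow_left[where h = "\<lambda>i j. real j - real i", symmetric] by (rule cancel)
  finally show ?thesis using 1 by simp
qed

text \<open>After the three-leaf recurrence for \<open>B\<close> only the products \<open>?X\<close>
  and \<open>?Y\<close> remain. What fails to cancel termwise is the left side of
  \<open>B_cross\<close>, so the identity holds only after summation.\<close>

lemma S_rec:
  "(real n + 2 - 2 * real (x + y)) * (S n (x + 1) y - S n x (y + 1))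
    = (real (x + 2) * real (x + 3) * real (x + 4) * S n (x + 4) y
        + real (x + 2) * real (x + 3) * (2 - real x) * S n (x + 3) (y + 1)
        - real (y + 2) * real (y + 3) * real (y + 4) * S n x (y + 4)
        - real (y + 2) * real (y + 3) * (2 - real y) * S n (x + 1) (y + 3)) / 2
      - 3 * real n * (real (x + 2) * P n (x + 2) (y + 1) + real (y + 2) * P n (x + 1) (y + 2))"
  (is "?L = ?R")
proof -
  let ?X = "\<lambda>i. B i (x + 1) * B (n - i) y" and ?Y = "\<lambda>i. B i x * B (n - i) (y + 1)"
  let ?j = "\<lambda>i. real (n - i)"
  have s3: "real (x + 2) * real (x + 3) * real (x + 4) * B i (x + 4) = 2 * (real i - 3 - 2 * real x) * B i (x + 1)" for i x
    using B_step3'[of "x + 1" i] by (simp add: algebra_simps eval_nat_numeral)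
  have s2: "real (x + 2) * real (x + 3) * (2 - real x) * B i (x + 3)
      = 2 * (real i - 1 - 2 * real x) * (2 - real x) / real (x + 1) * B i x" for i x
  proof -
    have "real (x + 1) * (real (x + 2) * real (x + 3) * (2 - real x) * B i (x + 3))
        = (2 - real x) * (real (x + 1) * real (x + 2) * real (x + 3) * B i (x + 3))"
      by (simp only: mult_ac)
    then show ?thesis unfolding B_step3' by (simp add: field_simps)
  qed
  have p: "N 1 i (x + 1) 0 = B i x / real (x + 1)" "N 1 i (x + 2) 0 = B i (x + 1) / real (x + 2)" for i x
    by (simp_all add: B_def)
  have pc: "real (z + 2) * (a / real (z + 2) * b) = a * b" "real (z + 2) * (b * (a / real (z + 2))) = b * a" for z and a b :: real
    by (simp_all del: of_nat_Suc of_nat_add)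
  have P1: "real (x + 2) * P n (x + 2) (y + 1) = (\<Sum>i\<le>n. ?X i / real (y + 1))"
  proof -
    have "real (x + 2) * (N 1 i (x + 2) 0 * N 1 (n - i) (y + 1) 0) = ?X i / real (y + 1)" for i
      unfolding p pc by simp
    then show ?thesis unfolding P_def sum_distrib_left by (intro sum.cong refl)
  qed
  have P2: "real (y + 2) * P n (x + 1) (y + 2) = (\<Sum>i\<le>n. ?Y i / real (x + 1))"
  proof -
    have "real (y + 2) * (N 1 i (x + 1) 0 * N 1 (n - i) (y + 2) 0) = ?Y i / real (x + 1)" for i
      unfolding p pc by simp
    then show ?thesis unfolding P_def sum_distrib_left by (intro sum.cong refl)
  qed
  have S1: "real (x + 2) * real (x + 3) * real (x + 4) * S n (x + 4) y
      = (\<Sum>i\<le>n. (?j i - real i) * (2 * (real i - 3 - 2 * real x)) * ?X i)"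
  proof -
    have "real (x + 2) * real (x + 3) * real (x + 4) * ((?j i - real i) * (B i (x + 4) * B (n - i) y))
        = (?j i - real i) * (real (x + 2) * real (x + 3) * real (x + 4) * B i (x + 4)) * B (n - i) y" for i
      by (simp only: mult_ac)
    then show ?thesis unfolding S_def sum_distrib_left s3 by (intro sum.cong refl) (simp only: mult_ac)
  qed
  have S2: "real (x + 2) * real (x + 3) * (2 - real x) * S n (x + 3) (y + 1)
      = (\<Sum>i\<le>n. (?j i - real i) * (2 * (real i - 1 - 2 * real x) * (2 - real x) / real (x + 1)) * ?Y i)"
  proof -
    have "real (x + 2) * real (x + 3) * (2 - real x) * ((?j i - real i) * (B i (x + 3) * B (n - i) (y + 1)))
        = (?j i - real i) * (real (x + 2) * real (x + 3) * (2 - real x) * B i (x + 3)) * B (n - i) (y + 1)" for i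
      by (simp only: mult_ac)
    then show ?thesis unfolding S_def sum_distrib_left s2 by (intro sum.cong refl) (simp only: mult_ac)
  qed
  have S3: "real (y + 2) * real (y + 3) * real (y + 4) * S n x (y + 4)
      = (\<Sum>i\<le>n. (?j i - real i) * (2 * (?j i - 3 - 2 * real y)) * ?Y i)"
  proof -
    have "real (y + 2) * real (y + 3) * real (y + 4) * ((?j i - real i) * (B i x * B (n - i) (y + 4)))
        = (?j i - real i) * (real (y + 2) * real (y + 3) * real (y + 4) * B (n - i) (y + 4)) * B i x" for i
      by (simp only: mult_ac)
    then show ?thesis unfolding S_def sum_distrib_left s3 by (intro sum.cong refl) (simp only: mult_ac)
  qed
  have S4: "real (y + 2) * real (y + 3) * (2 - real y) * S n (x + 1) (y + 3)
      = (\<Sum>i\<le>n. (?j i - real i) * (2 * (?j i - 1 - 2 * real y) * (2 - real y) / real (y + 1)) * ?X i)"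
  proof -
    have "real (y + 2) * real (y + 3) * (2 - real y) * ((?j i - real i) * (B i (x + 1) * B (n - i) (y + 3)))
        = (?j i - real i) * (real (y + 2) * real (y + 3) * (2 - real y) * B (n - i) (y + 3)) * B i (x + 1)" for i
      by (simp only: mult_ac)
    then show ?thesis unfolding S_def sum_distrib_left s2 by (intro sum.cong refl) (simp only: mult_ac)
  qed
  \<comment> \<open>The coefficient of \<open>?X\<close>; that of \<open>?Y\<close> is the same
    expression with i, j and x, y exchanged.\<close>
  have key: "((j - i) * (2 * (i - 3 - 2 * x)) - (j - i) * (2 * (j - 1 - 2 * y) * (2 - y) / (y + 1))) / 2
      - 3 * (i + j) / (y + 1) - (i + j + 2 - 2 * (x + y)) * (j - i)
      = - 3 * (j * (j + 2 - i) / (y + 1))" if "y + 1 \<noteq> 0" for i j x y :: real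
  proof -
    define z where "z = y + 1"
    have y: "y = z - 1" and "z \<noteq> 0" using that by (simp_all add: z_def)
    then show ?thesis unfolding y by (simp add: divide_simps) (simp add: algebra_simps)
  qed
  have tm: "((?j i - real i) * (2 * (real i - 3 - 2 * real x)) * ?X i
        + (?j i - real i) * (2 * (real i - 1 - 2 * real x) * (2 - real x) / real (x + 1)) * ?Y i
        - (?j i - real i) * (2 * (?j i - 3 - 2 * real y)) * ?Y i
        - (?j i - real i) * (2 * (?j i - 1 - 2 * real y) * (2 - real y) / real (y + 1)) * ?X i) / 2
      - 3 * real n * (?X i / real (y + 1) + ?Y i / real (x + 1))
      - (real n + 2 - 2 * real (x + y)) * ((?j i - real i) * ?X i - (?j i - real i) * ?Y i)
      = - 3 * (?j i * (?j i + 2 - real i) / real (y + 1) * ?X i + real i * (real i + 2 - ?j i) / real (x + 1) * ?Y i)"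
    (is "?l i = ?r i") if "i \<le> n" for i
  proof -
    have n: "real n = real i + ?j i" using that by simp
    have "?l i = (((?j i - real i) * (2 * (real i - 3 - 2 * real x)) - (?j i - real i) * (2 * (?j i - 1 - 2 * real y) * (2 - real y) / (real y + 1))) / 2
        - 3 * (real i + ?j i) / (real y + 1) - (real i + ?j i + 2 - 2 * (real x + real y)) * (?j i - real i)) * ?X i
      + (((real i - ?j i) * (2 * (?j i - 3 - 2 * real y)) - (real i - ?j i) * (2 * (real i - 1 - 2 * real x) * (2 - real x) / (real x + 1))) / 2
        - 3 * (?j i + real i) / (real x + 1) - (?j i + real i + 2 - 2 * (real y + real x)) * (real i - ?j i)) * ?Y i"
      unfolding n of_nat_add of_nat_1 by (simp only: ring_distribs diff_divide_distrib add_divide_distrib times_divide_eq_left times_divide_eq_right mult_ac)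
    also have "\<dots> = ?r i"
      by (subst (1 2) key) (simp_all add: algebra_simps)
    finally show ?thesis .
  qed
  have "?R - ?L = (\<Sum>i\<le>n. ?l i)"
    unfolding S1 S2 S3 S4 P1 P2 unfolding S_def sum_subtractf sum.distrib sum_divide_distrib[symmetric] sum_distrib_left[symmetric]
    by (simp only: )
  also have "\<dots> = (\<Sum>i\<le>n. ?r i)"
    by (intro sum.cong refl tm) simp
  also have "\<dots> = 0"
    unfolding sum_distrib_left[symmetric] sum.distrib Suc_eq_plus1[symmetric] B_cross by simp
  finally show ?thesis by simp
qed

text \<open>Multiplied by \<open>n\<close>, \<open>Q\<close> satisfies the recurrence of
  \<open>S\<close> with the same inhomogeneity, so the difference \<open>D\<close> satisfies the
  homogeneous one, whose right side has three leaves more. Induction goes down from many leaves,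
  where everything vanishes.\<close>

theorem Q_eq: "real n * Q n x y = S n x y"
proof -
  define D where "D x y = real n * Q n x y - S n x y" for x y
  have swap: "D y x = - D x y" for x y
    unfolding D_def Q_swap[of n y x] S_swap[of n y x] by simp
  have rec: "(real n + 2 - 2 * real (x + y)) * (D (x + 1) y - D x (y + 1))
    = (real (x + 2) * real (x + 3) * real (x + 4) * D (x + 4) y
        + real (x + 2) * real (x + 3) * (2 - real x) * D (x + 3) (y + 1)
        - real (y + 2) * real (y + 3) * real (y + 4) * D x (y + 4)
        - real (y + 2) * real (y + 3) * (2 - real y) * D (x + 1) (y + 3)) / 2" (is "?l = ?r") for x y
  proof -
    have "?l = real n * ((real n + 2 - 2 * real (x + y)) * (Q n (x + 1) y - Q n x (y + 1)))
        - (real n + 2 - 2 * real (x + y)) * (S n (x + 1) y - S n x (y + 1))"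
      unfolding D_def by (simp only: algebra_simps)
    also have "\<dots> = ?r" unfolding Q_rec S_rec D_def by (simp only: ring_distribs diff_divide_distrib add_divide_distrib mult_ac times_divide_eq_left times_divide_eq_right)
    finally show ?thesis .
  qed
  have "D x y = 0" for x y
  proof (induction "n + 4 - 2 * (x + y)" arbitrary: x y rule: less_induct)
    case less
    let ?m = "x + y"
    show ?case
    proof (cases "n + 4 \<le> 2 * ?m")
      case True
      have "F n (Suc x) y = 0" "F n x (Suc y) = 0" by (rule F_zero; use True in simp)+
      moreover have "B i x * B (n - i) y = 0" if "i \<le> n" for i
      proof (cases "i \<le> 2 * x")
        case False
        then have "n - i \<le> 2 * y" using True by arith
        then show ?thesis by (simp add: B_zero)
      qed (simp add: B_zero)
      then have "S n x y = 0" unfolding S_def by (intro sum.neutral) simp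
      ultimately show ?thesis by (simp add: D_def Q_def)
    next
      case False
      have far: "D a b = 0" if "a + b = ?m + 3" for a b
        by (rule less.hyps) (use that False in simp)
      have step: "D (a + 1) b = D a (b + 1)" if "a + b + 1 = ?m" for a b
      proof -
        have "D (a + 4) b = 0" "D (a + 3) (b + 1) = 0" "D a (b + 4) = 0" "D (a + 1) (b + 3) = 0"
          by (rule far; use that in simp)+
        then have "(real n + 2 - 2 * real (a + b)) * (D (a + 1) b - D a (b + 1)) = 0"
          unfolding rec by simp
        \<comment> \<open>The coefficient is positive because the case assumption gives
          \<open>2 * (a + b + 1) < n + 4\<close>.\<close>
        moreover have "real n + 2 - 2 * real (a + b) \<noteq> 0"
        proof -
          have "2 * (a + b) < n + 2" using False that by arith
          then have "2 * real (a + b) < real n + 2" by linarith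
          then show ?thesis by simp
        qed
        ultimately show ?thesis by simp
      qed
      have const: "a + b = ?m \<Longrightarrow> D a b = D 0 ?m" for a b
      proof (induction a arbitrary: b)
        case (Suc a)
        then show ?case using step[of a b] Suc.IH[of "b + 1"] by simp
      qed simp
      \<comment> \<open>Being constant along the line as well as antisymmetric, \<open>D\<close>
        vanishes on it.\<close>
      have "D x y = D y x" using const[of x y] const[of y x] by simp
      then show ?thesis using swap[of y x] by simp
    qed
  qed
  then show ?thesis by (simp add: D_def)
qed

text \<open>In a one-face map with \<open>i\<close> edges and \<open>x + 2\<close> leaves, \<open>(i - 1 - 2x) / 3\<close> is twice the genus; in a
  two-face map with \<open>n\<close> edges and \<open>x + y\<close> leaves, so is \<open>(n - 2(x + y)) / 3\<close>. Using these numbers in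
  place of the genus makes integrality irrelevant.\<close>

definition cube :: "nat \<Rightarrow> real" where
  "cube m = 4 / 3 * real m * real (m + 2) * real (m + 4)"

text \<open>The total of n + 2 edges drops to n when a leaf is removed from either map, which brings
  in a weight 2i or 2(n - i).\<close>

definition K :: "nat \<Rightarrow> nat \<Rightarrow> nat \<Rightarrow> real" where
  "K n x y = (\<Sum>i\<le>n + 2. B i x * B (n + 2 - i) y)"

text \<open>Inserting three leaves one after another into a map with i edges is possible in 2i, 2(i
  + 2), 2(i + 4) ways; division by 3! explains the constant 4/3 in \<open>cube\<close>. So twice the
  genus times the number of one-face maps equals the number of maps of one genus less with three
  further leaves marked.\<close>

lemma B_genus: "(real (i + 6) - 1 - 2 * real x) / 3 * B (i + 6) x = cube i * B i x"
proof -
  have g: "real (x + 3) * B (i + 6) (x + 3) = 2 * real (i + 4) * B (i + 4) (x + 2)"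
    "real (x + 2) * B (i + 4) (x + 2) = 2 * real (i + 2) * B (i + 2) (x + 1)"
    "real (x + 1) * B (i + 2) (x + 1) = 2 * real i * B i x"
    using B_grow[of "x + 2" "i + 4"] B_grow[of "x + 1" "i + 2"] B_grow[of x i] by (simp_all add: eval_nat_numeral)
  have "real (x + 1) * real (x + 2) * real (x + 3) * B (i + 6) (x + 3)
      = real (x + 1) * real (x + 2) * (real (x + 3) * B (i + 6) (x + 3))" by (simp only: mult_ac)
  also have "\<dots> = 2 * real (i + 4) * real (x + 1) * (real (x + 2) * B (i + 4) (x + 2))"
    unfolding g(1) by (simp only: mult_ac)
  also have "\<dots> = 4 * real (i + 4) * real (i + 2) * (real (x + 1) * B (i + 2) (x + 1))"
    unfolding g(2) by (simp add: algebra_simps)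
  also have "\<dots> = 6 * (cube i * B i x)"
    unfolding g(3) cube_def by (simp add: algebra_simps)
  finally show ?thesis unfolding B_step3' by (simp add: field_simps)
qed

lemma B_genus_small: "i < 6 \<Longrightarrow> (real i - 1 - 2 * real x) / 3 * B i x = 0"
  using B_step3'[of x i] B_zero[of i "x + 3"] by auto

lemma genus_sum:
  "(\<Sum>i\<le>m + 6. (real i - 1 - 2 * real x) / 3 * B i x * (h i (m + 6 - i) * B (m + 6 - i) y))
    = (\<Sum>i\<le>m. cube i * h (i + 6) (m - i) * (B i x * B (m - i) y))"
proof -
  have "(\<Sum>i\<le>m + 6. (real i - 1 - 2 * real x) / 3 * B i x * (h i (m + 6 - i) * B (m + 6 - i) y))
      = (\<Sum>i\<le>m. (real (i + 6) - 1 - 2 * real x) / 3 * B (i + 6) x * (h (i + 6) (m + 6 - (i + 6)) * B (m + 6 - (i + 6)) y))"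
    by (rule sum_shift) (simp only: B_genus_small mult_zero_left)
  then show ?thesis unfolding B_genus by (simp add: mult_ac)
qed

lemma genus_sum_small:
  "n < 6 \<Longrightarrow> (\<Sum>i\<le>n. (real i - 1 - 2 * real x) / 3 * B i x * (h i (n - i) * B (n - i) y)) = 0"
  by (rule sum.neutral, intro ballI, subst B_genus_small) simp_all

text \<open>Summed over the distributions of the leaves, this counts the maps of one genus less with three
  more leaves, three of them marked.\<close>

definition lower :: "(nat \<Rightarrow> nat \<Rightarrow> nat \<Rightarrow> real) \<Rightarrow> nat \<Rightarrow> nat \<Rightarrow> nat \<Rightarrow> real" where
  "lower A n x y = (if n < 6 then 0 else cube (n - 6) * A (n - 6) x y)"

text \<open>The genus factor is distributed over the two one-face maps, where \<open>B_genus\<close>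
  lowers the genus of one of them. The lowered convolution is turned back into two-face maps by
  \<open>Q_eq\<close> for six edges less.\<close>

lemma difference_step:
  "((real n - 2 * real (x + y + 1)) / 3 + 1) * S n x y
    = real n * (lower F n (x + 1) y - lower F n x (y + 1))
      + (real (x + 1) * real y * K n (x + 1) y - real x * real (y + 1) * K n x (y + 1))"
proof -
  let ?j = "\<lambda>i. real (n - i)"
  let ?u = "\<lambda>i x. (real i - 1 - 2 * real x) / 3"
  have K1: "real (x + 1) * K n (x + 1) y = (\<Sum>i\<le>n. 2 * real i * (B i x * B (n - i) y))"
    using sum_B_grow_left[where h = "\<lambda>i j. 1" and n = n and x = x and y = y] by (simp add: K_def)
  have K2: "real (y + 1) * K n x (y + 1) = (\<Sum>i\<le>n. 2 * ?j i * (B i x * B (n - i) y))"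
    using sum_B_grow_right[where h = "\<lambda>i j. 1" and n = n and x = x and y = y] by (simp add: K_def)
  \<comment> \<open>The fractions on the right are twice the genera of the two maps; the
    \<open>K\<close> terms are just what makes the left side a combination of these.\<close>
  have key: "((i + j - 2 * (x + y + 1)) / 3 + 1) * (j - i) - y * (2 * i) + x * (2 * j)
      = (j - 1 - 2 * y) / 3 * (j + 2 * i) - (i - 1 - 2 * x) / 3 * (2 * j + i)" for i j x y :: real
    by (simp add: field_simps)
  have tm: "((real n - 2 * real (x + y + 1)) / 3 + 1) * ((?j i - real i) * (B i x * B (n - i) y))
      - real y * (2 * real i * (B i x * B (n - i) y)) + real x * (2 * ?j i * (B i x * B (n - i) y))
      = ?u (n - i) y * B (n - i) y * ((?j i + 2 * real i) * B i x) - ?u i x * B i x * ((2 * ?j i + real i) * B (n - i) y)"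
    (is "?l = ?r") if "i \<le> n" for i
  proof -
    have n: "real n = real i + ?j i" using that by simp
    have "?l = (((real i + ?j i - 2 * (real x + real y + 1)) / 3 + 1) * (?j i - real i) - real y * (2 * real i) + real x * (2 * ?j i)) * (B i x * B (n - i) y)"
      unfolding n of_nat_add of_nat_1 by (simp only: ring_distribs mult_ac)
    also have "\<dots> = ?r" unfolding key by (simp only: ring_distribs mult_ac)
    finally show ?thesis .
  qed
  have "((real n - 2 * real (x + y + 1)) / 3 + 1) * S n x y
      - (real (x + 1) * real y * K n (x + 1) y - real x * real (y + 1) * K n x (y + 1))
      = ((real n - 2 * real (x + y + 1)) / 3 + 1) * S n x y - real y * (real (x + 1) * K n (x + 1) y) + real x * (real (y + 1) * K n x (y + 1))"
    by (simp only: algebra_simps)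
  also have "\<dots> = (\<Sum>i\<le>n. ((real n - 2 * real (x + y + 1)) / 3 + 1) * ((?j i - real i) * (B i x * B (n - i) y))
      - real y * (2 * real i * (B i x * B (n - i) y)) + real x * (2 * ?j i * (B i x * B (n - i) y)))"
    unfolding K1 K2 S_def by (simp only: sum.distrib sum_subtractf sum_distrib_left)
  also have "\<dots> = (\<Sum>i\<le>n. ?u (n - i) y * B (n - i) y * ((?j i + 2 * real i) * B i x) - ?u i x * B i x * ((2 * ?j i + real i) * B (n - i) y))"
    by (intro sum.cong refl tm) simp
  also have "\<dots> = (\<Sum>i\<le>n. ?u i y * B i y * ((real i + 2 * ?j i) * B (n - i) x)) - (\<Sum>i\<le>n. ?u i x * B i x * ((2 * ?j i + real i) * B (n - i) y))"
    unfolding sum_subtractf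
    using sum_flip[where h = "\<lambda>i j. ?u j y * B j y * ((real j + 2 * real i) * B i x)" and n = n] by simp
  also have "\<dots> = real n * (lower F n (x + 1) y - lower F n x (y + 1))"
  proof (cases "n < 6")
    case True
    show ?thesis
      using genus_sum_small[OF True, where x = y and y = x and h = "\<lambda>i j. real i + 2 * real j"]
        genus_sum_small[OF True, where x = x and y = y and h = "\<lambda>i j. 2 * real j + real i"] True
      by (simp add: lower_def)
  next
    case False
    then obtain m where n: "n = m + 6" by (metis add.commute le_Suc_ex not_less)
    \<comment> \<open>After lowering, the weights of the two sums combine to a factor depending on i
      + j alone, times the weight j - i of \<open>S\<close>.\<close>
    have key2: "(4 / 3 * j * (j + 2) * (j + 4)) * (j + 6 + 2 * i) - (4 / 3 * i * (i + 2) * (i + 4)) * (2 * j + (i + 6))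
      = (i + j + 6) * (4 / 3 * (i + j + 2) * (i + j + 4)) * (j - i)" for i j :: real
      by (simp add: field_simps)
    have "(\<Sum>i\<le>n. ?u i y * B i y * ((real i + 2 * ?j i) * B (n - i) x))
        = (\<Sum>i\<le>m. cube i * (real (i + 6) + 2 * real (m - i)) * (B i y * B (m - i) x))"
      unfolding n by (rule genus_sum[where h = "\<lambda>i j. real i + 2 * real j"])
    also have "\<dots> = (\<Sum>i\<le>m. cube (m - i) * (real (m - i + 6) + 2 * real i) * (B i x * B (m - i) y))"
      using sum_flip[where h = "\<lambda>i j. cube i * (real (i + 6) + 2 * real j) * (B i y * B j x)" and n = m]
      by (simp only: mult_ac)
    finally have "(\<Sum>i\<le>n. ?u i y * B i y * ((real i + 2 * ?j i) * B (n - i) x)) - (\<Sum>i\<le>n. ?u i x * B i x * ((2 * ?j i + real i) * B (n - i) y))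
      = (\<Sum>i\<le>m. cube (m - i) * (real (m - i + 6) + 2 * real i) * (B i x * B (m - i) y) - cube i * (2 * real (m - i) + real (i + 6)) * (B i x * B (m - i) y))"
      unfolding sum_subtractf n genus_sum[where h = "\<lambda>i j. 2 * real j + real i"] by simp
    also have "\<dots> = (\<Sum>i\<le>m. real n * (4 / 3 * real (m + 2) * real (m + 4)) * ((real (m - i) - real i) * (B i x * B (m - i) y)))"
    proof (intro sum.cong refl)
      fix i assume "i \<in> {..m}"
      then have m: "real m = real i + real (m - i)" by simp
      have "cube (m - i) * (real (m - i + 6) + 2 * real i) * (B i x * B (m - i) y) - cube i * (2 * real (m - i) + real (i + 6)) * (B i x * B (m - i) y)
          = (cube (m - i) * (real (m - i) + 6 + 2 * real i) - cube i * (2 * real (m - i) + (real i + 6))) * (B i x * B (m - i) y)"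
        unfolding of_nat_add of_nat_numeral by (simp only: left_diff_distrib)
      also have "\<dots> = real n * (4 / 3 * real (m + 2) * real (m + 4)) * (real (m - i) - real i) * (B i x * B (m - i) y)"
        unfolding n cube_def of_nat_add of_nat_numeral key2 m by (simp only: add_ac)
      finally show "cube (m - i) * (real (m - i + 6) + 2 * real i) * (B i x * B (m - i) y) - cube i * (2 * real (m - i) + real (i + 6)) * (B i x * B (m - i) y)
          = real n * (4 / 3 * real (m + 2) * real (m + 4)) * ((real (m - i) - real i) * (B i x * B (m - i) y))"
        by (simp only: mult.assoc)
    qed
    also have "\<dots> = real n * (4 / 3 * real (m + 2) * real (m + 4)) * S m x y"
      by (simp only: S_def sum_distrib_left)
    \<comment> \<open>The factor m that completes \<open>cube m\<close> comes from
      \<open>Q_eq\<close> for m edges.\<close>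
    also have "\<dots> = real n * (cube m * Q m x y)"
      unfolding Q_eq[symmetric] cube_def by simp
    also have "\<dots> = real n * (lower F n (x + 1) y - lower F n x (y + 1))"
      by (simp add: lower_def n Q_def right_diff_distrib)
    finally show ?thesis .
  qed
  finally show ?thesis by simp
qed

text \<open>\<open>difference_step\<close> is summed along a line of constant x + y, starting from
  \<open>F n 0 y = 0\<close>. As \<open>F\<close> counts all x + y leaves, the first factor is 2g +
  1.\<close>

theorem F_genus:
  "((real n - 2 * real (x + y)) / 3 + 1) * (real n * F n x y)
    = real n * lower F n x y + real x * real y * K n x y"
proof (induction x arbitrary: y)
  case 0
  show ?case by (simp add: lower_def)
next
  case (Suc x)
  let ?w = "(real n - 2 * real (x + y + 1)) / 3 + 1"
  have w: "x + Suc y = x + y + 1" "Suc x + y = x + y + 1" by simp_all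
  have "?w * (real n * F n (Suc x) y) = ?w * (real n * F n x (Suc y)) + ?w * (real n * Q n x y)"
    unfolding Q_def by (simp only: algebra_simps)
  also have "\<dots> = real n * lower F n (x + 1) y + real (x + 1) * real y * K n (x + 1) y"
    using Suc.IH[of "Suc y"] unfolding Q_eq difference_step w
    by (simp only: Suc_eq_plus1) (simp add: algebra_simps)
  finally show ?case unfolding w by (simp only: Suc_eq_plus1)
qed

text \<open>The quotient e/d stays at most 1 but grows in each step by a factor of at least 1 +
  1/(2(n + 2k) - 1), and the product of these factors diverges like the fourth root of k.\<close>

lemma ratio_argument:
  fixes e d a :: "nat \<Rightarrow> real" and n :: nat
  assumes n: "n \<ge> 1" and a: "\<And>k. a k > 0" and e: "\<And>k. 0 \<le> e k" and ed: "\<And>k. e k \<le> d k"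
    and up: "\<And>k. a k * e (Suc k) = 2 * real (n + 2 * k) * e k"
    and low: "\<And>k. a k * d (Suc k) \<le> (2 * real (n + 2 * k) - 1) * d k"
  shows "e 0 = 0"
proof (rule ccontr)
  assume "e 0 \<noteq> 0"
  then have e0: "e 0 > 0" using e[of 0] by simp
  have pos: "e k > 0" for k
  proof (induction k)
    case (Suc k)
    have "a k * e (Suc k) > 0" unfolding up using Suc n by simp
    then show ?case using a[of k] by (simp add: zero_less_mult_iff)
  qed (rule e0)
  define r where "r k = e k / d k" for k
  have dpos: "d k > 0" for k using pos[of k] ed[of k] by linarith
  have r: "0 < r k" "r k \<le> 1" for k using pos[of k] dpos[of k] ed[of k] by (simp_all add: r_def)
  \<comment> \<open>With t = 2(n + 2k) - 1, Bernoulli's inequality for the fourth power gives 1 +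
    4/t, which is at least the growth factor 1 + 2/(n + 2k) of the denominator.\<close>
  have step: "r k ^ 4 / real (n + 2 * k) \<le> r (Suc k) ^ 4 / real (n + 2 * Suc k)" for k
  proof -
    define t where "t = 2 * real (n + 2 * k) - 1"
    have t: "t \<ge> 1" using n by (simp add: t_def)
    have t1: "2 * real (n + 2 * k) = t + 1" by (simp add: t_def)
    have "d (Suc k) \<le> t * d k / a k"
      using low[of k] a[of k] by (simp add: t_def field_simps)
    moreover have "e (Suc k) = (t + 1) * e k / a k"
      using up[of k] a[of k] unfolding t1 by (simp add: field_simps)
    ultimately have "(t + 1) * e k / a k / (t * d k / a k) \<le> r (Suc k)"
      unfolding r_def using dpos[of "Suc k"] pos[of k] a[of k] t by (intro frac_le) simp_all
    moreover have "(t + 1) * e k / a k / (t * d k / a k) = (1 + 1 / t) * r k"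
    proof -
      have "1 + 1 / t = (t + 1) / t" using t by (simp add: field_simps)
      then show ?thesis using a[of k] by (simp add: r_def)
    qed
    ultimately have "((1 + 1 / t) * r k) ^ 4 \<le> r (Suc k) ^ 4"
      using r(1)[of k] t by (intro power_mono) (simp_all add: add_nonneg_nonneg)
    moreover have "1 + real 4 * (1 / t) \<le> (1 + 1 / t) ^ 4"
      using t by (intro Bernoulli_inequality) (simp add: order_trans[of "-1" 0])
    then have "(1 + 4 / t) * r k ^ 4 \<le> ((1 + 1 / t) * r k) ^ 4"
      unfolding power_mult_distrib using r(1)[of k] by (intro mult_right_mono) simp_all
    moreover have "real (n + 2 * Suc k) / real (n + 2 * k) \<le> 1 + 4 / t"
    proof -
      have m: "real (n + 2 * k) = (t + 1) / 2" "real (n + 2 * Suc k) = (t + 5) / 2" using t1 by simp_all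
      show ?thesis unfolding m using t by (simp add: field_simps)
    qed
    then have "real (n + 2 * Suc k) / real (n + 2 * k) * r k ^ 4 \<le> (1 + 4 / t) * r k ^ 4"
      using r(1)[of k] by (intro mult_right_mono) simp_all
    ultimately have "real (n + 2 * Suc k) / real (n + 2 * k) * r k ^ 4 \<le> r (Suc k) ^ 4" by linarith
    then show ?thesis using n by (simp add: field_simps)
  qed
  have low_r: "r 0 ^ 4 / real n \<le> r k ^ 4 / real (n + 2 * k)" for k
  proof (induction k)
    case (Suc k)
    then show ?case using step[of k] by linarith
  qed simp
  have bound: "r 0 ^ 4 / real n * real (n + 2 * k) \<le> 1" for k
  proof -
    have "r k ^ 4 \<le> 1" using r[of k] by (intro power_le_one) simp_all
    then have "r k ^ 4 / real (n + 2 * k) \<le> 1 / real (n + 2 * k)" by (intro divide_right_mono) simp_all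
    then have "r 0 ^ 4 / real n \<le> 1 / real (n + 2 * k)" using low_r[of k] by linarith
    then show ?thesis using n by (simp add: field_simps)
  qed
  define c where "c = r 0 ^ 4 / real n"
  have c: "c > 0" unfolding c_def using r(1)[of 0] n by simp
  obtain k where "1 / c < real k" using reals_Archimedean2 by blast
  then have "1 < c * real k" using c by (simp add: field_simps)
  also have "\<dots> \<le> c * real (n + 2 * k)" using c by (intro mult_left_mono) simp_all
  finally show False using bound[of k] unfolding c_def by simp
qed

section \<open>The refined formula with a leafless second face\<close>

abbreviation A :: "nat \<Rightarrow> nat \<Rightarrow> nat \<Rightarrow> real" where
  "A \<equiv> N 2"

text \<open>By \<open>sum_B_grow_left\<close> this is the sum over pairs of one-face maps with i and
  n - i edges, weighted by 2i/n. It is the last term of \<open>F_genus\<close> after division by n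
  and by the number y of possible roots of the second face.\<close>

definition K' :: "nat \<Rightarrow> nat \<Rightarrow> nat \<Rightarrow> real" where
  "K' n x y = real (Suc x) * K n (Suc x) y / real n"

lemma K'_grow:
  assumes n: "n > 0"
  shows "real (Suc x) * K' (n + 2) (Suc x) y + real (Suc y) * K' (n + 2) x (Suc y) = 2 * real n * K' n x y"
proof -
  have 1: "real (Suc (Suc x)) * K (n + 2) (Suc (Suc x)) y = (\<Sum>i\<le>n + 2. 2 * real i * (B i (Suc x) * B (n + 2 - i) y))"
    using sum_B_grow_left[where h = "\<lambda>i j. 1" and n = "n + 2" and x = "Suc x" and y = y] by (simp add: K_def)
  have 2: "real (Suc y) * K (n + 2) (Suc x) (Suc y) = (\<Sum>i\<le>n + 2. 2 * real (n + 2 - i) * (B i (Suc x) * B (n + 2 - i) y))"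
    using sum_B_grow_right[where h = "\<lambda>i j. 1" and n = "n + 2" and x = "Suc x" and y = y] by (simp add: K_def)
  have "2 * real i * b + 2 * real (n + 2 - i) * b = 2 * real (n + 2) * b" if "i \<le> n + 2" for i and b :: real
    using that by (simp add: of_nat_diff algebra_simps)
  then have "(\<Sum>i\<le>n + 2. 2 * real i * (B i (Suc x) * B (n + 2 - i) y) + 2 * real (n + 2 - i) * (B i (Suc x) * B (n + 2 - i) y))
      = (\<Sum>i\<le>n + 2. 2 * real (n + 2) * (B i (Suc x) * B (n + 2 - i) y))"
    by (intro sum.cong) simp_all
  then have s: "real (Suc (Suc x)) * K (n + 2) (Suc (Suc x)) y + real (Suc y) * K (n + 2) (Suc x) (Suc y) = 2 * real (n + 2) * K n (Suc x) y"
    unfolding 1 2 unfolding K_def by (simp only: sum.distrib sum_distrib_left)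
  have "real (Suc x) * K' (n + 2) (Suc x) y + real (Suc y) * K' (n + 2) x (Suc y)
      = real (Suc x) * (real (Suc (Suc x)) * K (n + 2) (Suc (Suc x)) y + real (Suc y) * K (n + 2) (Suc x) (Suc y)) / real (n + 2)"
    unfolding K'_def by (simp only: add_divide_distrib distrib_left mult_ac times_divide_eq_right times_divide_eq_left)
  also have "\<dots> = 2 * real n * K' n x y"
    unfolding s K'_def using n by (simp del: of_nat_add of_nat_Suc)
  finally show ?thesis .
qed

text \<open>The change of normalisation costs a factor (n + 2)/n, at most 2 here, while a second map
  with at least one edge offers at least two darts for the leaf. The term with an empty second map
  vanishes.\<close>

lemma K'_le:
  assumes n: "n \<ge> 2"
  shows "K' n x 0 \<le> K' (n + 2) x 1"
proof -
  have "K (n + 2) (Suc x) 1 = (\<Sum>i\<le>n + 2. 2 * real (n + 2 - i) * (B i (Suc x) * B (n + 2 - i) 0))"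
    using sum_B_grow_right[where h = "\<lambda>i j. 1" and n = "n + 2" and x = "Suc x" and y = 0] by (simp add: K_def)
  moreover have "real (n + 2) / real n * (B i (Suc x) * B (n + 2 - i) 0) \<le> 2 * real (n + 2 - i) * (B i (Suc x) * B (n + 2 - i) 0)"
    if "i \<le> n + 2" for i
  proof (cases "i = n + 2")
    case False
    have "real (n + 2) / real n \<le> 2" using n by (simp add: field_simps)
    also have "\<dots> \<le> 2 * real (n + 2 - i)" using that False by simp
    finally show ?thesis by (intro mult_right_mono mult_nonneg_nonneg B_nonneg)
  qed (simp add: B_zero)
  ultimately have "real (n + 2) / real n * K n (Suc x) 0 \<le> K (n + 2) (Suc x) 1"
    unfolding K_def sum_distrib_left by (simp only:) (intro sum_mono, simp)
  then have "K n (Suc x) 0 / real n \<le> K (n + 2) (Suc x) 1 / real (n + 2)"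
    using n by (simp add: field_simps)
  from mult_left_mono[OF this, of "real (Suc x)"] show ?thesis
    unfolding K'_def by simp
qed

lemma K'_nonneg: "K' n x y \<ge> 0"
  unfolding K'_def K_def by (intro divide_nonneg_nonneg mult_nonneg_nonneg sum_nonneg B_nonneg) simp_all

lemma cube_nonneg: "cube m \<ge> 0" by (simp add: cube_def)

lemma lower_nonneg: "lower A n x y \<ge> 0"
  by (simp add: lower_def cube_nonneg N_nonneg)

lemma even_less_six: "even n \<Longrightarrow> n < 6 \<Longrightarrow> n + 2 < 6 \<or> n = (4 :: nat)"
  by presburger

text \<open>The three factors of \<open>cube\<close> telescope, turning the growth factor 2(n - 6)
  into 2n. For even \<open>n\<close> the only critical boundary value is 4, where the new term
  carries \<open>cube 0\<close>, which is zero.\<close>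

lemma lower_grow:
  assumes "even n"
  shows "real (Suc x) * lower A (n + 2) (Suc x) y + real (Suc y) * lower A (n + 2) x (Suc y) = 2 * real n * lower A n x y"
proof (cases "n < 6")
  case True
  then show ?thesis using even_less_six[OF assms] by (auto simp: lower_def cube_def)
next
  case False
  then obtain m where n: "n = m + 6" by (metis add.commute le_Suc_ex not_less)
  have "lower A (n + 2) a b = cube (m + 2) * A (m + 2) a b" for a b by (simp add: lower_def n)
  then have "real (Suc x) * lower A (n + 2) (Suc x) y + real (Suc y) * lower A (n + 2) x (Suc y)
      = cube (m + 2) * (real (Suc x) * A (m + 2) (Suc x) y + real (Suc y) * A (m + 2) x (Suc y))"
    by (simp only: distrib_left mult_ac)
  also have "\<dots> = 2 * real n * lower A n x y"
    unfolding N_growth by (simp add: lower_def n cube_def algebra_simps)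
  finally show ?thesis .
qed

lemma lower_le: "lower A n x 0 \<le> lower A (n + 2) x 1"
proof (cases "n < 6")
  case True
  then show ?thesis using lower_nonneg[of "n + 2" x 1] by (simp add: lower_def)
next
  case False
  then obtain m where n: "n = m + 6" by (metis add.commute le_Suc_ex not_less)
  have "cube m \<le> cube (m + 2)" unfolding cube_def by (intro mult_mono) simp_all
  then have "cube m * A m x 0 \<le> cube (m + 2) * A (m + 2) x 1"
    by (intro mult_mono N_two_faces_le cube_nonneg N_nonneg)
  then show ?thesis by (simp add: lower_def n)
qed

text \<open>The factor is 2g + 1, because \<open>A n x y\<close> counts maps with x + y + 1 leaves
  including the root.\<close>

definition defect :: "nat \<Rightarrow> nat \<Rightarrow> nat \<Rightarrow> real" where
  "defect n x y = ((real n - 2 * real (x + y + 1)) / 3 + 1) * A n x y - lower A n x y - K' n x y"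

text \<open>\<open>F_genus\<close> carries a factor y from rooting the second face at a leaf, so it
  can be divided only if that face has one.\<close>

lemma defect_pos: "y > 0 \<Longrightarrow> n > 0 \<Longrightarrow> defect n x y = 0"
proof -
  assume y: "y > 0" and n: "n > 0"
  let ?w = "(real n - 2 * real (x + y + 1)) / 3 + 1"
  have w: "Suc x + y = x + y + 1" by simp
  have l: "lower F n (Suc x) y = real y * lower A n x y" by (simp add: lower_def)
  have "real n * real y * (?w * A n x y) = real n * real y * (lower A n x y + K' n x y)"
    using F_genus[of n "Suc x" y] n unfolding w l by (simp add: K'_def algebra_simps del: of_nat_Suc)
  then have "?w * A n x y = lower A n x y + K' n x y" using y n by simp
  then show ?thesis by (simp only: defect_def)
qed

text \<open>Inserting leaves keeps the genus factor \<open>?w\<close> fixed. The defect vanishes as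
  soon as the second face has a leaf, so insertions into that face contribute nothing and the defect
  with the second face still leafless inherits the full factor; the nonnegative quantities composing
  it lose a positive share there.\<close>

lemma defect_zero:
  assumes n: "even n" "2 * Suc x \<le> n"
  shows "defect n x 0 = 0"
proof -
  let ?w = "(real n - 2 * real (Suc x)) / 3 + 1"
  have w: "?w \<ge> 0" "?w \<ge> 1"
  proof -
    have "real (2 * Suc x) \<le> real n" using n(2) by (rule of_nat_mono)
    then show "?w \<ge> 0" "?w \<ge> 1" by simp_all
  qed
  \<comment> \<open>The sum of the three nonnegative terms bounds the absolute value of their signed
    combination.\<close>
  define e where "e k = \<bar>defect (n + 2 * k) (x + k) 0\<bar>" for k
  define d where "d k = ?w * A (n + 2 * k) (x + k) 0 + lower A (n + 2 * k) (x + k) 0 + K' (n + 2 * k) (x + k) 0" for k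
  have wk: "(real (n + 2 * k) - 2 * real (x + k + 0 + 1)) / 3 + 1 = ?w" for k by simp
  have df: "defect (n + 2 * k) (x + k) 0 = ?w * A (n + 2 * k) (x + k) 0 - lower A (n + 2 * k) (x + k) 0 - K' (n + 2 * k) (x + k) 0" for k
    unfolding defect_def wk ..
  have df1: "defect (n + 2 * k + 2) (x + k) 1 = ?w * A (n + 2 * k + 2) (x + k) 1 - lower A (n + 2 * k + 2) (x + k) 1 - K' (n + 2 * k + 2) (x + k) 1" for k
    unfolding defect_def by simp
  have S: "n + 2 * Suc k = n + 2 * k + 2" "x + Suc k = Suc (x + k)" for k by simp_all
  have gA: "real (Suc (x + k)) * A (n + 2 * k + 2) (Suc (x + k)) 0 + A (n + 2 * k + 2) (x + k) 1 = 2 * real (n + 2 * k) * A (n + 2 * k) (x + k) 0" for k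
    using N_growth[of "x + k" 2 "n + 2 * k" 0] by simp
  have gL: "real (Suc (x + k)) * lower A (n + 2 * k + 2) (Suc (x + k)) 0 + lower A (n + 2 * k + 2) (x + k) 1 = 2 * real (n + 2 * k) * lower A (n + 2 * k) (x + k) 0" for k
    using lower_grow[of "n + 2 * k" "x + k" 0] n by simp
  have gK: "real (Suc (x + k)) * K' (n + 2 * k + 2) (Suc (x + k)) 0 + K' (n + 2 * k + 2) (x + k) 1 = 2 * real (n + 2 * k) * K' (n + 2 * k) (x + k) 0" for k
    using K'_grow[of "n + 2 * k" "x + k" 0] n by simp
  have "e 0 = 0"
  proof (rule ratio_argument[where d = d and n = n and a = "\<lambda>k. real (Suc (x + k))"])
    fix k
    show "0 \<le> e k" by (simp add: e_def)
    have nn: "0 \<le> ?w * A (n + 2 * k) (x + k) 0" by (intro mult_nonneg_nonneg w N_nonneg)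
    have "\<bar>a - b - c\<bar> \<le> a + b + c" if "0 \<le> a" "0 \<le> b" "0 \<le> c" for a b c :: real
      using that by linarith
    from this[OF nn lower_nonneg K'_nonneg] show "e k \<le> d k"
      unfolding e_def d_def df .
    have "real (Suc (x + k)) * defect (n + 2 * k + 2) (Suc (x + k)) 0 + defect (n + 2 * k + 2) (x + k) 1
        = ?w * (real (Suc (x + k)) * A (n + 2 * k + 2) (Suc (x + k)) 0 + A (n + 2 * k + 2) (x + k) 1)
          - (real (Suc (x + k)) * lower A (n + 2 * k + 2) (Suc (x + k)) 0 + lower A (n + 2 * k + 2) (x + k) 1)
          - (real (Suc (x + k)) * K' (n + 2 * k + 2) (Suc (x + k)) 0 + K' (n + 2 * k + 2) (x + k) 1)"
      unfolding df[of "Suc k", unfolded S] df1 by (simp only: algebra_simps)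
    also have "\<dots> = 2 * real (n + 2 * k) * defect (n + 2 * k) (x + k) 0"
      unfolding gA gL gK df by (simp only: algebra_simps)
    finally have "real (Suc (x + k)) * defect (n + 2 * k + 2) (Suc (x + k)) 0 = 2 * real (n + 2 * k) * defect (n + 2 * k) (x + k) 0"
      using defect_pos[of 1 "n + 2 * k + 2" "x + k"] by simp
    then have "\<bar>real (Suc (x + k)) * defect (n + 2 * k + 2) (Suc (x + k)) 0\<bar> = \<bar>2 * real (n + 2 * k) * defect (n + 2 * k) (x + k) 0\<bar>"
      by (simp only:)
    then show "real (Suc (x + k)) * e (Suc k) = 2 * real (n + 2 * k) * e k"
      unfolding e_def S abs_mult by simp
    have m: "?w * A (n + 2 * k) (x + k) 0 \<le> ?w * A (n + 2 * k + 2) (x + k) 1"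
      by (intro mult_left_mono w N_two_faces_le)
    have "real (Suc (x + k)) * d (Suc k)
        = ?w * (real (Suc (x + k)) * A (n + 2 * k + 2) (Suc (x + k)) 0)
          + real (Suc (x + k)) * lower A (n + 2 * k + 2) (Suc (x + k)) 0
          + real (Suc (x + k)) * K' (n + 2 * k + 2) (Suc (x + k)) 0"
      unfolding d_def S by (simp only: algebra_simps)
    also have "\<dots> = 2 * real (n + 2 * k) * d k
        - (?w * A (n + 2 * k + 2) (x + k) 1 + lower A (n + 2 * k + 2) (x + k) 1 + K' (n + 2 * k + 2) (x + k) 1)"
    proof -
      have A: "real (Suc (x + k)) * A (n + 2 * k + 2) (Suc (x + k)) 0 = 2 * real (n + 2 * k) * A (n + 2 * k) (x + k) 0 - A (n + 2 * k + 2) (x + k) 1"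
        using gA[of k] by linarith
      have L: "real (Suc (x + k)) * lower A (n + 2 * k + 2) (Suc (x + k)) 0 = 2 * real (n + 2 * k) * lower A (n + 2 * k) (x + k) 0 - lower A (n + 2 * k + 2) (x + k) 1"
        using gL[of k] by linarith
      have K: "real (Suc (x + k)) * K' (n + 2 * k + 2) (Suc (x + k)) 0 = 2 * real (n + 2 * k) * K' (n + 2 * k) (x + k) 0 - K' (n + 2 * k + 2) (x + k) 1"
        using gK[of k] by linarith
      show ?thesis unfolding A L K d_def by (simp only: algebra_simps)
    qed
    \<comment> \<open>By \<open>N_two_faces_le\<close>, \<open>lower_le\<close> and
      \<open>K'_le\<close> the part lost to the formerly leafless face is at least
      \<open>d k\<close>.\<close>
    also have "\<dots> \<le> 2 * real (n + 2 * k) * d k - d k"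
      using m lower_le[of "n + 2 * k" "x + k"] K'_le[of "n + 2 * k" "x + k"] n unfolding d_def by simp
    also have "\<dots> = (2 * real (n + 2 * k) - 1) * d k" by (simp only: left_diff_distrib mult_1)
    finally show "real (Suc (x + k)) * d (Suc k) \<le> (2 * real (n + 2 * k) - 1) * d k" .
  qed (use n in simp_all)
  then show ?thesis by (simp add: e_def)
qed

section \<open>Summation over the leaf distributions\<close>

definition two_face_total :: "nat \<Rightarrow> nat \<Rightarrow> real" where
  "two_face_total n m = (\<Sum>x\<le>m. A n x (m - x))"

lemma two_face_total_grow: "real (Suc m) * two_face_total (n + 2) (Suc m) = 2 * real n * two_face_total n m"
proof -
  let ?h = "\<lambda>x. A (n + 2) x (Suc m - x)"
  have "2 * real n * two_face_total n m = (\<Sum>x\<le>m. real (Suc x) * A (n + 2) (Suc x) (m - x) + real (Suc (m - x)) * A (n + 2) x (Suc (m - x)))"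
    unfolding two_face_total_def sum_distrib_left N_growth ..
  also have "\<dots> = (\<Sum>x\<le>m. real (Suc x) * ?h (Suc x)) + (\<Sum>x\<le>m. real (Suc m - x) * ?h x)"
    unfolding sum.distrib by (intro arg_cong2[where f = "(+)"] sum.cong) (simp_all add: Suc_diff_le)
  also have "(\<Sum>x\<le>m. real (Suc x) * ?h (Suc x)) = (\<Sum>x\<le>Suc m. real x * ?h x)"
    by (subst sum.atMost_Suc_shift) simp
  also have "(\<Sum>x\<le>m. real (Suc m - x) * ?h x) = (\<Sum>x\<le>Suc m. real (Suc m - x) * ?h x)"
    by (subst sum.atMost_Suc) simp
  also have "(\<Sum>x\<le>Suc m. real x * ?h x) + (\<Sum>x\<le>Suc m. real (Suc m - x) * ?h x) = (\<Sum>x\<le>Suc m. real (Suc m) * ?h x)"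
    unfolding sum.distrib[symmetric]
    by (intro sum.cong refl) (simp add: of_nat_diff distrib_right[symmetric] del: of_nat_Suc)
  finally show ?thesis unfolding two_face_total_def by (simp only: sum_distrib_left)
qed

text \<open>Three insertions lead from n - 6 to n edges and from m to m + 3 leaves; counting the
  resulting maps with three distinguished leaves gives the binomial coefficient.\<close>

lemma two_face_total_lower:
  assumes n: "even n"
  shows "(\<Sum>x\<le>m. lower A n x (m - x)) = real ((m + 3) choose 3) * two_face_total n (m + 3)"
proof (cases "n < 6")
  case True
  \<comment> \<open>For these \<open>n\<close> the bound on leaves leaves no map with m + 3 leaves
    besides the root; an odd value 5 would escape it.\<close>
  then have "n \<le> 4" using n by presburger
  then have "A n x (m + 3 - x) = 0" if "x \<le> m + 3" for x
    by (intro N_two_faces_zero) (use that in simp)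
  then have "two_face_total n (m + 3) = 0" unfolding two_face_total_def by (intro sum.neutral) simp
  then show ?thesis using True by (simp add: lower_def)
next
  case False
  then obtain j where j: "n = j + 6" by (metis add.commute le_Suc_ex not_less)
  have g: "real (m + 3) * two_face_total (j + 6) (m + 3) = 2 * real (j + 4) * two_face_total (j + 4) (m + 2)"
    "real (m + 2) * two_face_total (j + 4) (m + 2) = 2 * real (j + 2) * two_face_total (j + 2) (m + 1)"
    "real (m + 1) * two_face_total (j + 2) (m + 1) = 2 * real j * two_face_total j m"
    using two_face_total_grow[of "m + 2" "j + 4"] two_face_total_grow[of "m + 1" "j + 2"] two_face_total_grow[of m j] by (simp_all add: eval_nat_numeral)
  have "real ((m + 3) choose 3) * two_face_total n (m + 3) = real (m + 1) * real (m + 2) * (real (m + 3) * two_face_total (j + 6) (m + 3)) / 6"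
    unfolding choose3 j by simp
  also have "\<dots> = 2 * real (j + 4) * real (m + 1) * (real (m + 2) * two_face_total (j + 4) (m + 2)) / 6"
    unfolding g(1) by (simp add: algebra_simps)
  also have "\<dots> = 4 * real (j + 4) * real (j + 2) * (real (m + 1) * two_face_total (j + 2) (m + 1)) / 6"
    unfolding g(2) by (simp add: algebra_simps)
  also have "\<dots> = cube j * two_face_total j m"
    unfolding g(3) cube_def by (simp add: algebra_simps)
  also have "\<dots> = (\<Sum>x\<le>m. lower A n x (m - x))"
    by (simp add: two_face_total_def lower_def j sum_distrib_left)
  finally show ?thesis by simp
qed

text \<open>Exchanging the two maps replaces the weight 2i/n by 2(n - i)/n, and the average is 1.
  The exchange also swaps the leaf numbers, so it needs the sum over all distributions.\<close>

lemma two_face_total_K':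
  assumes n: "n > 0"
  shows "(\<Sum>x\<le>m. K' n x (m - x)) = (\<Sum>x\<le>m. \<Sum>i\<le>n. B i x * B (n - i) (m - x))"
proof -
  let ?s = "\<Sum>x\<le>m. \<Sum>i\<le>n. real i * (B i x * B (n - i) (m - x))"
  have K: "real (Suc x) * K n (Suc x) y = (\<Sum>i\<le>n. 2 * real i * (B i x * B (n - i) y))" for x y
    using sum_B_grow_left[where h = "\<lambda>i j. 1" and n = n and x = x and y = y] by (simp add: K_def)
  have "real n * (\<Sum>x\<le>m. K' n x (m - x)) = 2 * ?s"
    using n unfolding sum_distrib_left K'_def K using n by (simp add: mult.assoc)
  also have "\<dots> = ?s + (\<Sum>x\<le>m. \<Sum>i\<le>n. real (n - i) * (B i x * B (n - i) (m - x)))"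
  proof -
    have "?s = (\<Sum>x\<le>m. \<Sum>i\<le>n. real i * (B i (m - x) * B (n - i) x))"
      by (rule sum_flip[where h = "\<lambda>x y. \<Sum>i\<le>n. real i * (B i x * B (n - i) y)"])
    also have "\<dots> = (\<Sum>x\<le>m. \<Sum>i\<le>n. real (n - i) * (B (n - i) (m - x) * B i x))"
      by (intro sum.cong refl sum_flip[where h = "\<lambda>i j. real i * (B i (m - x) * B j x)" for x])
    finally show ?thesis by (simp only: mult_ac)
  qed
  also have "\<dots> = (\<Sum>x\<le>m. \<Sum>i\<le>n. real n * (B i x * B (n - i) (m - x)))"
    unfolding sum.distrib[symmetric] distrib_right[symmetric] by (intro sum.cong refl) simp
  finally have "real n * (\<Sum>x\<le>m. K' n x (m - x)) = real n * (\<Sum>x\<le>m. \<Sum>i\<le>n. B i x * B (n - i) (m - x))"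
    by (simp only: sum_distrib_left)
  then show ?thesis using n by simp
qed

theorem two_face_total_eq:
  assumes n: "even n" "2 * Suc m \<le> n"
  shows "((real n - 2 * real (Suc m)) / 3 + 1) * two_face_total n m
    = real ((m + 3) choose 3) * two_face_total n (m + 3) + (\<Sum>x\<le>m. \<Sum>i\<le>n. B i x * B (n - i) (m - x))"
proof -
  let ?w = "(real n - 2 * real (Suc m)) / 3 + 1"
  have "?w * A n x (m - x) = lower A n x (m - x) + K' n x (m - x)" if "x \<le> m" for x
  proof -
    have "defect n x (m - x) = 0"
    proof (cases "x = m")
      case True
      then show ?thesis using defect_zero[of n m] n by simp
    next
      case False
      then show ?thesis using that n by (intro defect_pos) simp_all
    qed
    moreover have "x + (m - x) + 1 = Suc m" using that by simp
    ultimately show ?thesis unfolding defect_def by (simp only:)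
  qed
  then have "?w * two_face_total n m = (\<Sum>x\<le>m. lower A n x (m - x) + K' n x (m - x))"
    unfolding two_face_total_def sum_distrib_left by (intro sum.cong) auto
  also have "\<dots> = (\<Sum>x\<le>m. lower A n x (m - x)) + (\<Sum>x\<le>m. K' n x (m - x))" by (rule sum.distrib)
  finally show ?thesis using two_face_total_lower[OF n(1), of m] two_face_total_K'[of n m] n by simp
qed

section \<open>Isomorphism classes\<close>

text \<open>Translates the degree condition of a precubic map into a rotation of order dividing
  three.\<close>

lemma card_orbit_one_three:
  assumes p: "p permutes D" and fin: "finite D"
  shows "card (orbit p d) = 1 \<or> card (orbit p d) = 3 \<longleftrightarrow> p (p (p d)) = d"
proof
  have self: "d \<in> orbit p d" by (rule self_in_orbit[OF p fin])
  note f = face_list_flist[OF self]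
  have dist: "distinct (d # flist p d)" and path: "path p (d # flist p d @ [d])"
    using f(1) by (simp_all add: face_list_def)
  have len: "Suc (length (flist p d)) = card (orbit p d)"
    using distinct_card[OF dist] unfolding f(2) by simp
  assume "card (orbit p d) = 1 \<or> card (orbit p d) = 3"
  then show "p (p (p d)) = d"
  proof
    assume "card (orbit p d) = 1"
    then have "flist p d = []" using len by simp
    then show ?thesis using path by simp
  next
    assume "card (orbit p d) = 3"
    then have "length (flist p d) = 2" using len by simp
    then obtain a b where "flist p d = [a, b]" by (auto simp: numeral_2_eq_2 length_Suc_conv)
    then show ?thesis using path by simp
  qed
next
  assume c: "p (p (p d)) = d"
  have inj: "p a = p b \<longleftrightarrow> a = b" for a b using permutes_inj[OF p] by (simp add: inj_eq)
  have "orbit p d \<subseteq> {d, p d, p (p d)}" by (rule orbit_least) (use c in auto)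
  moreover have "{d, p d, p (p d)} \<subseteq> orbit p d"
    using self_in_orbit[OF p fin, of d] by (auto intro: orbit.intros)
  ultimately have o: "orbit p d = {d, p d, p (p d)}" by blast
  show "card (orbit p d) = 1 \<or> card (orbit p d) = 3"
  proof (cases "p d = d")
    case True
    then show ?thesis unfolding o by simp
  next
    case False
    moreover have "p (p d) \<noteq> d" using c False inj by metis
    moreover have "p (p d) \<noteq> p d" using False inj by metis
    ultimately show ?thesis unfolding o by (simp add: eq_commute)
  qed
qed

lemma card_orbit_one:
  assumes p: "p permutes D" and fin: "finite D"
  shows "card (orbit p d) = 1 \<longleftrightarrow> p d = d" and "p d = d \<Longrightarrow> orbit p d = {d}"
proof -
  have self: "d \<in> orbit p d" by (rule self_in_orbit[OF p fin])
  have o: "orbit p d = {d}" if "p d = d"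
  proof
    show "orbit p d \<subseteq> {d}" by (rule orbit_least) (use that in auto)
    show "{d} \<subseteq> orbit p d" using self by simp
  qed
  then show "p d = d \<Longrightarrow> orbit p d = {d}" .
  show "card (orbit p d) = 1 \<longleftrightarrow> p d = d"
  proof
    assume "card (orbit p d) = 1"
    then obtain a where a: "orbit p d = {a}" by (auto simp: card_1_singleton_iff)
    have "p d \<in> orbit p d" by (rule orbit.base)
    then show "p d = d" using self a by simp
  qed (simp add: o)
qed

lemma orbits_partition:
  assumes p: "p permutes D" and fin: "finite D"
  shows "\<Union> (orbit p ` D) = D" "finite (orbit p ` D)"
    "c \<in> orbit p ` D \<Longrightarrow> c' \<in> orbit p ` D \<Longrightarrow> c \<noteq> c' \<Longrightarrow> c \<inter> c' = {}"
    "(\<Sum>c\<in>orbit p ` D. card c) = card D"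
proof -
  show U: "\<Union> (orbit p ` D) = D"
    using orbit_in[OF p] self_in_orbit[OF p fin] by blast
  show f: "finite (orbit p ` D)" using fin by simp
  show d: "c \<inter> c' = {}" if "c \<in> orbit p ` D" "c' \<in> orbit p ` D" "c \<noteq> c'" for c c'
    using that orbit_eq[OF p fin] by blast
  have "finite c" if "c \<in> orbit p ` D" for c
    using that U fin by (metis Union_upper finite_subset)
  then have "card (\<Union> (orbit p ` D)) = (\<Sum>c\<in>orbit p ` D. card c)"
    using d by (intro card_Union_disjoint) (auto simp: pairwise_def disjnt_def)
  then show "(\<Sum>c\<in>orbit p ` D. card c) = card D" unfolding U by simp
qed

section \<open>Euler's formula for precubic maps\<close>

lemma card_edges:
  assumes cp: "cubic_pair D rt op" and fin: "finite D"
  shows "2 * card (orbit op ` D) = card D"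
proof -
  note c = cubic_pairD[OF cp]
  have "card v = 2" if v: "v \<in> orbit op ` D" for v
  proof -
    obtain d where d: "d \<in> D" "v = orbit op d" using v by blast
    have "orbit op d \<subseteq> {d, op d}" by (rule orbit_least) (use c(5)[OF d(1)] in auto)
    moreover have "{d, op d} \<subseteq> orbit op d"
      using self_in_orbit[OF c(2) fin, of d] by (auto intro: orbit.intros)
    ultimately have "v = {d, op d}" using d by blast
    then show ?thesis using c(4)[OF d(1)] by auto
  qed
  then have "(\<Sum>v\<in>orbit op ` D. card v) = (\<Sum>v\<in>orbit op ` D. 2)" by (rule sum.cong[OF refl])
  then show ?thesis using orbits_partition(4)[OF c(2) fin] by simp
qed

lemma singleton_orbits:
  assumes p: "p permutes D" and fin: "finite D"
  shows "{v \<in> orbit p ` D. card v = 1} = (\<lambda>d. {d}) ` {d \<in> D. p d = d}"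
proof (intro subset_antisym subsetI)
  fix v assume "v \<in> {v \<in> orbit p ` D. card v = 1}"
  then obtain d where d: "d \<in> D" "v = orbit p d" "card (orbit p d) = 1" by blast
  then show "v \<in> (\<lambda>d. {d}) ` {d \<in> D. p d = d}" using card_orbit_one[OF p fin, of d] by simp
next
  fix v assume "v \<in> (\<lambda>d. {d}) ` {d \<in> D. p d = d}"
  then obtain d where d: "d \<in> D" "v = {d}" "p d = d" by blast
  then have "v \<in> orbit p ` D" using card_orbit_one(2)[OF p fin d(3)] by blast
  moreover have "card v = 1" using d(2) by simp
  ultimately show "v \<in> {v \<in> orbit p ` D. card v = 1}" by blast
qed

text \<open>Each vertex of degree one falls two darts short of three.\<close>

lemma card_vertices:
  assumes cp: "cubic_pair D rt op" and fin: "finite D"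
  shows "3 * card (orbit rt ` D) = card D + 2 * card {d \<in> D. rt d = d}"
proof -
  note c = cubic_pairD[OF cp]
  let ?V = "orbit rt ` D"
  have "3 = card v + (if card v = 1 then 2 else 0)" if v: "v \<in> ?V" for v
  proof -
    obtain d where d: "d \<in> D" "v = orbit rt d" using v by blast
    then have "card v = 1 \<or> card v = 3" using card_orbit_one_three[OF c(1) fin, of d] c(7)[of d] by blast
    then show ?thesis by auto
  qed
  then have "(\<Sum>v\<in>?V. 3) = (\<Sum>v\<in>?V. card v + (if card v = 1 then 2 else 0))" by (rule sum.cong[OF refl])
  also have "\<dots> = card D + (\<Sum>v\<in>?V. if card v = 1 then 2 else 0)"
    unfolding sum.distrib orbits_partition(4)[OF c(1) fin] ..
  also have "(\<Sum>v\<in>?V. if card v = 1 then 2 else 0) = (\<Sum>v\<in>{v \<in> ?V. card v = 1}. 2)"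
    by (rule sum.inter_filter[symmetric]) (use fin in simp)
  also have "\<dots> = 2 * card {d \<in> D. rt d = d}"
    unfolding singleton_orbits[OF c(1) fin] by (simp add: card_image)
  finally show ?thesis by simp
qed

lemma connected_pair_rtrancl:
  assumes "\<And>d. d \<in> D \<Longrightarrow> rt d \<in> D \<and> op d \<in> D"
  shows "connected_pair D rt op \<longleftrightarrow>
    (\<forall>x\<in>D. \<forall>y\<in>D. (x, y) \<in> ({(d, rt d) | d. d \<in> D} \<union> {(d, op d) | d. d \<in> D})\<^sup>*)"
    (is "_ \<longleftrightarrow> (\<forall>x\<in>D. \<forall>y\<in>D. (x, y) \<in> ?r\<^sup>*)")
proof
  assume con: "connected_pair D rt op"
  show "\<forall>x\<in>D. \<forall>y\<in>D. (x, y) \<in> ?r\<^sup>*"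
  proof (intro ballI)
    fix x y assume x: "x \<in> D" and y: "y \<in> D"
    let ?S = "{y \<in> D. (x, y) \<in> ?r\<^sup>*}"
    have cl: "rt d \<in> ?S \<and> op d \<in> ?S" if "d \<in> ?S" for d
    proof -
      have d: "d \<in> D" "(x, d) \<in> ?r\<^sup>*" using that by blast+
      have "(d, rt d) \<in> ?r" "(d, op d) \<in> ?r" using d by blast+
      then show ?thesis using d assms by (blast intro: rtrancl_into_rtrancl)
    qed
    have "?S = D"
    proof (rule connectedD[OF con])
      show "?S \<noteq> {}" using x by blast
      show "rt ` ?S \<subseteq> ?S" "op ` ?S \<subseteq> ?S" using cl by blast+
    qed blast
    then show "(x, y) \<in> ?r\<^sup>*" using y by blast
  qed
next
  assume reach: "\<forall>x\<in>D. \<forall>y\<in>D. (x, y) \<in> ?r\<^sup>*"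
  show "connected_pair D rt op"
    unfolding connected_pair_def
  proof (intro allI impI, elim conjE)
    fix S assume S: "S \<subseteq> D" "S \<noteq> {}" "rt ` S \<subseteq> S" "op ` S \<subseteq> S"
    then obtain a where a: "a \<in> S" by blast
    have "y \<in> S" if "y \<in> D" for y
    proof -
      have "(a, y) \<in> ?r\<^sup>*" using reach a S(1) that by blast
      then show ?thesis by induction (use a S in blast)+
    qed
    then show "S = D" using S(1) by blast
  qed
qed

lemma is_precubic_iff:
  "is_precubic m \<longleftrightarrow> finite (darts m) \<and> cubic_pair (darts m) (rot m) (opp m) \<and>
     connected_pair (darts m) (rot m) (opp m) \<and> root m \<in> darts m \<and> rot m (root m) = root m"
proof -
  let ?D = "darts m"
  have con: "connected_pair ?D (rot m) (opp m) \<longleftrightarrow> (\<forall>x\<in>?D. \<forall>y\<in>?D.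
      (x, y) \<in> ({(d, rot m d) | d. d \<in> ?D} \<union> {(d, opp m d) | d. d \<in> ?D})\<^sup>*)"
    if "rot m permutes ?D" "opp m permutes ?D"
    by (rule connected_pair_rtrancl) (use that in \<open>simp add: permutes_in_image\<close>)
  have deg: "(\<forall>v\<in>vertices m. card v = 1 \<or> card v = 3) \<longleftrightarrow> (\<forall>d\<in>?D. rot m (rot m (rot m d)) = d)"
    if "rot m permutes ?D" "finite ?D"
    unfolding vertices_def ball_simps card_orbit_one_three[OF that] ..
  show ?thesis
  proof
    assume p: "is_precubic m"
    then have r: "rot m permutes ?D" "opp m permutes ?D" "finite ?D"
      by (simp_all add: is_precubic_def is_rooted_map_def)
    show "finite ?D \<and> cubic_pair ?D (rot m) (opp m) \<and>
     connected_pair ?D (rot m) (opp m) \<and> root m \<in> ?D \<and> rot m (root m) = root m"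
      using p unfolding con[OF r(1,2)] is_precubic_def deg[OF r(1,3)] card_orbit_one(1)[OF r(1,3)]
        is_rooted_map_def cubic_pair_def by blast
  next
    assume p: "finite ?D \<and> cubic_pair ?D (rot m) (opp m) \<and>
     connected_pair ?D (rot m) (opp m) \<and> root m \<in> ?D \<and> rot m (root m) = root m"
    then have r: "rot m permutes ?D" "opp m permutes ?D" "finite ?D"
      by (simp_all add: cubic_pair_def)
    show "is_precubic m"
      using p unfolding con[OF r(1,2)] is_precubic_def deg[OF r(1,3)] card_orbit_one(1)[OF r(1,3)]
        is_rooted_map_def cubic_pair_def by blast
  qed
qed

lemma card_leaves_pmaps:
  assumes m: "(rt, op, r) \<in> pmaps D k x y" and fin: "finite D"
  shows "card {d \<in> D. rt d = d} = x + y + 1"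
proof -
  have cp: "cubic_pair D rt op" and r: "r \<in> D" and x: "card {d \<in> orbit (rt \<circ> op) r. rt d = d} = Suc x"
    and y: "card {d \<in> D - orbit (rt \<circ> op) r. rt d = d} = y"
    using m by (auto simp: pmaps_def)
  let ?O = "orbit (rt \<circ> op) r"
  have sub: "?O \<subseteq> D" by (rule orbit_in[OF cubic_pair_face[OF cp] r])
  have "{d \<in> D. rt d = d} = {d \<in> ?O. rt d = d} \<union> {d \<in> D - ?O. rt d = d}" using sub by blast
  moreover have "card ({d \<in> ?O. rt d = d} \<union> {d \<in> D - ?O. rt d = d}) = card {d \<in> ?O. rt d = d} + card {d \<in> D - ?O. rt d = d}"
    by (rule card_Un_disjoint) (use fin finite_subset[OF sub fin] in auto)
  ultimately show ?thesis using x y by simp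
qed

text \<open>Inserting 3V = 2n + 2L, where L = x + y + 1 counts all vertices of degree one, into V -
  n + f = 2 - 2g gives the numerical condition. Fixing the genus thus means fixing the number of
  leaves.\<close>

lemma precubic_maps_iff:
  "m \<in> precubic_maps g n f \<longleftrightarrow> darts m = {..<2 * n} \<and>
     (\<exists>x y. (rot m, opp m, root m) \<in> pmaps {..<2 * n} f x y \<and> n + 6 = 2 * (x + y + 1) + 3 * f + 6 * g)"
proof -
  let ?D = "{..<2 * n}"
  have euler: "has_genus m g \<longleftrightarrow> n + 6 = 2 * (x + y + 1) + 3 * f + 6 * g"
    if "darts m = ?D" "(rot m, opp m, root m) \<in> pmaps ?D f x y" for x y
  proof -
    have cp: "cubic_pair ?D (rot m) (opp m)" and f: "card (faces m) = f"
      using that by (auto simp: pmaps_def faces_def)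
    have e: "card (edges m) = n" using card_edges[OF cp] by (simp add: edges_def that)
    have v: "3 * card (vertices m) = 2 * n + 2 * (x + y + 1)"
      using card_vertices[OF cp] card_leaves_pmaps[OF that(2)] by (simp add: vertices_def that)
    show ?thesis unfolding has_genus_def e f using v by presburger
  qed
  show ?thesis
  proof
    assume m: "m \<in> precubic_maps g n f"
    then have D: "darts m = ?D" and p: "is_precubic m" and f: "card (faces m) = f" and g: "has_genus m g"
      by (simp_all add: precubic_maps_def)
    have q: "cubic_pair ?D (rot m) (opp m)" "connected_pair ?D (rot m) (opp m)" "root m \<in> ?D" "rot m (root m) = root m"
      using p unfolding is_precubic_iff D by blast+
    let ?O = "orbit (rot m \<circ> opp m) (root m)"
    have "finite ?O" using finite_subset[OF orbit_in[OF cubic_pair_face[OF q(1)] q(3)]] by simp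
    moreover have "root m \<in> {d \<in> ?O. rot m d = d}"
      using q(4) self_in_orbit[OF cubic_pair_face[OF q(1)]] by simp
    ultimately have "card {d \<in> ?O. rot m d = d} > 0" by (auto simp: card_gt_0_iff)
    then obtain x where x: "card {d \<in> ?O. rot m d = d} = Suc x" by (metis gr0_implies_Suc)
    have pm: "(rot m, opp m, root m) \<in> pmaps ?D f x (card {d \<in> ?D - ?O. rot m d = d})"
      unfolding pmaps_def mem_Collect_eq prod.case using q x f by (simp add: faces_def D)
    then show "darts m = ?D \<and> (\<exists>x y. (rot m, opp m, root m) \<in> pmaps ?D f x y \<and> n + 6 = 2 * (x + y + 1) + 3 * f + 6 * g)"
      using D g euler by blast
  next
    assume "darts m = ?D \<and> (\<exists>x y. (rot m, opp m, root m) \<in> pmaps ?D f x y \<and> n + 6 = 2 * (x + y + 1) + 3 * f + 6 * g)"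
    then obtain x y where D: "darts m = ?D" and pm: "(rot m, opp m, root m) \<in> pmaps ?D f x y"
      and g: "n + 6 = 2 * (x + y + 1) + 3 * f + 6 * g" by blast
    have q: "cubic_pair ?D (rot m) (opp m)" "connected_pair ?D (rot m) (opp m)" "root m \<in> ?D" "rot m (root m) = root m"
      "card (faces m) = f"
      using pm unfolding pmaps_def faces_def D by blast+
    have "is_precubic m" unfolding is_precubic_iff D using q by simp
    moreover have "has_genus m g" using euler[OF D pm] g by blast
    moreover have "card (edges m) = n" using card_edges[OF q(1)] by (simp add: edges_def D)
    ultimately show "m \<in> precubic_maps g n f" using D q(5) by (simp add: precubic_maps_def)
  qed
qed

lemma card_leaves:
  assumes m: "(rot m, opp m, root m) \<in> pmaps (darts m) k x y" and fin: "finite (darts m)"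
  shows "card (leaves m) = x + y" "leaves m \<subseteq> Pow (darts m)"
proof -
  let ?D = "darts m" and ?F = "{d \<in> darts m. rot m d = d}"
  have rt: "rot m permutes ?D" and r: "root m \<in> ?F"
    using m by (auto simp: pmaps_def cubic_pair_def)
  have "leaves m = {v \<in> {v \<in> orbit (rot m) ` ?D. card v = 1}. root m \<notin> v}"
    by (auto simp: leaves_def vertices_def)
  also have "\<dots> = (\<lambda>d. {d}) ` (?F - {root m})"
    unfolding singleton_orbits[OF rt fin] by auto
  finally have l: "leaves m = (\<lambda>d. {d}) ` (?F - {root m})" .
  then have "card (leaves m) = card (?F - {root m})" by (simp add: card_image)
  also have "\<dots> = x + y" using r card_leaves_pmaps[OF m fin] by simp
  finally show "card (leaves m) = x + y" .
  show "leaves m \<subseteq> Pow ?D" unfolding l by auto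
qed

text \<open>The classes are the orbits of the symmetric group on \<open>D\<close>; as the action is
  free, each of them has as many elements as the group.\<close>

lemma card_free_quotient:
  fixes act :: "('d \<Rightarrow> 'd) \<Rightarrow> 'x \<Rightarrow> 'x"
  assumes fin: "finite X" "finite D"
    and closed: "\<And>\<pi> x. \<pi> permutes D \<Longrightarrow> x \<in> X \<Longrightarrow> act \<pi> x \<in> X"
    and id: "\<And>x. act id x = x"
    and comp: "\<And>\<pi> \<sigma> x. \<pi> permutes D \<Longrightarrow> \<sigma> permutes D \<Longrightarrow> act \<pi> (act \<sigma> x) = act (\<pi> \<circ> \<sigma>) x"
    and free: "\<And>\<pi> \<sigma> x. \<pi> permutes D \<Longrightarrow> \<sigma> permutes D \<Longrightarrow> x \<in> X \<Longrightarrow> act \<pi> x = act \<sigma> x \<Longrightarrow> \<pi> = \<sigma>"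
    and rel: "\<And>x y. x \<in> X \<Longrightarrow> y \<in> X \<Longrightarrow> (x, y) \<in> R \<longleftrightarrow> (\<exists>\<pi>. \<pi> permutes D \<and> y = act \<pi> x)"
  shows "card X = fact (card D) * card (X // Restr R X)"
proof -
  let ?R = "Restr R X"
  have R: "(x, y) \<in> ?R \<longleftrightarrow> x \<in> X \<and> (\<exists>\<pi>. \<pi> permutes D \<and> y = act \<pi> x)" for x y
    using rel closed by auto
  have equiv: "equiv X ?R"
  proof (rule equivI)
    show "?R \<subseteq> X \<times> X" by blast
    show "refl_on X ?R"
    proof (rule refl_onI)
      fix x assume "x \<in> X"
      moreover have "x = act id x" by (simp add: id)
      ultimately show "(x, x) \<in> ?R" unfolding R using permutes_id by blast
    qed
    show "sym ?R"
    proof (rule symI)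
      fix x y assume "(x, y) \<in> ?R"
      then obtain \<pi> where x: "x \<in> X" and \<pi>: "\<pi> permutes D" "y = act \<pi> x" unfolding R by blast
      have i: "inv \<pi> permutes D" by (rule permutes_inv[OF \<pi>(1)])
      have "act (inv \<pi>) y = act (inv \<pi> \<circ> \<pi>) x" unfolding \<pi>(2) by (rule comp[OF i \<pi>(1)])
      then have "x = act (inv \<pi>) y" using permutes_inv_o(2)[OF \<pi>(1)] by (simp add: id)
      moreover have "y \<in> X" unfolding \<pi>(2) by (rule closed[OF \<pi>(1) x])
      ultimately show "(y, x) \<in> ?R" unfolding R using i by blast
    qed
    show "trans ?R"
    proof (rule transI)
      fix x y z assume "(x, y) \<in> ?R" "(y, z) \<in> ?R"
      then obtain \<pi> \<sigma> where x: "x \<in> X" and \<pi>: "\<pi> permutes D" "y = act \<pi> x" and \<sigma>: "\<sigma> permutes D" "z = act \<sigma> y"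
        unfolding R by blast
      have "z = act (\<sigma> \<circ> \<pi>) x" unfolding \<sigma>(2) \<pi>(2) by (rule comp[OF \<sigma>(1) \<pi>(1)])
      then show "(x, z) \<in> ?R" unfolding R using x permutes_compose[OF \<pi>(1) \<sigma>(1)] by blast
    qed
  qed
  have "card c = fact (card D)" if c: "c \<in> X // ?R" for c
  proof -
    obtain x where x: "x \<in> X" "c = ?R `` {x}" using c by (auto elim: quotientE)
    have "c = (\<lambda>\<pi>. act \<pi> x) ` {\<pi>. \<pi> permutes D}"
      unfolding x(2) Image_singleton R using x(1) by blast
    moreover have "inj_on (\<lambda>\<pi>. act \<pi> x) {\<pi>. \<pi> permutes D}"
      by (rule inj_onI) (use free x(1) in blast)
    ultimately show ?thesis using card_permutations[OF refl fin(2)] by (simp add: card_image)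
  qed
  moreover have "finite (X // ?R)" by (rule finite_quotient) (use fin equiv in auto)
  moreover have "finite (\<Union> (X // ?R))" unfolding Union_quotient[OF equiv] by (rule fin)
  moreover have "c \<inter> c' = {}" if "c \<in> X // ?R" "c' \<in> X // ?R" "c \<noteq> c'" for c c'
    using quotient_disj[OF equiv that(1,2)] that(3) by blast
  ultimately have "fact (card D) * card (X // ?R) = card (\<Union> (X // ?R))" by (intro card_partition)
  then show ?thesis unfolding Union_quotient[OF equiv] by simp
qed

section \<open>The relabelling action on precubic maps\<close>

definition relabel :: "(nat \<Rightarrow> nat) \<Rightarrow> nat rooted_map \<Rightarrow> nat rooted_map" where
  "relabel \<pi> m = \<lparr>darts = darts m, rot = conjp \<pi> (rot m), opp = conjp \<pi> (opp m), root = \<pi> (root m)\<rparr>"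

lemma relabel_simps [simp]:
  "darts (relabel \<pi> m) = darts m" "rot (relabel \<pi> m) = conjp \<pi> (rot m)"
  "opp (relabel \<pi> m) = conjp \<pi> (opp m)" "root (relabel \<pi> m) = \<pi> (root m)"
  by (simp_all add: relabel_def)

lemma relabel_id: "relabel id m = m"
  by (cases m) (simp add: relabel_def conjp_def)

lemma conjp_conjp: "bij \<pi> \<Longrightarrow> bij \<sigma> \<Longrightarrow> conjp \<pi> (conjp \<sigma> f) = conjp (\<pi> \<circ> \<sigma>) f"
  by (simp add: conjp_def o_inv_distrib comp_assoc)

lemma relabel_comp: "bij \<pi> \<Longrightarrow> bij \<sigma> \<Longrightarrow> relabel \<pi> (relabel \<sigma> m) = relabel (\<pi> \<circ> \<sigma>) m"
  by (simp add: relabel_def conjp_conjp)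

lemma relabel_precubic:
  assumes \<pi>: "\<pi> permutes {..<2 * n}" and m: "m \<in> precubic_maps g n f"
  shows "relabel \<pi> m \<in> precubic_maps g n f"
proof -
  have "(conjp \<pi> (rot m), conjp \<pi> (opp m), \<pi> (root m)) \<in> pmaps {..<2 * n} f x y"
    if "(rot m, opp m, root m) \<in> pmaps {..<2 * n} f x y" for x y
    using pmaps_conjp[OF permutes_bij[OF \<pi>] that] unfolding permutes_image[OF \<pi>] .
  then show ?thesis using m unfolding precubic_maps_iff relabel_simps by blast
qed

lemma precubicD:
  assumes "m \<in> precubic_maps g n f"
  shows "darts m = {..<2 * n}" "cubic_pair {..<2 * n} (rot m) (opp m)"
    "connected_pair {..<2 * n} (rot m) (opp m)" "root m \<in> {..<2 * n}"
  using assms unfolding precubic_maps_iff pmaps_def by blast+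

text \<open>Rooted maps are rigid: the darts on which two relabellings agree include the root and
  are closed under both permutations, so by connectivity they are all darts.\<close>

lemma relabel_free:
  assumes \<pi>: "\<pi> permutes {..<2 * n}" and \<sigma>: "\<sigma> permutes {..<2 * n}" and m: "m \<in> precubic_maps g n f"
    and eq: "relabel \<pi> m = relabel \<sigma> m"
  shows "\<pi> = \<sigma>"
proof -
  let ?D = "{..<2 * n}"
  note p = precubicD[OF m]
  have e: "conjp \<pi> (rot m) = conjp \<sigma> (rot m)" "conjp \<pi> (opp m) = conjp \<sigma> (opp m)" "\<pi> (root m) = \<sigma> (root m)"
    using arg_cong[OF eq, of rot] arg_cong[OF eq, of opp] arg_cong[OF eq, of root] by simp_all
  let ?S = "{d \<in> ?D. \<pi> d = \<sigma> d}"
  have step: "\<pi> (h d) = \<sigma> (h d)" if "\<pi> d = \<sigma> d" "conjp \<pi> h = conjp \<sigma> h" for h d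
    using conjp_apply[OF permutes_bij[OF \<pi>], of h d] conjp_apply[OF permutes_bij[OF \<sigma>], of h d] that by simp
  have cl: "rot m d \<in> ?S \<and> opp m d \<in> ?S" if "d \<in> ?S" for d
    using that step[OF _ e(1)] step[OF _ e(2)] cubic_pairD(3,6)[OF p(2)] by blast
  have "?S = ?D"
  proof (rule connectedD[OF p(3)])
    show "?S \<noteq> {}" using p(4) e(3) by blast
    show "rot m ` ?S \<subseteq> ?S" "opp m ` ?S \<subseteq> ?S" using cl by blast+
  qed blast
  then have "\<pi> d = \<sigma> d" if "d \<in> ?D" for d using that by blast
  moreover have "\<pi> d = \<sigma> d" if "d \<notin> ?D" for d using that \<pi> \<sigma> by (simp add: permutes_not_in)
  ultimately show ?thesis by blast
qed

text \<open>An isomorphism is constrained only on the darts. Extended by the identity it becomes a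
  permutation of all numbers, and conjugation by it also respects that both maps fix everything
  outside the darts.\<close>

lemma is_map_iso_relabel:
  assumes m: "m \<in> precubic_maps g n f" and m': "m' \<in> precubic_maps g n f"
    and h: "is_map_iso h m m'"
  obtains \<pi> where "\<pi> permutes {..<2 * n}" "m' = relabel \<pi> m" "\<And>d. d \<in> {..<2 * n} \<Longrightarrow> \<pi> d = h d"
proof -
  let ?D = "{..<2 * n}"
  note p = precubicD[OF m] and p' = precubicD[OF m']
  note c = cubic_pairD[OF p(2)] and c' = cubic_pairD[OF p'(2)]
  define \<pi> where "\<pi> = restr ?D h"
  have hb: "bij_betw h ?D ?D" and hc: "\<And>d. d \<in> ?D \<Longrightarrow> h (rot m d) = rot m' (h d) \<and> h (opp m d) = opp m' (h d)"
    and hr: "h (root m) = root m'"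
    using h p(1) p'(1) by (auto simp: is_map_iso_def)
  have \<pi>h: "\<pi> d = h d" if "d \<in> ?D" for d using that by (simp add: \<pi>_def restr_def)
  have "bij_betw \<pi> ?D ?D" using hb bij_betw_cong[of ?D \<pi> h ?D] \<pi>h by blast
  then have \<pi>: "\<pi> permutes ?D" by (rule bij_imp_permutes) (simp add: \<pi>_def restr_def)
  have bij: "bij \<pi>" by (rule permutes_bij[OF \<pi>])
  have eq: "k' = conjp \<pi> k" if k: "k permutes ?D" and k': "k' permutes ?D" and hk: "\<And>d. d \<in> ?D \<Longrightarrow> h (k d) = k' (h d)" for k k'
  proof
    fix d
    obtain a where a: "d = \<pi> a" using bij by (metis bij_pointE)
    show "k' d = conjp \<pi> k d"
    proof (cases "a \<in> ?D")
      case True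
      moreover have "k a \<in> ?D" using True k by (metis permutes_in_image)
      ultimately show ?thesis unfolding a conjp_apply[OF bij] using hk[OF True] \<pi>h by metis
    next
      case False
      moreover have "\<pi> a \<notin> ?D" using False \<pi> by (metis permutes_in_image)
      ultimately show ?thesis unfolding a conjp_apply[OF bij] using k k' \<pi> by (simp add: permutes_not_in)
    qed
  qed
  have "m' = relabel \<pi> m"
    using eq[OF c(1) c'(1)] eq[OF c(2) c'(2)] hc hr \<pi>h[OF p(4)] p(1) p'(1)
    by (cases m') (simp add: relabel_def)
  then show ?thesis using that \<pi> \<pi>h by blast
qed

lemma relabel_is_map_iso:
  assumes \<pi>: "\<pi> permutes darts m"
  shows "is_map_iso \<pi> m (relabel \<pi> m)"
  unfolding is_map_iso_def relabel_simps conjp_apply[OF permutes_bij[OF \<pi>]]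
  using permutes_imp_bij[OF \<pi>] by simp

lemma map_iso_iff:
  assumes m: "m \<in> precubic_maps g n f" and m': "m' \<in> precubic_maps g n f"
  shows "(m, m') \<in> map_iso_rel \<longleftrightarrow> (\<exists>\<pi>. \<pi> permutes {..<2 * n} \<and> m' = relabel \<pi> m)"
proof
  assume "(m, m') \<in> map_iso_rel"
  then obtain h where "is_map_iso h m m'" by (auto simp: map_iso_rel_def)
  then show "\<exists>\<pi>. \<pi> permutes {..<2 * n} \<and> m' = relabel \<pi> m"
    by (rule is_map_iso_relabel[OF m m']) blast
next
  assume "\<exists>\<pi>. \<pi> permutes {..<2 * n} \<and> m' = relabel \<pi> m"
  then show "(m, m') \<in> map_iso_rel"
    using relabel_is_map_iso[of _ m] precubicD(1)[OF m] by (auto simp: map_iso_rel_def)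
qed

abbreviation triple :: "nat rooted_map \<Rightarrow> (nat \<Rightarrow> nat) \<times> (nat \<Rightarrow> nat) \<times> nat" where
  "triple m \<equiv> (rot m, opp m, root m)"

lemma inj_on_triple: "inj_on triple (precubic_maps g n f)"
proof (rule inj_onI)
  fix m m' assume m: "m \<in> precubic_maps g n f" "m' \<in> precubic_maps g n f" and "triple m = triple m'"
  then show "m = m'" using precubicD(1)[OF m(1)] precubicD(1)[OF m(2)] by (cases m; cases m') simp
qed

lemma triple_image:
  "triple ` precubic_maps g n f
    = (\<Union>(x, y)\<in>{(x, y). n + 6 = 2 * (x + y + 1) + 3 * f + 6 * g}. pmaps {..<2 * n} f x y)" (is "_ = ?U")
proof (intro subset_antisym subsetI)
  fix t assume "t \<in> triple ` precubic_maps g n f"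
  then obtain m where m: "m \<in> precubic_maps g n f" "t = triple m" by (rule imageE) blast
  then obtain x y where "triple m \<in> pmaps {..<2 * n} f x y" "n + 6 = 2 * (x + y + 1) + 3 * f + 6 * g"
    unfolding precubic_maps_iff by blast
  then show "t \<in> ?U" unfolding m(2) by (intro UN_I[of "(x, y)"]) simp_all
next
  fix t assume "t \<in> ?U"
  then obtain x y where xy: "n + 6 = 2 * (x + y + 1) + 3 * f + 6 * g" "t \<in> pmaps {..<2 * n} f x y" by blast
  obtain rt op r where t: "t = (rt, op, r)" by (cases t)
  let ?m = "\<lparr>darts = {..<2 * n}, rot = rt, opp = op, root = r\<rparr>"
  have "triple ?m \<in> pmaps {..<2 * n} f x y" using xy(2) unfolding t by simp
  then have "?m \<in> precubic_maps g n f" unfolding precubic_maps_iff using xy(1)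
    by (intro conjI exI) simp_all
  then show "t \<in> triple ` precubic_maps g n f" using t by (intro image_eqI[of _ _ ?m]) simp_all
qed

lemma finite_leaf_pairs: "finite {(x, y). n + 6 = 2 * (x + y + 1) + 3 * f + 6 * (g :: nat)}"
  by (rule finite_subset[of _ "{..n + 6} \<times> {..n + 6}"]) auto

lemma finite_precubic_maps: "finite (precubic_maps g n f)"
proof -
  have "finite (triple ` precubic_maps g n f)"
    unfolding triple_image using finite_leaf_pairs by (auto intro: finite_pmaps)
  then show ?thesis using inj_on_triple finite_imageD by blast
qed

lemma card_precubic_maps:
  "card (precubic_maps g n f)
    = (\<Sum>(x, y)\<in>{(x, y). n + 6 = 2 * (x + y + 1) + 3 * f + 6 * g}. card (pmaps {..<2 * n} f x y))"
proof -
  have "card (precubic_maps g n f) = card (triple ` precubic_maps g n f)"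
    by (rule card_image[OF inj_on_triple, symmetric])
  also have "\<dots> = (\<Sum>p\<in>{(x, y). n + 6 = 2 * (x + y + 1) + 3 * f + 6 * g}. card (case p of (x, y) \<Rightarrow> pmaps {..<2 * n} f x y))"
    unfolding triple_image
  proof (rule card_UN_disjoint[OF finite_leaf_pairs])
    show "\<forall>p\<in>{(x, y). n + 6 = 2 * (x + y + 1) + 3 * f + 6 * g}. finite (case p of (x, y) \<Rightarrow> pmaps {..<2 * n} f x y)"
      by (auto intro: finite_pmaps)
    have "(case p of (x, y) \<Rightarrow> pmaps {..<2 * n} f x y) \<inter> (case q of (x, y) \<Rightarrow> pmaps {..<2 * n} f x y) = {}"
      if "p \<noteq> q" for p q
    proof -
      obtain x y x' y' where "p = (x, y)" "q = (x', y')" by (cases p; cases q)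
      then show ?thesis using that unfolding pmaps_def by auto
    qed
    then show "\<forall>p\<in>{(x, y). n + 6 = 2 * (x + y + 1) + 3 * f + 6 * g}. \<forall>q\<in>{(x, y). n + 6 = 2 * (x + y + 1) + 3 * f + 6 * g}.
        p \<noteq> q \<longrightarrow> (case p of (x, y) \<Rightarrow> pmaps {..<2 * n} f x y) \<inter> (case q of (x, y) \<Rightarrow> pmaps {..<2 * n} f x y) = {}"
      by blast
  qed
  finally show ?thesis by (simp add: case_prod_beta)
qed

lemma fact_num_precubic: "fact (2 * n) * num_precubic g n f = card (precubic_maps g n f)"
proof -
  have "card (precubic_maps g n f) = fact (card {..<2 * n}) * card (precubic_maps g n f // Restr map_iso_rel (precubic_maps g n f))"
    by (rule card_free_quotient[where act = relabel])
      (simp_all add: finite_precubic_maps relabel_precubic relabel_id relabel_comp permutes_bij map_iso_iff, rule relabel_free)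
  then show ?thesis by (simp add: num_precubic_def)
qed

lemma leaves_relabel:
  assumes \<pi>: "bij \<pi>" "\<pi> ` darts m = darts m"
  shows "leaves (relabel \<pi> m) = (`) \<pi> ` leaves m"
proof -
  have inj: "inj \<pi>" by (rule bij_is_inj[OF \<pi>(1)])
  have "vertices (relabel \<pi> m) = (`) \<pi> ` vertices m"
  proof -
    have "vertices (relabel \<pi> m) = orbit (conjp \<pi> (rot m)) ` \<pi> ` darts m"
      unfolding vertices_def relabel_simps \<pi>(2) ..
    then show ?thesis unfolding vertices_def image_image orbit_conjp[OF \<pi>(1)] .
  qed
  moreover have "card (\<pi> ` v) = card v" "\<pi> a \<in> \<pi> ` v \<longleftrightarrow> a \<in> v" for v a
    using inj by (simp_all add: card_image inj_on_subset[OF inj] inj_image_mem_iff)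
  ultimately show ?thesis using inj_eq[OF inj] by (auto simp: leaves_def)
qed

text \<open>Relabelling is already free on the maps, so it stays free when a set of leaves is
  carried along, and labelled marked maps can be counted map by map.\<close>

lemma fact_num_marked:
  "fact (2 * n) * num_marked_precubic k g n f
    = (\<Sum>m\<in>precubic_maps g n f. card (leaves m) choose k)"
proof -
  let ?X = "marked_precubic_maps k g n f" and ?act = "\<lambda>\<pi> (m, L). (relabel \<pi> m, (`) \<pi> ` L)"
  have fl: "finite (leaves m)" if "m \<in> precubic_maps g n f" for m
    using precubicD(1)[OF that] by (simp add: leaves_def vertices_def)
  have X: "?X = (SIGMA m : precubic_maps g n f. {L. L \<subseteq> leaves m \<and> card L = k})"
    by (auto simp: marked_precubic_maps_def)
  have fin: "finite {L. L \<subseteq> leaves m \<and> card L = k}" if "m \<in> precubic_maps g n f" for m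
    using fl[OF that] by simp
  have cardX: "card ?X = (\<Sum>m\<in>precubic_maps g n f. card (leaves m) choose k)"
    unfolding X using fin n_subsets[OF fl] by (subst card_SigmaI) (auto simp: finite_precubic_maps)
  have finX: "finite ?X" unfolding X using fin finite_precubic_maps by blast
  have imim: "(`) \<pi> ` (`) \<sigma> ` L = (`) (\<pi> \<circ> \<sigma>) ` L" for \<pi> \<sigma> :: "nat \<Rightarrow> nat" and L
    by (simp add: image_image image_comp)
  have cl: "?act \<pi> x \<in> ?X" if \<pi>: "\<pi> permutes {..<2 * n}" and x: "x \<in> ?X" for \<pi> x
  proof -
    obtain m L where mL: "x = (m, L)" "m \<in> precubic_maps g n f" "L \<subseteq> leaves m" "card L = k"
      using x unfolding X by blast
    have b: "bij \<pi>" "\<pi> ` darts m = darts m"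
      using permutes_bij[OF \<pi>] permutes_image[OF \<pi>] precubicD(1)[OF mL(2)] by simp_all
    have "inj ((`) \<pi>)" using bij_is_inj[OF b(1)] by (simp add: inj_on_def inj_image_eq_iff)
    then have "card ((`) \<pi> ` L) = k" using mL(4) card_image[OF inj_on_subset] by blast
    then show ?thesis using relabel_precubic[OF \<pi> mL(2)] mL(3) leaves_relabel[OF b] mL(1) unfolding X by auto
  qed
  have rel: "(x, y) \<in> marked_map_iso_rel \<longleftrightarrow> (\<exists>\<pi>. \<pi> permutes {..<2 * n} \<and> y = ?act \<pi> x)"
    if "x \<in> ?X" "y \<in> ?X" for x y
  proof -
    obtain m L m' L' where x: "x = (m, L)" "m \<in> precubic_maps g n f" "L \<subseteq> leaves m"
      and y: "y = (m', L')" "m' \<in> precubic_maps g n f" using \<open>x \<in> ?X\<close> \<open>y \<in> ?X\<close> unfolding X by blast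
    have sub: "v \<subseteq> {..<2 * n}" if "v \<in> L" for v
      using that x(2,3) card_leaves(2)[of m] precubicD(1)[OF x(2)] x(2) unfolding precubic_maps_iff by force
    show ?thesis
    proof
      assume "(x, y) \<in> marked_map_iso_rel"
      then obtain h where h: "is_map_iso h m m'" "(\<lambda>v. h ` v) ` L = L'"
        unfolding x y marked_map_iso_rel_def by blast
      obtain \<pi> where \<pi>: "\<pi> permutes {..<2 * n}" "m' = relabel \<pi> m" "\<And>d. d \<in> {..<2 * n} \<Longrightarrow> \<pi> d = h d"
        by (rule is_map_iso_relabel[OF x(2) y(2) h(1)]) blast
      have "\<pi> ` v = h ` v" if "v \<in> L" for v
        using \<pi>(3) sub[OF that] by (intro image_cong) auto
      then have "(`) \<pi> ` L = L'" using h(2) by (metis (no_types, lifting) image_cong)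
      then show "\<exists>\<pi>. \<pi> permutes {..<2 * n} \<and> y = ?act \<pi> x" using \<pi>(1,2) x y by auto
    next
      assume "\<exists>\<pi>. \<pi> permutes {..<2 * n} \<and> y = ?act \<pi> x"
      then obtain \<pi> where \<pi>: "\<pi> permutes {..<2 * n}" "m' = relabel \<pi> m" "L' = (`) \<pi> ` L" using x y by auto
      have "is_map_iso \<pi> m m'" unfolding \<pi>(2) by (rule relabel_is_map_iso) (use \<pi>(1) precubicD(1)[OF x(2)] in simp)
      then show "(x, y) \<in> marked_map_iso_rel" unfolding x y marked_map_iso_rel_def using \<pi>(3) by blast
    qed
  qed
  have "card ?X = fact (card {..<2 * n}) * card (?X // Restr marked_map_iso_rel ?X)"
  proof (rule card_free_quotient[where act = ?act])
    show "?act \<pi> x \<in> ?X" if "\<pi> permutes {..<2 * n}" "x \<in> ?X" for \<pi> x by (rule cl[OF that])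
    show "?act id x = x" for x by (cases x) (simp add: relabel_id)
    show "?act \<pi> (?act \<sigma> x) = ?act (\<pi> \<circ> \<sigma>) x" if "\<pi> permutes {..<2 * n}" "\<sigma> permutes {..<2 * n}" for \<pi> \<sigma> x
      using that by (cases x) (simp only: prod.case relabel_comp permutes_bij imim)
    show "\<pi> = \<sigma>" if "\<pi> permutes {..<2 * n}" "\<sigma> permutes {..<2 * n}" "x \<in> ?X" "?act \<pi> x = ?act \<sigma> x" for \<pi> \<sigma> x
      using that relabel_free[of \<pi> n \<sigma> _ g f] unfolding X by auto
    show "(x, y) \<in> marked_map_iso_rel \<longleftrightarrow> (\<exists>\<pi>. \<pi> permutes {..<2 * n} \<and> y = ?act \<pi> x)" if "x \<in> ?X" "y \<in> ?X" for x y
      by (rule rel[OF that])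
  qed (simp_all add: finX)
  then show ?thesis unfolding cardX by (simp add: num_marked_precubic_def)
qed

text \<open>Euler's formula gives all maps with the same genus, edges and faces the same number of
  leaves.\<close>

lemma num_marked_choose:
  assumes n: "n + 6 = 2 * (l + 1) + 3 * f + 6 * g"
  shows "num_marked_precubic k g n f = (l choose k) * num_precubic g n f"
proof -
  have "card (leaves m) = l" if m: "m \<in> precubic_maps g n f" for m
  proof -
    obtain x y where "(rot m, opp m, root m) \<in> pmaps (darts m) f x y" "n + 6 = 2 * (x + y + 1) + 3 * f + 6 * g"
      using m precubicD(1)[OF m] unfolding precubic_maps_iff by auto
    then show ?thesis using card_leaves(1)[of m f x y] precubicD(1)[OF m] n by simp
  qed
  then have "fact (2 * n) * num_marked_precubic k g n f = fact (2 * n) * ((l choose k) * num_precubic g n f)"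
    unfolding fact_num_marked using fact_num_precubic[of n g f] by (simp add: mult.left_commute)
  then show ?thesis by simp
qed

section \<open>Numbers of isomorphism classes\<close>

lemma num_precubic_N:
  "real (num_precubic g n f) = (\<Sum>(x, y)\<in>{(x, y). n + 6 = 2 * (x + y + 1) + 3 * f + 6 * g}. N f n x y)"
proof -
  have "fact (2 * n) * real (num_precubic g n f) = real (fact (2 * n) * num_precubic g n f)" by simp
  also have "\<dots> = (\<Sum>(x, y)\<in>{(x, y). n + 6 = 2 * (x + y + 1) + 3 * f + 6 * g}. fact (2 * n) * N f n x y)"
    unfolding fact_num_precubic card_precubic_maps of_nat_sum
    by (intro sum.cong refl) (auto intro!: card_pmaps_N)
  also have "\<dots> = fact (2 * n) * (\<Sum>(x, y)\<in>{(x, y). n + 6 = 2 * (x + y + 1) + 3 * f + 6 * g}. N f n x y)"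
    by (simp add: sum_distrib_left case_prod_beta)
  finally show ?thesis by (simp only: mult_left_cancel[OF fact_nonzero])
qed

lemma num_precubic_two_faces:
  assumes n: "n = 2 * Suc m + 6 * g"
  shows "real (num_precubic g n 2) = two_face_total n m"
proof -
  have "{(x, y). n + 6 = 2 * (x + y + 1) + 3 * 2 + 6 * g} = {(x, y). x + y = m}" using n by auto
  then have "real (num_precubic g n 2) = (\<Sum>(x, y)\<in>{(x, y). x + y = m}. N 2 n x y)"
    unfolding num_precubic_N by (simp only:)
  also have "\<dots> = two_face_total n m"
    unfolding two_face_total_def by (rule sum.reindex_bij_witness[of _ "\<lambda>x. (x, m - x)" fst]) auto
  finally show ?thesis .
qed

lemma num_precubic_one_face:
  assumes n: "n + 1 = 2 * x + 6 * g"
  shows "real (num_precubic g n 1) = N 1 n x 0"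
proof -
  let ?P = "{(a, b). n + 6 = 2 * (a + b + 1) + 3 * 1 + 6 * g}"
  have "(\<Sum>(a, b)\<in>?P. N 1 n a b) = (\<Sum>(a, b)\<in>{(x, 0)}. N 1 n a b)"
  proof (rule sum.mono_neutral_right)
    show "finite ?P" by (rule finite_leaf_pairs)
    show "{(x, 0)} \<subseteq> ?P" using n by simp
    show "\<forall>p\<in>?P - {(x, 0)}. (case p of (a, b) \<Rightarrow> N 1 n a b) = 0"
    proof
      fix p assume p: "p \<in> ?P - {(x, 0)}"
      obtain a b where ab: "p = (a, b)" by (cases p)
      have "b > 0"
      proof (rule ccontr)
        assume "\<not> b > 0"
        then show False using p n ab by simp
      qed
      then show "(case p of (a, b) \<Rightarrow> N 1 n a b) = 0" unfolding ab prod.case by (rule N_one_face)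
    qed
  qed
  then show ?thesis unfolding num_precubic_N by simp
qed

text \<open>Either Euler's formula prescribes fewer than k leaves, or it has no solution and there
  is no map at all.\<close>

lemma num_marked_zero:
  assumes "\<And>l. n + 6 = 2 * (l + 1) + 3 * f + 6 * g \<Longrightarrow> l < k"
  shows "num_marked_precubic k g n f = 0"
proof (cases "\<exists>l. n + 6 = 2 * (l + 1) + 3 * f + 6 * g")
  case True
  then obtain l where l: "n + 6 = 2 * (l + 1) + 3 * f + 6 * g" by blast
  show ?thesis using num_marked_choose[OF l, of k] assms[OF l] by (simp add: binomial_eq_0)
next
  case False
  have "precubic_maps g n f = {}"
  proof (rule equals0I)
    fix m assume "m \<in> precubic_maps g n f"
    then obtain x y where "n + 6 = 2 * (x + y + 1) + 3 * f + 6 * g" unfolding precubic_maps_iff by blast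
    then show False using False by blast
  qed
  then show ?thesis using fact_num_marked[of n k g f] by simp
qed

lemma num_marked_one_face:
  assumes "i = 2 * x + 1 + 6 * g"
  shows "real (num_marked_precubic 1 g i 1) = B i x"
proof -
  have "num_marked_precubic 1 g i 1 = (Suc x choose 1) * num_precubic g i 1"
    by (rule num_marked_choose) (use assms in simp)
  then show ?thesis
    using num_precubic_one_face[of i "Suc x" g] assms by (simp add: B_def distrib_right)
qed

lemma num_marked_one_face_zero:
  assumes "\<And>x. i \<noteq> 2 * x + 1 + 6 * g"
  shows "num_marked_precubic 1 g i 1 = 0"
proof (rule num_marked_zero)
  fix l assume "i + 6 = 2 * (l + 1) + 3 * 1 + 6 * g"
  then have "i + 1 = 2 * l + 6 * g" by simp
  then show "l < 1" using assms[of "l - 1"] by (cases l) auto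
qed

text \<open>If i differs from 2x + 1, the genus factor is nonzero and \<open>B_genus\<close> passes
  to six edges less with the same x; below six edges \<open>B_genus_small\<close> rules this case
  out.\<close>

lemma B_genus_exists: "B i x \<noteq> 0 \<Longrightarrow> \<exists>g. i = 2 * x + 1 + 6 * g"
proof (induction i rule: less_induct)
  case (less i)
  show ?case
  proof (cases "i = 2 * x + 1")
    case True
    then show ?thesis by (intro exI[of _ 0]) simp
  next
    case False
    then have "real i \<noteq> real (2 * x + 1)" unfolding of_nat_eq_iff .
    then have ne: "(real i - 1 - 2 * real x) / 3 * B i x \<noteq> 0" using less.prems by simp
    show ?thesis
    proof (cases "i < 6")
      case True
      then show ?thesis using B_genus_small[OF True, of x] ne by blast
    next
      case False
      then obtain j where j: "i = j + 6" by (metis add.commute le_Suc_ex not_less)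
      have "B j x \<noteq> 0" using B_genus[of j x] ne unfolding j by auto
      then obtain g where "j = 2 * x + 1 + 6 * g" using less.IH[of j] j by auto
      then show ?thesis unfolding j by (intro exI[of _ "Suc g"]) simp
    qed
  qed
qed

text \<open>For a given number i of edges the genus h and the number x of leaves of the first map
  determine each other by i = 2x + 1 + 6h, so both sums run over the same pairs.\<close>

lemma marked_pair_sum:
  assumes n: "i + j = 2 * Suc m + 6 * g"
  shows "(\<Sum>h\<le>g. real (num_marked_precubic 1 h i 1) * real (num_marked_precubic 1 (g - h) j 1))
    = (\<Sum>x\<le>m. B i x * B j (m - x))"
proof -
  have L: "real (num_marked_precubic 1 h i 1) * real (num_marked_precubic 1 (g - h) j 1)
      = (\<Sum>x\<le>m. if i = 2 * x + 1 + 6 * h then B i x * B j (m - x) else 0)" if h: "h \<le> g" for h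
  proof (cases "\<exists>x\<le>m. i = 2 * x + 1 + 6 * h")
    case True
    then obtain x where x: "x \<le> m" "i = 2 * x + 1 + 6 * h" by blast
    have eq: "i = 2 * z + 1 + 6 * h \<longleftrightarrow> z = x" for z using x(2) by auto
    have "j = 2 * (m - x) + 1 + 6 * (g - h)" using n x h by simp
    then have "real (num_marked_precubic 1 (g - h) j 1) = B j (m - x)" by (rule num_marked_one_face)
    moreover have "real (num_marked_precubic 1 h i 1) = B i x" by (rule num_marked_one_face[OF x(2)])
    ultimately show ?thesis unfolding eq using x(1) by simp
  next
    case False
    \<comment> \<open>If the first map alone would need more than m further leaves, the remaining
      edges admit no second map of genus g - h with a marked leaf.\<close>
    have z: "real (num_marked_precubic 1 h i 1) * real (num_marked_precubic 1 (g - h) j 1) = 0"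
    proof (cases "\<exists>x. i = 2 * x + 1 + 6 * h")
      case True
      then obtain x where x: "i = 2 * x + 1 + 6 * h" by blast
      have "m < x"
      proof (rule ccontr)
        assume "\<not> m < x"
        then show False using False x by auto
      qed
      then have "num_marked_precubic 1 (g - h) j 1 = 0"
        by (intro num_marked_one_face_zero) (use n x h in simp)
      then show ?thesis by simp
    next
      case False
      then have "num_marked_precubic 1 h i 1 = 0" by (intro num_marked_one_face_zero) blast
      then show ?thesis by simp
    qed
    show ?thesis unfolding z by (rule sum.neutral[symmetric]) (use False in auto)
  qed
  have R: "(\<Sum>h\<le>g. if i = 2 * x + 1 + 6 * h then B i x * B j (m - x) else 0) = B i x * B j (m - x)" if x: "x \<le> m" for x
  proof (cases "B i x * B j (m - x) = 0")
    case True
    then show ?thesis unfolding True by simp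
  next
    case False
    then obtain h h' where h: "i = 2 * x + 1 + 6 * h" "j = 2 * (m - x) + 1 + 6 * h'"
      using B_genus_exists[of i x] B_genus_exists[of j "m - x"] by auto
    then have "h \<le> g" using n x by simp
    moreover have "i = 2 * x + 1 + 6 * k \<longleftrightarrow> k = h" for k using h(1) by auto
    ultimately show ?thesis by simp
  qed
  have "(\<Sum>h\<le>g. real (num_marked_precubic 1 h i 1) * real (num_marked_precubic 1 (g - h) j 1))
      = (\<Sum>h\<le>g. \<Sum>x\<le>m. if i = 2 * x + 1 + 6 * h then B i x * B j (m - x) else 0)"
    by (intro sum.cong refl L) simp
  also have "\<dots> = (\<Sum>x\<le>m. \<Sum>h\<le>g. if i = 2 * x + 1 + 6 * h then B i x * B j (m - x) else 0)"
    by (rule sum.swap)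
  also have "\<dots> = (\<Sum>x\<le>m. B i x * B j (m - x))"
    by (intro sum.cong refl R) simp
  finally show ?thesis .
qed

section \<open>The identity for two faces\<close>

lemma sum_pairs: "(\<Sum>(i, j)\<in>{(i, j). i + j = n}. h i j) = (\<Sum>i\<le>n. h i (n - i))" for n :: nat
  by (rule sum.reindex_bij_witness[of _ "\<lambda>i. (i, n - i)" fst]) auto

theorem mainTheorem6:
  fixes g n :: nat
  shows "(2 * g + 1) * num_precubic g n 2 =
    (if g = 0 then 0 else num_marked_precubic 3 (g - 1) n 2) +
    (\<Sum>(g1, g2) \<in> {(g1, g2). g1 + g2 = g}. \<Sum>(i, j) \<in> {(i, j). i + j = n}.
       num_marked_precubic 1 g1 i 1 * num_marked_precubic 1 g2 j 1)"
proof -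
  let ?u = "\<lambda>h i. num_marked_precubic 1 h i 1"
  have pairs: "(\<Sum>(g1, g2) \<in> {(g1, g2). g1 + g2 = g}. \<Sum>(i, j) \<in> {(i, j). i + j = n}. ?u g1 i * ?u g2 j)
      = (\<Sum>h\<le>g. \<Sum>i\<le>n. ?u h i * ?u (g - h) (n - i))"
    by (simp only: sum_pairs)
  show ?thesis
  \<comment> \<open>Euler's formula for two faces, with m the number of leaves besides the root. If
    it has no solution, all terms of the identity vanish.\<close>
  proof (cases "\<exists>m. n = 2 * Suc m + 6 * g")
    case True
    then obtain m where n: "n = 2 * Suc m + 6 * g" by blast
    have w: "(real n - 2 * real (Suc m)) / 3 + 1 = real (2 * g + 1)" using n by simp
    have low: "real (if g = 0 then 0 else num_marked_precubic 3 (g - 1) n 2) = real ((m + 3) choose 3) * two_face_total n (m + 3)"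
    proof (cases "g = 0")
      case True
      \<comment> \<open>The three additional leaves would require genus -1; the bound on leaves
        excludes them, in agreement with the convention for g = 0.\<close>
      then have "N 2 n x (m + 3 - x) = 0" if "x \<le> m + 3" for x
        by (intro N_two_faces_zero) (use n that in simp)
      then have "two_face_total n (m + 3) = 0" unfolding two_face_total_def by (intro sum.neutral) simp
      then show ?thesis using True by simp
    next
      case False
      have n': "n = 2 * Suc (m + 3) + 6 * (g - 1)" using n False by simp
      have "num_marked_precubic 3 (g - 1) n 2 = ((m + 3) choose 3) * num_precubic (g - 1) n 2"
        by (rule num_marked_choose) (use n' in simp)
      then show ?thesis using False num_precubic_two_faces[OF n'] by simp
    qed
    have conv: "real (\<Sum>h\<le>g. \<Sum>i\<le>n. ?u h i * ?u (g - h) (n - i)) = (\<Sum>x\<le>m. \<Sum>i\<le>n. B i x * B (n - i) (m - x))"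
    proof -
      have "real (\<Sum>h\<le>g. \<Sum>i\<le>n. ?u h i * ?u (g - h) (n - i)) = (\<Sum>i\<le>n. \<Sum>h\<le>g. real (?u h i) * real (?u (g - h) (n - i)))"
        unfolding of_nat_sum of_nat_mult by (rule sum.swap)
      also have "\<dots> = (\<Sum>i\<le>n. \<Sum>x\<le>m. B i x * B (n - i) (m - x))"
        by (intro sum.cong refl marked_pair_sum) (use n in simp)
      also have "\<dots> = (\<Sum>x\<le>m. \<Sum>i\<le>n. B i x * B (n - i) (m - x))" by (rule sum.swap)
      finally show ?thesis .
    qed
    have "real ((2 * g + 1) * num_precubic g n 2) = real (2 * g + 1) * two_face_total n m"
      unfolding of_nat_mult num_precubic_two_faces[OF n] ..
    also have "\<dots> = real ((m + 3) choose 3) * two_face_total n (m + 3) + (\<Sum>x\<le>m. \<Sum>i\<le>n. B i x * B (n - i) (m - x))"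
      unfolding w[symmetric] by (rule two_face_total_eq) (use n in simp_all)
    also have "\<dots> = real ((if g = 0 then 0 else num_marked_precubic 3 (g - 1) n 2)
        + (\<Sum>h\<le>g. \<Sum>i\<le>n. ?u h i * ?u (g - h) (n - i)))"
      unfolding of_nat_add low conv ..
    finally show ?thesis unfolding pairs by (simp only: of_nat_eq_iff)
  next
    case False
    \<comment> \<open>Marking no leaf counts the maps themselves, so the vanishing result for marked
      maps applies with k = 0.\<close>
    have "num_marked_precubic 0 g n 2 = 0"
      by (rule num_marked_zero) (use False in auto)
    moreover have "num_marked_precubic 0 g n 2 = num_precubic g n 2"
    proof -
      have "fact (2 * n) * num_marked_precubic 0 g n 2 = fact (2 * n) * num_precubic g n 2"
        unfolding fact_num_marked fact_num_precubic by simp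
      then show ?thesis by simp
    qed
    ultimately have "num_precubic g n 2 = 0" by simp
    moreover have "num_marked_precubic 3 (g - 1) n 2 = 0" if "g \<noteq> 0"
    proof (rule num_marked_zero, rule ccontr)
      fix l assume l: "n + 6 = 2 * (l + 1) + 3 * 2 + 6 * (g - 1)" "\<not> l < 3"
      then have "n = 2 * Suc (l - 3) + 6 * g" using that by simp
      then show False using False by blast
    qed
    moreover have "?u h i * ?u (g - h) (n - i) = 0" if "h \<le> g" "i \<le> n" for h i
    proof (rule ccontr)
      assume a: "?u h i * ?u (g - h) (n - i) \<noteq> 0"
      then obtain x y where "i = 2 * x + 1 + 6 * h" "n - i = 2 * y + 1 + 6 * (g - h)"
        using num_marked_one_face_zero[of i h] num_marked_one_face_zero[of "n - i" "g - h"] by auto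
      then have "n = 2 * Suc (x + y) + 6 * g" using that by simp
      then show False using False by blast
    qed
    ultimately show ?thesis unfolding pairs by simp
  qed
qed

end
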